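(* For any $z=\lambda\pm i0$ with $\lambda$ essentially regular, for any real resonance point $r_\lambda\in\mathbb R$ with property $C$ corresponding to $z$ (of a line $\{H_r=H_0+rV\}$ regular at $\lambda$) and for any $j=1,2,3,\ldots$: (1) the restriction of the idempotent operator $P_{\lambda\pm i0}(r_\lambda)$ to $\Upsilon^j_{\lambda\mp i0}(r_\lambda)$ is a linear isomorphism of the vector spaces $\Upsilon^j_{\lambda\mp i0}(r_\lambda)$ and $\Upsilon^j_{\lambda\pm i0}(r_\lambda)$; and (2) the idempotent $Q_{\lambda\pm i0}(r_\lambda)$ is a linear isomorphism of the vector spaces $\Psi^j_{\lambda\mp i0}(r_\lambda)$ and $\Psi^j_{\lambda\pm i0}(r_\lambda)$. In other words, for points $r_\lambda$ with property $C$ and all $j=1,2,3,\ldots$, the maps $J:\Upsilon^j_{\lambda\pm i0}(r_\lambda)\to\Psi^j_{\lambda\pm i0}(r_\lambda)$, $P_{\lambda\pm i0}(r_\lambda):\Upsilon^j_{\lambda\mp i0}(r_\lambda)\to\Upsilon^j_{\lambda\pm i0}(r_\lambda)$ and $Q_{\lambda\pm i0}(r_\lambda):\Psi^j_{\lambda\mp i0}(r_\lambda)\to\Psi^j_{\lambda\pm i0}(r_\lambda)$ are linear isomorphisms, and the squares they form commute: $Q_{\lambda\pm i0}(r_\lambda)J=JP_{\lambda\pm i0}(r_\lambda)$ on $\Upsilon^j_{\lambda\mp i0}(r_\lambda)$.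
   Context: Setting. $\mathcal H,\mathcal K$ are complex separable Hilbert spaces. $F:\mathcal H\to\mathcal K$ is a closed densely defined operator with trivial kernel and co-kernel. $\{H_r=H_0+rV:r\in\mathbb R\}$ is a line of self-adjoint operators on $\mathcal H$, $V=F^*JF$ self-adjoint with $J$ bounded self-adjoint on $\mathcal K$. Standing assumptions: all $H_r$ have a common dense domain $\mathcal D$, $\mathcal D\subset\operatorname{dom}(F)\cap\operatorname{dom}(V)$, $V$ is relatively compact with respect to each $H_r$, and for non-real $z$ the operator $T_z(H_r):=F(H_r-z)^{-1}F^*$ (densely defined on $\operatorname{dom}F^*$) extends to a compact operator on $\mathcal K$, also denoted $T_z(H_r)$. $\Lambda(H_r,F)$ is the set of real $\lambda$ for which the norm limits $T_{\lambda\pm i0}(H_r):=\lim_{y\to0^+}T_{\lambda\pm iy}(H_r)$ exist (assumed of full Lebesgue measure). It is assumed that $\lambda\in\Lambda(H_r,F)$ for some real $r$ (that is, the line is regular at $\lambda$); a real $r$ is non-resonant if $\lambda\in\Lambda(H_r,F)$, otherwise it is a real resonance point. For $z=\lambda\pm i0$ and non-resonant $s$ put $A_z(s)=T_z(H_s)J$ and $B_z(s)=JT_z(H_s)$; as functions of $s$ they extend meromorphically to $\mathbb C$, their real poles being the real resonance points. For such a pole $r_\lambda$ (all objects below are independent of the non-resonant real $s$): $\Upsilon^j_z(r_\lambda)=\{u\in\mathcal K:(1+(r_\lambda-s)A_z(s))^ju=0\}$, $\Upsilon_z(r_\lambda)=\bigcup_j\Upsilon^j_z(r_\lambda)$, $\Psi^j_z(r_\lambda)=\{\psi\in\mathcal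 K:(1+(r_\lambda-s)B_z(s))^j\psi=0\}$; $P_z(r_\lambda)=\frac1{2\pi i}\oint_{C(r_\lambda)}A_z(s)\,ds$, $Q_z(r_\lambda)=\frac1{2\pi i}\oint_{C(r_\lambda)}B_z(s)\,ds$, $\mathbf A_z(r_\lambda)=\frac1{2\pi i}\oint_{C(r_\lambda)}(s-r_\lambda)A_z(s)\,ds$, with $C(r_\lambda)$ a small counter-clockwise circle around $r_\lambda$ enclosing no other poles. $P_z$, $Q_z$ are finite-rank idempotents, and $\mathbf A_z(r_\lambda)$ is nilpotent on the finite-dimensional space $\Upsilon_z(r_\lambda)=\operatorname{im}P_z(r_\lambda)$. Let $m=\dim\Upsilon^1_{\lambda\pm i0}(r_\lambda)$ (the same for both signs). A Jordan decomposition of $\Upsilon_z(r_\lambda)$ is a direct sum decomposition $\Upsilon_z(r_\lambda)=\Upsilon_z^{[1]}(r_\lambda)\dotplus\ldots\dotplus\Upsilon_z^{[m]}(r_\lambda)$ coming from a Jordan basis $(u_\nu^{(j)})$, $\nu=1,\ldots,m$, $j=1,\ldots,d_\nu$, $d_1\ge\ldots\ge d_m$, of $\Upsilon_z(r_\lambda)$ (that is, $\mathbf A_z(r_\lambda)u^{(j)}_\nu=u^{(j-1)}_\nu$, $u^{(0)}_\nu=0$), where $\Upsilon_z^{[\nu]}(r_\lambda)$ is the linear span of $u_\nu^{(1)},\ldots,u_\nu^{(d_\nu)}$. The point $r_\lambda$ has property $C$ if $\Upsilon_{\lambda+i0}(r_\lambda)$ and $\Upsilon_{\lambda-i0}(r_\lambda)$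 admit Jordan decompositions such that for all $\nu=1,\ldots,m$: $P_{\lambda+i0}(r_\lambda)\Upsilon^{[\nu]}_{\lambda-i0}(r_\lambda)=\Upsilon^{[\nu]}_{\lambda+i0}(r_\lambda)$ and $P_{\lambda-i0}(r_\lambda)\Upsilon^{[\nu]}_{\lambda+i0}(r_\lambda)=\Upsilon^{[\nu]}_{\lambda-i0}(r_\lambda)$. *)

theory Defs
  imports "HOL-Complex_Analysis.Complex_Analysis"
begin

section \<open>Complex separable Hilbert spaces\<close>

class scaleC =
  fixes scaleC :: "complex \<Rightarrow> 'a \<Rightarrow> 'a" (infixr "*\<^sub>C" 75)

text \<open>
  The norm is the one of \<^class>\<open>real_inner\<close>, so the last axiom says that it is induced by the
  sesquilinear form \<open>cinner\<close> (conjugate-linear in the first argument).  For metric spaces second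
  countability is separability.
\<close>

class complex_hilbert_space = real_inner + complete_space + second_countable_topology + scaleC +
  fixes cinner :: "'a \<Rightarrow> 'a \<Rightarrow> complex"
  assumes scaleC_add_right: "a *\<^sub>C (x + y) = a *\<^sub>C x + a *\<^sub>C y"
    and scaleC_add_left: "(a + b) *\<^sub>C x = a *\<^sub>C x + b *\<^sub>C x"
    and scaleC_scaleC: "a *\<^sub>C (b *\<^sub>C x) = (a * b) *\<^sub>C x"
    and scaleC_of_real: "complex_of_real r *\<^sub>C x = r *\<^sub>R x"
    and cinner_commute: "cinner x y = cnj (cinner y x)"
    and cinner_add_right: "cinner x (y + w) = cinner x y + cinner x w"
    and cinner_scaleC_right: "cinner x (a *\<^sub>C y) = a * cinner x y"
    and inner_eq_Re_cinner: "inner x y = Re (cinner x y)"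

global_interpretation complex_vector: vector_space "scaleC :: complex \<Rightarrow> 'a \<Rightarrow> 'a::complex_hilbert_space"
proof
  show "1 *\<^sub>C x = x" for x :: 'a
    using scaleC_of_real[of 1 x] by simp
qed (simp_all add: scaleC_add_right scaleC_add_left scaleC_scaleC)

lemma norm_scaleC: "norm (a *\<^sub>C x) = cmod a * norm x" for x :: "'a::complex_hilbert_space"
proof -
  have l: "cinner (a *\<^sub>C x) y = cnj a * cinner x y" for y
    by (metis cinner_commute cinner_scaleC_right complex_cnj_mult)
  have im: "Im (cinner x x) = 0"
    using cinner_commute[of x x] by (metis add.inverse_unique cnj.sel(2) neg_equal_zero)
  have "inner (a *\<^sub>C x) (a *\<^sub>C x) = Re (cnj a * a * cinner x x)"
    by (simp add: inner_eq_Re_cinner l cinner_scaleC_right algebra_simps)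
  also have "cnj a * a = complex_of_real ((cmod a)\<^sup>2)"
    by (metis complex_norm_square mult.commute)
  finally have "inner (a *\<^sub>C x) (a *\<^sub>C x) = (cmod a)\<^sup>2 * inner x x"
    by (simp add: inner_eq_Re_cinner)
  then show ?thesis
    by (simp add: norm_eq_sqrt_inner real_sqrt_mult)
qed

lemma bounded_linear_scaleC: "bounded_linear (\<lambda>x::'a::complex_hilbert_space. a *\<^sub>C x)"
proof
  show "a *\<^sub>C (x + y) = a *\<^sub>C x + a *\<^sub>C y" for x y :: 'a
    by (rule scaleC_add_right)
  show "a *\<^sub>C (r *\<^sub>R x) = r *\<^sub>R (a *\<^sub>C x)" for r and x :: 'a
    by (simp add: scaleC_of_real[symmetric] scaleC_scaleC mult.commute)
  show "\<exists>K. \<forall>x::'a. norm (a *\<^sub>C x) \<le> norm x * K"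
    by (metis norm_scaleC mult.commute order_refl)
qed

definition clinear_iso_betw ::
    "('a::complex_hilbert_space \<Rightarrow> 'b::complex_hilbert_space) \<Rightarrow> 'a set \<Rightarrow> 'b set \<Rightarrow> bool" where
  "clinear_iso_betw f U W \<longleftrightarrow>
     complex_vector.subspace U \<and> complex_vector.subspace W \<and>
     (\<forall>x\<in>U. \<forall>y\<in>U. f (x + y) = f x + f y) \<and> (\<forall>a. \<forall>x\<in>U. f (a *\<^sub>C x) = a *\<^sub>C f x) \<and>
     bij_betw f U W"


section \<open>Unbounded operators\<close>

text \<open>
  An unbounded operator is identified with its graph.  The relational composition \<open>G O G'\<close> applies
  \<open>G\<close> first, and \<open>Domain\<close> is the domain of the operator.
\<close>

definition linear_operator ::
    "('a::complex_hilbert_space \<times> 'b::complex_hilbert_space) set \<Rightarrow> bool" where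
  "linear_operator G \<longleftrightarrow>
     single_valued G \<and> (0, 0) \<in> G \<and>
     (\<forall>(x, u)\<in>G. \<forall>(y, v)\<in>G. (x + y, u + v) \<in> G) \<and>
     (\<forall>a. \<forall>(x, u)\<in>G. (a *\<^sub>C x, a *\<^sub>C u) \<in> G)"

definition densely_defined :: "('a::topological_space \<times> 'b) set \<Rightarrow> bool" where
  "densely_defined G \<longleftrightarrow> closure (Domain G) = UNIV"

definition kernel :: "('a \<times> 'b::zero) set \<Rightarrow> 'a set" where
  "kernel G = {x. (x, 0) \<in> G}"

definition adjoint_op ::
    "('a::complex_hilbert_space \<times> 'b::complex_hilbert_space) set \<Rightarrow> ('b \<times> 'a) set" where
  "adjoint_op G = {(y, w). \<forall>(x, u)\<in>G. cinner u y = cinner x w}"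

definition self_adjoint :: "('a::complex_hilbert_space \<times> 'a) set \<Rightarrow> bool" where
  "self_adjoint G \<longleftrightarrow> linear_operator G \<and> densely_defined G \<and> adjoint_op G = G"

definition op_graph ::
    "('a::complex_hilbert_space \<Rightarrow>\<^sub>L 'b::complex_hilbert_space) \<Rightarrow> ('a \<times> 'b) set" where
  "op_graph T = {(x, blinfun_apply T x) | x. True}"

definition resolvent ::
    "('a::complex_hilbert_space \<times> 'a) set \<Rightarrow> complex \<Rightarrow> ('a \<times> 'a) set" where
  "resolvent H z = {(y - z *\<^sub>C x, x) | x y. (x, y) \<in> H}"

definition compact_op ::
    "('a::complex_hilbert_space \<times> 'b::complex_hilbert_space) set \<Rightarrow> bool" where
  "compact_op G \<longleftrightarrow> linear_operator G \<and> Domain G = UNIV \<and> compact (closure (G `` cball 0 1))"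

definition relatively_compact ::
    "('a::complex_hilbert_space \<times> 'a) set \<Rightarrow> ('a \<times> 'a) set \<Rightarrow> bool" where
  "relatively_compact V H \<longleftrightarrow>
     Domain H \<subseteq> Domain V \<and> (\<forall>z. Im z \<noteq> 0 \<longrightarrow> compact_op (resolvent H z O V))"


section \<open>Operator-valued functions of a complex variable\<close>

text \<open>
  \<^typ>\<open>'a \<Rightarrow>\<^sub>L 'b\<close> consists of the real-linear bounded operators; with \<open>cscale\<close> as scalar
  multiplication it is a complex Banach space containing the complex-linear ones.
\<close>

definition cscale :: "complex \<Rightarrow> ('a::complex_hilbert_space \<Rightarrow>\<^sub>L 'b::complex_hilbert_space) \<Rightarrow> ('a \<Rightarrow>\<^sub>L 'b)" where
  "cscale c T = Blinfun (\<lambda>x. c *\<^sub>C blinfun_apply T x)"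

lemma blinfun_apply_cscale [simp]: "blinfun_apply (cscale c T) x = c *\<^sub>C blinfun_apply T x"
proof -
  have "bounded_linear (\<lambda>x. c *\<^sub>C blinfun_apply T x)"
    by (rule bounded_linear_compose[OF bounded_linear_scaleC blinfun.bounded_linear_right])
  then show ?thesis
    by (simp add: cscale_def bounded_linear_Blinfun_apply)
qed

definition op_holomorphic_on ::
    "(complex \<Rightarrow> 'a::complex_hilbert_space \<Rightarrow>\<^sub>L 'b::complex_hilbert_space) \<Rightarrow> complex set \<Rightarrow> bool" where
  "op_holomorphic_on f S \<longleftrightarrow> (\<forall>z\<in>S. \<exists>D. (f has_derivative (\<lambda>h. cscale h D)) (at z within S))"

text \<open>As for \<open>meromorphic_on\<close>, the values at the poles are irrelevant.\<close>

definition op_meromorphic ::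
    "(complex \<Rightarrow> 'a::complex_hilbert_space \<Rightarrow>\<^sub>L 'b::complex_hilbert_space) \<Rightarrow> bool" where
  "op_meromorphic f \<longleftrightarrow>
     (\<forall>z. \<exists>n g. \<exists>e>0. op_holomorphic_on g (ball z e) \<and>
        (\<forall>w\<in>ball z e - {z}. f w = cscale (inverse ((w - z) ^ n)) (g w)))"

definition meromorphic_extension ::
    "real set \<Rightarrow> (real \<Rightarrow> 'a::complex_hilbert_space \<Rightarrow>\<^sub>L 'b::complex_hilbert_space) \<Rightarrow>
     complex \<Rightarrow> 'a \<Rightarrow>\<^sub>L 'b" where
  "meromorphic_extension S f =
     (SOME g. op_meromorphic g \<and> (\<forall>s\<in>S. g (complex_of_real s) = f s))"

text \<open>The next two definitions are \<open>has_contour_integral\<close> and \<open>residue\<close> for operator-valued functions.\<close>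

definition has_op_contour_integral ::
    "(complex \<Rightarrow> 'a::complex_hilbert_space \<Rightarrow>\<^sub>L 'b::complex_hilbert_space) \<Rightarrow> ('a \<Rightarrow>\<^sub>L 'b) \<Rightarrow>
     (real \<Rightarrow> complex) \<Rightarrow> bool" where
  "has_op_contour_integral f I g \<longleftrightarrow>
     ((\<lambda>t. cscale (vector_derivative g (at t within {0..1})) (f (g t))) has_integral I) {0..1}"

definition op_residue ::
    "(complex \<Rightarrow> 'a::complex_hilbert_space \<Rightarrow>\<^sub>L 'b::complex_hilbert_space) \<Rightarrow> complex \<Rightarrow> 'a \<Rightarrow>\<^sub>L 'b" where
  "op_residue f z =
     (SOME R. \<exists>e>0. \<forall>\<epsilon>>0. \<epsilon> < e \<longrightarrow>
        has_op_contour_integral f (cscale (2 * pi * \<i>) R) (circlepath z \<epsilon>))"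


section \<open>Lines of self-adjoint operators\<close>

definition perturbation ::
    "('h::complex_hilbert_space \<times> 'k::complex_hilbert_space) set \<Rightarrow> ('k \<Rightarrow>\<^sub>L 'k) \<Rightarrow> ('h \<times> 'h) set" where
  "perturbation F J = F O op_graph J O adjoint_op F"

definition line_op ::
    "('h::complex_hilbert_space \<times> 'k::complex_hilbert_space) set \<Rightarrow> ('k \<Rightarrow>\<^sub>L 'k) \<Rightarrow> ('h \<times> 'h) set \<Rightarrow>
     real \<Rightarrow> ('h \<times> 'h) set" where
  "line_op F J H\<^sub>0 r = {(x, y + r *\<^sub>R v) | x y v. (x, y) \<in> H\<^sub>0 \<and> (x, v) \<in> perturbation F J}"

text \<open>\<open>T\<^sub>z(H)\<close>: the bounded extension of \<open>F (H - z)\<^sup>-\<^sup>1 F\<^sup>*\<close>, unique because \<open>F\<^sup>*\<close> is densely defined.\<close>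

definition sandwiched_resolvent ::
    "('h::complex_hilbert_space \<times> 'k::complex_hilbert_space) set \<Rightarrow> ('h \<times> 'h) set \<Rightarrow> complex \<Rightarrow>
     'k \<Rightarrow>\<^sub>L 'k" where
  "sandwiched_resolvent F H z = (THE T. adjoint_op F O resolvent H z O F \<subseteq> op_graph T)"

text \<open>
  From here on the sign \<open>\<sigma> \<in> {1, -1}\<close> encodes the boundary point \<open>lam + \<sigma>i0\<close>.
\<close>

definition regular_points ::
    "('h::complex_hilbert_space \<times> 'k::complex_hilbert_space) set \<Rightarrow> ('h \<times> 'h) set \<Rightarrow> real set" where
  "regular_points F H =
     {lam. \<forall>\<sigma>\<in>{1, -1}. \<exists>T. ((\<lambda>y. sandwiched_resolvent F H (Complex lam (\<sigma> * y))) \<longlongrightarrow> T) (at_right 0)}"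

definition boundary_resolvent ::
    "('h::complex_hilbert_space \<times> 'k::complex_hilbert_space) set \<Rightarrow> ('h \<times> 'h) set \<Rightarrow> real \<Rightarrow> real \<Rightarrow>
     'k \<Rightarrow>\<^sub>L 'k" where
  "boundary_resolvent F H lam \<sigma> =
     Lim (at_right 0) (\<lambda>y. sandwiched_resolvent F H (Complex lam (\<sigma> * y)))"

locale resonance_line =
  fixes F :: "('h::complex_hilbert_space \<times> 'k::complex_hilbert_space) set"
    and J :: "'k \<Rightarrow>\<^sub>L 'k"
    and H\<^sub>0 :: "('h \<times> 'h) set"
    and D :: "'h set"
  assumes linear_F: "linear_operator F"
    and closed_F: "closed F"
    and dense_F: "densely_defined F"
    and kernel_F: "kernel F = {0}"
    and cokernel_F: "kernel (adjoint_op F) = {0}"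
    and self_adjoint_J: "self_adjoint (op_graph J)"
    and self_adjoint_V: "self_adjoint (perturbation F J)"
    and self_adjoint_H0: "self_adjoint H\<^sub>0"
    and self_adjoint_line: "\<And>r. self_adjoint (line_op F J H\<^sub>0 r)"
    and domain_H0: "Domain H\<^sub>0 = D"
    and common_domain: "\<And>r. Domain (line_op F J H\<^sub>0 r) = D"
    and dense_D: "closure D = UNIV"
    and D_subset: "D \<subseteq> Domain F \<inter> Domain (perturbation F J)"
    and relatively_compact_V: "\<And>r. relatively_compact (perturbation F J) (line_op F J H\<^sub>0 r)"
    and compact_sandwiched_resolvent:
      "\<And>r z. Im z \<noteq> 0 \<Longrightarrow>
         \<exists>T. compact_op (op_graph T) \<and> adjoint_op F O resolvent (line_op F J H\<^sub>0 r) z O F \<subseteq> op_graph T"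
    and full_measure_regular_points: "\<And>r. negligible (- regular_points F (line_op F J H\<^sub>0 r))"


section \<open>Resonance points\<close>

definition nonresonant_points ::
    "('h::complex_hilbert_space \<times> 'k::complex_hilbert_space) set \<Rightarrow> ('k \<Rightarrow>\<^sub>L 'k) \<Rightarrow> ('h \<times> 'h) set \<Rightarrow>
     real \<Rightarrow> real set" where
  "nonresonant_points F J H\<^sub>0 lam = {r. lam \<in> regular_points F (line_op F J H\<^sub>0 r)}"

definition A_op ::
    "('h::complex_hilbert_space \<times> 'k::complex_hilbert_space) set \<Rightarrow> ('k \<Rightarrow>\<^sub>L 'k) \<Rightarrow> ('h \<times> 'h) set \<Rightarrow>
     real \<Rightarrow> real \<Rightarrow> real \<Rightarrow> 'k \<Rightarrow>\<^sub>L 'k" where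
  "A_op F J H\<^sub>0 lam \<sigma> s = boundary_resolvent F (line_op F J H\<^sub>0 s) lam \<sigma> o\<^sub>L J"

definition B_op ::
    "('h::complex_hilbert_space \<times> 'k::complex_hilbert_space) set \<Rightarrow> ('k \<Rightarrow>\<^sub>L 'k) \<Rightarrow> ('h \<times> 'h) set \<Rightarrow>
     real \<Rightarrow> real \<Rightarrow> real \<Rightarrow> 'k \<Rightarrow>\<^sub>L 'k" where
  "B_op F J H\<^sub>0 lam \<sigma> s = J o\<^sub>L boundary_resolvent F (line_op F J H\<^sub>0 s) lam \<sigma>"

definition A_ext ::
    "('h::complex_hilbert_space \<times> 'k::complex_hilbert_space) set \<Rightarrow> ('k \<Rightarrow>\<^sub>L 'k) \<Rightarrow> ('h \<times> 'h) set \<Rightarrow>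
     real \<Rightarrow> real \<Rightarrow> complex \<Rightarrow> 'k \<Rightarrow>\<^sub>L 'k" where
  "A_ext F J H\<^sub>0 lam \<sigma> = meromorphic_extension (nonresonant_points F J H\<^sub>0 lam) (A_op F J H\<^sub>0 lam \<sigma>)"

definition B_ext ::
    "('h::complex_hilbert_space \<times> 'k::complex_hilbert_space) set \<Rightarrow> ('k \<Rightarrow>\<^sub>L 'k) \<Rightarrow> ('h \<times> 'h) set \<Rightarrow>
     real \<Rightarrow> real \<Rightarrow> complex \<Rightarrow> 'k \<Rightarrow>\<^sub>L 'k" where
  "B_ext F J H\<^sub>0 lam \<sigma> = meromorphic_extension (nonresonant_points F J H\<^sub>0 lam) (B_op F J H\<^sub>0 lam \<sigma>)"

text \<open>
  \<open>Upsilon_j\<close> and \<open>Psi_j\<close> do not depend on the non-resonant point \<open>s\<close>; requiring the equation for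
  all such \<open>s\<close> avoids choosing one.
\<close>

definition Upsilon_j ::
    "('h::complex_hilbert_space \<times> 'k::complex_hilbert_space) set \<Rightarrow> ('k \<Rightarrow>\<^sub>L 'k) \<Rightarrow> ('h \<times> 'h) set \<Rightarrow>
     real \<Rightarrow> real \<Rightarrow> real \<Rightarrow> nat \<Rightarrow> 'k set" where
  "Upsilon_j F J H\<^sub>0 lam \<sigma> r j =
     {u. \<forall>s\<in>nonresonant_points F J H\<^sub>0 lam.
           (blinfun_apply (id_blinfun + (r - s) *\<^sub>R A_op F J H\<^sub>0 lam \<sigma> s) ^^ j) u = 0}"

definition Psi_j ::
    "('h::complex_hilbert_space \<times> 'k::complex_hilbert_space) set \<Rightarrow> ('k \<Rightarrow>\<^sub>L 'k) \<Rightarrow> ('h \<times> 'h) set \<Rightarrow>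
     real \<Rightarrow> real \<Rightarrow> real \<Rightarrow> nat \<Rightarrow> 'k set" where
  "Psi_j F J H\<^sub>0 lam \<sigma> r j =
     {\<psi>. \<forall>s\<in>nonresonant_points F J H\<^sub>0 lam.
           (blinfun_apply (id_blinfun + (r - s) *\<^sub>R B_op F J H\<^sub>0 lam \<sigma> s) ^^ j) \<psi> = 0}"

definition Upsilon ::
    "('h::complex_hilbert_space \<times> 'k::complex_hilbert_space) set \<Rightarrow> ('k \<Rightarrow>\<^sub>L 'k) \<Rightarrow> ('h \<times> 'h) set \<Rightarrow>
     real \<Rightarrow> real \<Rightarrow> real \<Rightarrow> 'k set" where
  "Upsilon F J H\<^sub>0 lam \<sigma> r = (\<Union>j. Upsilon_j F J H\<^sub>0 lam \<sigma> r j)"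

definition P_idem ::
    "('h::complex_hilbert_space \<times> 'k::complex_hilbert_space) set \<Rightarrow> ('k \<Rightarrow>\<^sub>L 'k) \<Rightarrow> ('h \<times> 'h) set \<Rightarrow>
     real \<Rightarrow> real \<Rightarrow> real \<Rightarrow> 'k \<Rightarrow>\<^sub>L 'k" where
  "P_idem F J H\<^sub>0 lam \<sigma> r = op_residue (A_ext F J H\<^sub>0 lam \<sigma>) (complex_of_real r)"

definition Q_idem ::
    "('h::complex_hilbert_space \<times> 'k::complex_hilbert_space) set \<Rightarrow> ('k \<Rightarrow>\<^sub>L 'k) \<Rightarrow> ('h \<times> 'h) set \<Rightarrow>
     real \<Rightarrow> real \<Rightarrow> real \<Rightarrow> 'k \<Rightarrow>\<^sub>L 'k" where
  "Q_idem F J H\<^sub>0 lam \<sigma> r = op_residue (B_ext F J H\<^sub>0 lam \<sigma>) (complex_of_real r)"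

definition A_nil ::
    "('h::complex_hilbert_space \<times> 'k::complex_hilbert_space) set \<Rightarrow> ('k \<Rightarrow>\<^sub>L 'k) \<Rightarrow> ('h \<times> 'h) set \<Rightarrow>
     real \<Rightarrow> real \<Rightarrow> real \<Rightarrow> 'k \<Rightarrow>\<^sub>L 'k" where
  "A_nil F J H\<^sub>0 lam \<sigma> r =
     op_residue (\<lambda>s. cscale (s - complex_of_real r) (A_ext F J H\<^sub>0 lam \<sigma> s)) (complex_of_real r)"


section \<open>Jordan decompositions and property C\<close>

definition jordan_basis ::
    "('k::complex_hilbert_space \<Rightarrow> 'k) \<Rightarrow> 'k set \<Rightarrow> nat \<Rightarrow> (nat \<Rightarrow> nat) \<Rightarrow> (nat \<Rightarrow> nat \<Rightarrow> 'k) \<Rightarrow> bool" where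
  "jordan_basis N W m d u \<longleftrightarrow>
     (\<forall>\<nu>\<in>{1..m}. 1 \<le> d \<nu>) \<and>
     (\<forall>\<mu>\<in>{1..m}. \<forall>\<nu>\<in>{1..m}. \<mu> \<le> \<nu> \<longrightarrow> d \<nu> \<le> d \<mu>) \<and>
     inj_on (\<lambda>(\<nu>, j). u \<nu> j) (SIGMA \<nu>:{1..m}. {1..d \<nu>}) \<and>
     complex_vector.independent ((\<lambda>(\<nu>, j). u \<nu> j) ` (SIGMA \<nu>:{1..m}. {1..d \<nu>})) \<and>
     complex_vector.span ((\<lambda>(\<nu>, j). u \<nu> j) ` (SIGMA \<nu>:{1..m}. {1..d \<nu>})) = W \<and>
     (\<forall>\<nu>\<in>{1..m}. u \<nu> 0 = 0 \<and> (\<forall>j\<in>{1..d \<nu>}. N (u \<nu> j) = u \<nu> (j - 1)))"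

definition jordan_decomposition ::
    "('k::complex_hilbert_space \<Rightarrow> 'k) \<Rightarrow> 'k set \<Rightarrow> nat \<Rightarrow> (nat \<Rightarrow> 'k set) \<Rightarrow> bool" where
  "jordan_decomposition N W m Y \<longleftrightarrow>
     (\<exists>d u. jordan_basis N W m d u \<and>
        (\<forall>\<nu>\<in>{1..m}. Y \<nu> = complex_vector.span (u \<nu> ` {1..d \<nu>})))"

text \<open>The dimension \<open>m\<close> of \<open>Upsilon_j F J H\<^sub>0 lam \<sigma> r 1\<close> is the same for both signs \<open>\<sigma>\<close>.\<close>

definition property_C ::
    "('h::complex_hilbert_space \<times> 'k::complex_hilbert_space) set \<Rightarrow> ('k \<Rightarrow>\<^sub>L 'k) \<Rightarrow> ('h \<times> 'h) set \<Rightarrow>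
     real \<Rightarrow> real \<Rightarrow> bool" where
  "property_C F J H\<^sub>0 lam r \<longleftrightarrow>
     (let m = complex_vector.dim (Upsilon_j F J H\<^sub>0 lam 1 r 1) in
      \<exists>Y. (\<forall>\<sigma>\<in>{1, -1}.
              jordan_decomposition (A_nil F J H\<^sub>0 lam \<sigma> r) (Upsilon F J H\<^sub>0 lam \<sigma> r) m (Y \<sigma>)) \<and>
          (\<forall>\<sigma>\<in>{1, -1}. \<forall>\<nu>\<in>{1..m}. P_idem F J H\<^sub>0 lam \<sigma> r ` Y (- \<sigma>) \<nu> = Y \<sigma> \<nu>))"

end

theory Submission
  imports Defs
begin

text \<open>
  Write \<open>[u, v] = (u, J v)\<close> and let \<open>N\<^sub>\<plusminus>\<close> be the nilpotent parts on \<open>\<Upsilon>\<^sub>\<plusminus> = im P\<^sub>\<plusminus>\<close>.  The second resolvent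
  identity turns \<open>A(s)\<close> into \<open>(1 + (s - s0) A(s0))\<^sup>-\<^sup>1 A(s0)\<close>, so that Riesz theory of the compact
  operator \<open>A(s0)\<close> provides the meromorphic extension and identifies \<open>P\<^sub>\<plusminus>\<close> with the Riesz projections.
  The operators of the two signs are adjoint to each other with respect to \<open>[\<cdot>, \<cdot>]\<close>, and \<open>Im T\<^sub>+ \<ge> 0\<close>
  makes \<open>N\<^sub>+\<close> and \<open>- N\<^sub>-\<close> dissipative.  If \<open>y\<^sub>1, \<dots>, y\<^sub>n\<close> is a Jordan chain of one sign, then
  \<open>Im [y\<^sub>i, N y\<^sub>i] = 0\<close> for \<open>2 i \<le> n + 1\<close>, so the lower half of the chain belongs to both \<open>\<Upsilon>\<^sub>+\<close> and
  \<open>\<Upsilon>\<^sub>-\<close>, where \<open>N\<^sub>+\<close> and \<open>N\<^sub>-\<close> agree.  Property C keeps the defect \<open>N\<^sub>+ P\<^sub>+ e - P\<^sub>+ N\<^sub>- e\<close> of a vector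
  \<open>e\<close> of a block of \<open>\<Upsilon>\<^sub>-\<close> inside the corresponding block of \<open>\<Upsilon>\<^sub>+\<close>; pairing it with the vectors of
  \<open>\<Upsilon>\<^sub>-\<close> that are dual to the upper half of this block shows that it lies in the lower half.  Hence
  \<open>P\<^sub>+\<close> respects the filtration by order.  The statements on \<open>\<Psi>\<close> follow by transport along \<open>J\<close>.
\<close>

text \<open>The obstacle is that \<open>P_+\<close> need not intertwine \<open>N_-\<close> with
  \<open>N_+\<close>. The two operators are only known to agree on lower halves of chains, so two
  half ranges have to fit together. In a chain \<open>e_1, ..., e_d\<close> of \<open>N_-\<close>,
  the vectors with \<open>2 k <= d + 1\<close> are fixed by \<open>P_+\<close>. For larger
  \<open>k\<close> the defect \<open>y\<close> has to be killed by a power \<open>N_+^q\<close>.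
  Pairing \<open>N_+^q y\<close> with \<open>w\<close> is pairing \<open>y\<close> with
  \<open>N_-^q w\<close>, and this last vector is in a lower half as soon as
  \<open>N_-^n w = 0\<close> with \<open>n <= 2 q + 1\<close>. If \<open>w\<close> annihilates all
  blocks but one, then \<open>n\<close> can be taken to be the length of that block. This is the use
  of property C: without it the defect would have to be tested against longer chains. Property C
  also gives the comparison of block lengths that makes the two ranges of \<open>k\<close> meet.
  Bijectivity on each kernel then follows from injective maps in both directions between
  finite-dimensional spaces.\<close>

instance complex_hilbert_space \<subseteq> banach ..

section \<open>Elementary rules for the sesquilinear form\<close>

lemma scaleC_scaleR_commute: "a *\<^sub>C (r *\<^sub>R x) = r *\<^sub>R (a *\<^sub>C x)" for x :: "'a::complex_hilbert_space"
  by (simp add: scaleC_of_real[symmetric] scaleC_scaleC mult.commute)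

lemma cinner_add_left: "cinner (x + y) w = cinner x w + cinner y w"
  by (metis cinner_add_right cinner_commute complex_cnj_add)

lemma cinner_scaleC_left: "cinner (a *\<^sub>C x) y = cnj a * cinner x y"
  by (metis cinner_commute cinner_scaleC_right complex_cnj_mult)

lemma cinner_scaleR_left: "cinner (a *\<^sub>R x) y = of_real a * cinner x y"
  using cinner_scaleC_left[of "of_real a" x y] by (simp add: scaleC_of_real)

lemma cinner_scaleR_right: "cinner x (a *\<^sub>R y) = of_real a * cinner x y"
  using cinner_scaleC_right[of x "of_real a" y] by (simp add: scaleC_of_real)

lemma cinner_zero_left [simp]: "cinner 0 y = 0"
  using cinner_scaleR_left[of 0 0 y] by simp

lemma cinner_zero_right [simp]: "cinner y 0 = 0"
  using cinner_scaleR_right[of y 0 0] by simp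

lemma cinner_minus_left: "cinner (- x) y = - cinner x y"
  using cinner_scaleR_left[of "-1" x y] by simp

lemma cinner_minus_right: "cinner x (- y) = - cinner x y"
  using cinner_scaleR_right[of x "-1" y] by simp

lemma cinner_diff_left: "cinner (x - y) w = cinner x w - cinner y w"
  using cinner_add_left[of x "- y" w] by (simp add: cinner_minus_left)

lemma cinner_diff_right: "cinner w (x - y) = cinner w x - cinner w y"
  using cinner_add_right[of w x "- y"] by (simp add: cinner_minus_right)

lemma Im_cinner_self: "Im (cinner x x) = 0"
  using cinner_commute[of x x] by (metis add.inverse_unique cnj.sel(2) neg_equal_zero)

lemma cinner_self: "cinner x x = of_real ((norm x)\<^sup>2)"
  by (simp add: complex_eq_iff Im_cinner_self power2_norm_eq_inner inner_eq_Re_cinner)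

text \<open>The complex form is recovered from the real one, so that orthogonality for the real
  inner product can be turned into complex orthogonality.\<close>

lemma cinner_eq_Complex: "cinner x y = Complex (inner x y) (- inner x (\<i> *\<^sub>C y))"
  by (simp add: complex_eq_iff inner_eq_Re_cinner cinner_scaleC_right)

lemma cinner_eq_0_iff_all: "(\<forall>y. cinner x y = 0) \<longleftrightarrow> x = 0"
  by (metis cinner_self cinner_zero_left norm_eq_zero of_real_eq_0_iff power_eq_0_iff)

lemma cinner_ext_left: "(\<And>y. cinner x y = cinner x' y) \<Longrightarrow> x = x'"
  using cinner_eq_0_iff_all[of "x - x'"] by (simp add: cinner_diff_left)

lemma cinner_ext_right: "(\<And>y. cinner y x = cinner y x') \<Longrightarrow> x = x'"
  by (rule cinner_ext_left) (metis cinner_commute)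

lemma norm_cinner_le: "cmod (cinner x y) \<le> norm x * norm y"
proof (cases "cinner x y = 0")
  case False
  \<comment> \<open>\<open>a\<close> is the phase that turns \<open>cinner x y\<close> into its
    modulus; this reduces the claim to the real Cauchy-Schwarz inequality.\<close>
  define a where "a = cnj (cinner x y) / cmod (cinner x y)"
  have na: "cmod a = 1"
    using False by (simp add: a_def norm_divide)
  have "a * cinner x y = cmod (cinner x y)"
    using False by (simp add: a_def complex_norm_square[symmetric] power2_eq_square mult.commute field_simps flip: of_real_mult)
  then have "cmod (cinner x y) = inner x (a *\<^sub>C y)"
    by (metis Re_complex_of_real cinner_scaleC_right inner_eq_Re_cinner)
  also have "\<dots> \<le> norm x * norm (a *\<^sub>C y)"
    by (rule norm_cauchy_schwarz)
  finally show ?thesis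
    by (simp add: norm_scaleC na)
qed auto

lemma bounded_bilinear_cinner:
  "bounded_bilinear (cinner :: 'a::complex_hilbert_space \<Rightarrow> 'a \<Rightarrow> complex)"
proof
  show "\<exists>K. \<forall>a b::'a. cmod (cinner a b) \<le> norm a * norm b * K"
    by (rule exI[of _ 1]) (simp add: norm_cinner_le)
qed (simp_all add: cinner_add_left cinner_add_right cinner_scaleR_left cinner_scaleR_right scaleR_conv_of_real)

lemma bounded_linear_cinner_right: "bounded_linear (cinner (x::'a::complex_hilbert_space))"
  by (rule bounded_bilinear.bounded_linear_right[OF bounded_bilinear_cinner])

lemmas tendsto_cinner = bounded_bilinear.tendsto[OF bounded_bilinear_cinner]
lemmas continuous_on_cinner = bounded_bilinear.continuous_on[OF bounded_bilinear_cinner]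

section \<open>Orthogonal projection\<close>

lemma norm_add_diff_square: "(norm (a + b))\<^sup>2 + (norm (a - b))\<^sup>2 = 2 * (norm a)\<^sup>2 + 2 * (norm b)\<^sup>2"
  for a b :: "'a::real_inner"
  by (simp add: power2_norm_eq_inner inner_simps inner_commute algebra_simps)

text \<open>A minimising sequence is Cauchy by the parallelogram law, because midpoints stay in
  \<open>S\<close>. Working with real subspaces makes the result available for graphs in a product
  space as well.\<close>

lemma orthogonal_projection_exists:
  fixes x :: "'a::{real_inner,complete_space}"
  assumes S: "closed S" "subspace S"
  obtains p where "p \<in> S" "\<And>y. y \<in> S \<Longrightarrow> inner (x - p) y = 0"
proof -
  define \<delta> where "\<delta> = (INF y\<in>S. norm (x - y))"
  have ne: "S \<noteq> {}" using subspace_0[OF S(2)] by auto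
  have bdd: "bdd_below ((\<lambda>y. norm (x - y)) ` S)" by (auto intro!: bdd_belowI[of _ 0])
  have lower: "\<delta> \<le> norm (x - y)" if "y \<in> S" for y
    unfolding \<delta>_def by (rule cINF_lower[OF bdd that])
  have d0: "0 \<le> \<delta>"
    unfolding \<delta>_def using ne by (intro cINF_greatest) auto
  have "\<exists>y\<in>S. norm (x - y) < \<delta> + inverse (real (Suc n))" for n
  proof -
    have "(INF y\<in>S. norm (x - y)) < \<delta> + inverse (real (Suc n))" by (simp add: \<delta>_def)
    from cInf_lessD[OF _ this] ne show ?thesis by auto
  qed
  then obtain y where y: "\<And>n. y n \<in> S" "\<And>n. norm (x - y n) < \<delta> + inverse (real (Suc n))"
    by metis
  have lim: "(\<lambda>n. norm (x - y n)) \<longlonglongrightarrow> \<delta>"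
  proof (rule tendsto_sandwich[OF _ _ tendsto_const])
    show "(\<lambda>n. \<delta> + inverse (real (Suc n))) \<longlonglongrightarrow> \<delta>"
      using tendsto_add[OF tendsto_const LIMSEQ_inverse_real_of_nat, of \<delta>] by simp
    show "\<forall>\<^sub>F n in sequentially. norm (x - y n) \<le> \<delta> + inverse (real (Suc n))"
      using y(2) by (auto intro!: always_eventually less_imp_le simp del: of_nat_Suc)
  qed (use lower y(1) in \<open>simp add: always_eventually\<close>)
  have est: "(norm (y n - y m))\<^sup>2 \<le> 2 * (norm (x - y n))\<^sup>2 + 2 * (norm (x - y m))\<^sup>2 - 4 * \<delta>\<^sup>2" for n m
  proof -
    have "(1/2) *\<^sub>R (y n + y m) \<in> S"
      using S(2) y(1) by (simp add: subspace_add subspace_mul)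
    then have "\<delta> \<le> norm (x - (1/2) *\<^sub>R (y n + y m))" by (rule lower)
    then have "\<delta>\<^sup>2 \<le> (norm (x - (1/2) *\<^sub>R (y n + y m)))\<^sup>2"
      using d0 by (rule power_mono)
    moreover have "(x - y n) + (x - y m) = 2 *\<^sub>R (x - (1/2) *\<^sub>R (y n + y m))"
      by (simp add: algebra_simps scaleR_2)
    ultimately have "4 * \<delta>\<^sup>2 \<le> (norm ((x - y n) + (x - y m)))\<^sup>2"
      by (simp add: power_mult_distrib)
    then show ?thesis
      using norm_add_diff_square[of "x - y n" "x - y m"] by (simp add: norm_minus_commute)
  qed
  have "Cauchy y"
  proof (rule metric_CauchyI)
    fix e :: real assume e: "0 < e"
    have "(\<lambda>n. (norm (x - y n))\<^sup>2) \<longlonglongrightarrow> \<delta>\<^sup>2"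
      by (intro tendsto_power lim)
    then have "\<forall>\<^sub>F n in sequentially. (norm (x - y n))\<^sup>2 < \<delta>\<^sup>2 + e\<^sup>2 / 4"
      by (rule order_tendstoD) (use e in simp)
    then obtain M where M: "\<And>n. n \<ge> M \<Longrightarrow> (norm (x - y n))\<^sup>2 < \<delta>\<^sup>2 + e\<^sup>2 / 4"
      unfolding eventually_sequentially by auto
    have "dist (y m) (y n) < e" if "m \<ge> M" "n \<ge> M" for m n
    proof -
      have "(norm (y m - y n))\<^sup>2 < e\<^sup>2"
        using est[of m n] M[OF that(1)] M[OF that(2)] by simp
      then show ?thesis
        using e by (simp add: dist_norm power2_less_imp_less)
    qed
    then show "\<exists>M. \<forall>m\<ge>M. \<forall>n\<ge>M. dist (y m) (y n) < e" by blast
  qed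
  then obtain p where p: "y \<longlonglongrightarrow> p"
    using Cauchy_convergent convergent_def by blast
  have pS: "p \<in> S"
    using S(1) y(1) p by (metis closed_sequentially)
  have np: "norm (x - p) = \<delta>"
    using LIMSEQ_unique[OF tendsto_norm[OF tendsto_diff[OF tendsto_const p]] lim] .
  have "inner (x - p) v = 0" if v: "v \<in> S" for v
  proof (cases "v = 0")
    case False
    \<comment> \<open>This \<open>t\<close> minimises the distance from \<open>x\<close> to the line
      \<open>p + t v\<close>; it would fall below the infimum unless \<open>inner (x - p) v\<close>
      vanished.\<close>
    define t where "t = inner (x - p) v / inner v v"
    have vv: "inner v v > 0" using False by simp
    have "p + t *\<^sub>R v \<in> S"
      using S(2) pS v by (simp add: subspace_add subspace_mul)
    then have "\<delta>\<^sup>2 \<le> (norm (x - (p + t *\<^sub>R v)))\<^sup>2"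
      by (intro power_mono d0 lower)
    also have "x - (p + t *\<^sub>R v) = (x - p) - t *\<^sub>R v" by simp
    also have "(norm \<dots>)\<^sup>2 = inner (x - p) (x - p) - 2 * t * inner (x - p) v + t * t * inner v v"
      unfolding power2_norm_eq_inner
      using inner_commute[of v "x - p"]
      by (simp add: inner_diff_left[of _ "t *\<^sub>R v"] inner_diff_right[of _ _ "t *\<^sub>R v"] right_diff_distrib)
    also have "\<dots> = \<delta>\<^sup>2 - (inner (x - p) v)\<^sup>2 / inner v v"
      using vv by (simp add: t_def np[symmetric] dot_square_norm field_simps power2_eq_square)
    finally have "(inner (x - p) v)\<^sup>2 / inner v v \<le> 0" by simp
    then show ?thesis
      using vv by (simp add: divide_le_0_iff)
  qed simp
  with pS show ?thesis by (rule that)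
qed

lemma exists_orthogonal:
  fixes S :: "'a::{real_inner,complete_space} set"
  assumes "closed S" "subspace S" "x \<notin> S"
  obtains v where "inner v x \<noteq> 0" "\<And>y. y \<in> S \<Longrightarrow> inner v y = 0"
proof -
  obtain p where p: "p \<in> S" "\<And>y. y \<in> S \<Longrightarrow> inner (x - p) y = 0"
    using orthogonal_projection_exists[OF assms(1,2)] by blast
  have "inner (x - p) (x - p) \<noteq> 0" using p(1) assms(3) by auto
  then have "inner (x - p) x \<noteq> 0"
    using p by (simp add: inner_diff_right)
  then show ?thesis using that p(2) by blast
qed

lemma subspace_closure_real:
  fixes S :: "'a::real_normed_vector set"
  assumes "subspace S"
  shows "subspace (closure S)"
  unfolding subspace_def
proof (intro conjI ballI allI)
  show "0 \<in> closure S"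
    using assms closure_subset subspace_0 by blast
next
  fix x y assume "x \<in> closure S" "y \<in> closure S"
  then obtain f g where fg: "\<And>n. f n \<in> S" "f \<longlonglongrightarrow> x" "\<And>n. g n \<in> S" "g \<longlonglongrightarrow> y"
    by (metis closure_sequential)
  then have "(\<lambda>n. f n + g n) \<longlonglongrightarrow> x + y" "\<forall>n. f n + g n \<in> S"
    using assms by (auto intro: tendsto_add subspace_add)
  then show "x + y \<in> closure S"
    unfolding closure_sequential by (intro exI[of _ "\<lambda>n. f n + g n"]) simp
next
  fix c :: real and x assume "x \<in> closure S"
  then obtain f where f: "\<And>n. f n \<in> S" "f \<longlonglongrightarrow> x"
    by (metis closure_sequential)
  then have "(\<lambda>n. c *\<^sub>R f n) \<longlonglongrightarrow> c *\<^sub>R x" "\<forall>n. c *\<^sub>R f n \<in> S"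
    using assms by (auto intro: tendsto_scaleR subspace_mul)
  then show "c *\<^sub>R x \<in> closure S"
    unfolding closure_sequential by (intro exI[of _ "\<lambda>n. c *\<^sub>R f n"]) simp
qed

section \<open>Graphs of linear operators and density of the domain of the adjoint\<close>

lemma linear_operatorD:
  assumes "linear_operator G"
  shows "(x, u) \<in> G \<Longrightarrow> (x, v) \<in> G \<Longrightarrow> u = v" "(0, 0) \<in> G"
    "(x, u) \<in> G \<Longrightarrow> (y, w) \<in> G \<Longrightarrow> (x + y, u + w) \<in> G"
    "(x, u) \<in> G \<Longrightarrow> (a *\<^sub>C x, a *\<^sub>C u) \<in> G"
    "(x, u) \<in> G \<Longrightarrow> (b *\<^sub>R x, b *\<^sub>R u) \<in> G"
proof -
  show *: "(x, u) \<in> G \<Longrightarrow> (a *\<^sub>C x, a *\<^sub>C u) \<in> G" for a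
    using assms by (auto simp: linear_operator_def)
  show "(x, u) \<in> G \<Longrightarrow> (b *\<^sub>R x, b *\<^sub>R u) \<in> G"
    using *[of "of_real b"] by (simp add: scaleC_of_real)
qed (use assms in \<open>auto simp: linear_operator_def single_valued_def\<close>)

text \<open>If \<open>y\<close> is orthogonal to the domain of the adjoint, then \<open>(0, y)\<close> is orthogonal to the
  orthogonal complement of the graph.\<close>

lemma densely_defined_adjoint:
  assumes lin: "linear_operator F" and closed: "closed F"
  shows "closure (Domain (adjoint_op F)) = UNIV"
proof (rule ccontr)
  let ?M = "Domain (adjoint_op F)"
  assume "closure ?M \<noteq> UNIV"
  then obtain b0 where b0: "b0 \<notin> closure ?M" by auto
  have "subspace ?M"
    unfolding subspace_def
  proof (intro conjI ballI allI)
    show "0 \<in> ?M" by (auto simp: adjoint_op_def Domain_iff intro!: exI[of _ 0])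
  next
    fix x y assume "x \<in> ?M" "y \<in> ?M"
    then obtain a b where "(x, a) \<in> adjoint_op F" "(y, b) \<in> adjoint_op F" by (metis DomainE)
    then have "(x + y, a + b) \<in> adjoint_op F"
      by (fastforce simp: adjoint_op_def cinner_add_right)
    then show "x + y \<in> ?M" by (rule DomainI)
  next
    fix c :: real and x assume "x \<in> ?M"
    then obtain a where "(x, a) \<in> adjoint_op F" by (metis DomainE)
    then have "(c *\<^sub>R x, c *\<^sub>R a) \<in> adjoint_op F"
      by (fastforce simp: adjoint_op_def cinner_scaleR_right)
    then show "c *\<^sub>R x \<in> ?M" by (rule DomainI)
  qed
  then have sub: "subspace (closure ?M)" by (rule subspace_closure_real)
  obtain y where y: "inner y b0 \<noteq> 0" "\<And>b. b \<in> closure ?M \<Longrightarrow> inner y b = 0"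
    using exists_orthogonal[OF closed_closure sub b0] by blast
  have subF: "subspace F"
    using linear_operatorD[OF lin] by (auto simp: subspace_def zero_prod_def)
  have "(0, y) \<in> F"
  proof (rule ccontr)
    assume "(0, y) \<notin> F"
    then obtain v where v: "inner v (0, y) \<noteq> 0" "\<And>q. q \<in> F \<Longrightarrow> inner v q = 0"
      using exists_orthogonal[OF closed subF] by blast
    obtain a b where ab: "v = (a, b)" by force
    \<comment> \<open>Real orthogonality of \<open>(a, b)\<close> to the graph, used at
      \<open>(x, u)\<close> and at its multiple by \<open>\<i>\<close>, amounts to complex
      orthogonality; hence \<open>(b, - a)\<close> belongs to the adjoint.\<close>
    have "cinner u b = cinner x (- a)" if xu: "(x, u) \<in> F" for x u
    proof -
      have 1: "inner a x + inner b u = 0"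
        using v(2)[OF xu] by (simp add: ab)
      have 2: "inner a (\<i> *\<^sub>C x) + inner b (\<i> *\<^sub>C u) = 0"
        using v(2)[OF linear_operatorD(4)[OF lin xu, of \<i>]] by (simp add: ab)
      have "cinner a x + cinner b u = 0"
        using 1 2 by (simp add: cinner_eq_Complex complex_eq_iff)
      then have "cnj (cinner a x) + cnj (cinner b u) = 0"
        by (metis complex_cnj_add complex_cnj_zero)
      then show ?thesis
        by (simp add: cinner_commute[symmetric] cinner_minus_right add_eq_0_iff)
    qed
    then have "b \<in> ?M" by (auto simp: adjoint_op_def Domain_iff)
    then have "inner y b = 0" using closure_subset y(2) by blast
    then show False using v(1) by (simp add: ab inner_commute)
  qed
  then have "y = 0" using linear_operatorD(1,2)[OF lin] by blast
  then show False using y(1) by simp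
qed

section \<open>Riesz theory of compact perturbations of the identity\<close>

definition compact_blinfun :: "('a::real_normed_vector \<Rightarrow>\<^sub>L 'b::real_normed_vector) \<Rightarrow> bool" where
  "compact_blinfun K \<longleftrightarrow> compact (closure (blinfun_apply K ` cball 0 1))"

lemma compact_blinfun_convergent_subseq:
  fixes K :: "'a::real_normed_vector \<Rightarrow>\<^sub>L 'b::real_normed_vector"
  assumes K: "compact_blinfun K" and x: "\<And>n. norm (x n) \<le> 1"
  obtains l r where "strict_mono (r :: nat \<Rightarrow> nat)" "(\<lambda>n. K (x (r n))) \<longlonglongrightarrow> l"
proof -
  have "seq_compact (closure (blinfun_apply K ` cball 0 1))"
    using K by (simp add: compact_blinfun_def compact_imp_seq_compact)
  moreover have "\<forall>n. K (x n) \<in> closure (blinfun_apply K ` cball 0 1)"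
    using x closure_subset by fastforce
  ultimately obtain l r where "strict_mono (r :: nat \<Rightarrow> nat)" "((\<lambda>n. K (x n)) \<circ> r) \<longlonglongrightarrow> l"
    by (rule seq_compactE)
  then show ?thesis using that by (simp add: o_def)
qed

lemma funpow_bounded_linear:
  fixes X :: "'a::real_normed_vector \<Rightarrow>\<^sub>L 'a"
  shows "bounded_linear (blinfun_apply X ^^ n)"
  by (induction n)
    (auto simp: bounded_linear_ident id_def o_def intro: bounded_linear_compose[OF blinfun.bounded_linear_right])

text \<open>Hilbert space form of the Riesz lemma: with exact orthogonality,
  \<open>norm_diff_orthogonal_ge\<close> puts \<open>v\<close> at distance at least 1 from
  \<open>S\<close>.\<close>

lemma unit_vector_orthogonal:
  fixes S T :: "'a::{real_inner,complete_space} set"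
  assumes "closed S" "subspace S" "subspace T" "S \<subseteq> T" "S \<noteq> T"
  obtains v where "v \<in> T" "norm v = 1" "\<And>y. y \<in> S \<Longrightarrow> inner v y = 0"
proof -
  obtain x where x: "x \<in> T" "x \<notin> S" using assms by auto
  obtain p where p: "p \<in> S" "\<And>y. y \<in> S \<Longrightarrow> inner (x - p) y = 0"
    using orthogonal_projection_exists[OF assms(1,2)] by blast
  have "x - p \<noteq> 0" using p(1) x(2) by auto
  then show ?thesis
    using x p assms(3,4)
    by (intro that[of "inverse (norm (x - p)) *\<^sub>R (x - p)"]) (auto intro!: subspace_mul subspace_diff)
qed

lemma norm_diff_orthogonal_ge:
  fixes a v :: "'a::real_inner"
  assumes "inner v a = 0"
  shows "norm v \<le> norm (a - v)"
proof -
  have "(norm (a - v))\<^sup>2 = (norm a)\<^sup>2 + (norm v)\<^sup>2"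
    using assms by (simp add: power2_norm_eq_inner inner_diff_left inner_diff_right inner_commute)
  then have "(norm v)\<^sup>2 \<le> (norm (a - v))\<^sup>2" by simp
  then show ?thesis by (rule power2_le_imp_le) simp
qed

text \<open>The lower bound makes solutions in \<open>R\<close> unique, so choosing them pointwise
  gives a linear map, of norm at most \<open>C / \<delta>\<close>. Projections, partial inverses and
  Neumann inverses are all obtained in this way.\<close>

lemma bounded_linear_solution:
  fixes L :: "'a::real_normed_vector \<Rightarrow> 'b::real_normed_vector" and f :: "'c::real_normed_vector \<Rightarrow> 'b"
  assumes L: "bounded_linear L" and f: "bounded_linear f" and R: "subspace R"
    and below: "0 < \<delta>" "\<And>y. y \<in> R \<Longrightarrow> \<delta> * norm y \<le> norm (L y)"
    and ex: "\<And>x. \<exists>y\<in>R. L y = f x"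
  shows "\<exists>g. (\<forall>x. blinfun_apply g x \<in> R) \<and> (\<forall>x. L (blinfun_apply g x) = f x)"
proof -
  interpret L: bounded_linear L by fact
  interpret f: bounded_linear f by fact
  obtain g where g: "\<And>x. g x \<in> R" "\<And>x. L (g x) = f x" using ex by metis
  have uniq: "y = y'" if "y \<in> R" "y' \<in> R" "L y = L y'" for y y'
  proof -
    have "\<delta> * norm (y - y') \<le> norm (L (y - y'))"
      using that R by (intro below) (simp add: subspace_diff)
    then show ?thesis using that below(1) by (simp add: L.diff mult_le_0_iff)
  qed
  obtain C where C: "\<And>x. norm (f x) \<le> norm x * C" using f.bounded by blast
  have "bounded_linear g"
  proof (rule bounded_linear_intro[where K = "C / \<delta>"])
    show "g (x + y) = g x + g y" for x y
      using g R by (intro uniq) (simp_all add: subspace_add L.add f.add)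
    show "g (a *\<^sub>R x) = a *\<^sub>R g x" for a x
      using g R by (intro uniq) (simp_all add: subspace_mul L.scaleR f.scaleR)
    show "norm (g x) \<le> norm x * (C / \<delta>)" for x
      using below(2)[OF g(1)[of x]] C[of x] below(1) by (simp add: g(2) field_simps)
  qed
  then show ?thesis
    using g by (intro exI[of _ "Blinfun g"]) (simp add: bounded_linear_Blinfun_apply)
qed

context
  fixes K X :: "'a::{real_inner,complete_space} \<Rightarrow>\<^sub>L 'a"
  assumes K: "compact_blinfun K" and X_def: "X = id_blinfun + K"
begin

lemma riesz_X_apply: "X x = x + K x"
  by (simp add: X_def blinfun.add_left)

text \<open>Compactness of \<open>K\<close> forbids unit vectors whose images keep mutual distance
  at least 1. Ascent and descent are proved by building such a sequence.\<close>

lemma riesz_no_separated_sequence: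
  assumes x: "\<And>n. norm (x n) = 1"
  shows "\<exists>n m. n < (m::nat) \<and> norm (K (x n) - K (x m)) < 1"
proof -
  obtain l r where r: "strict_mono (r :: nat \<Rightarrow> nat)" and l: "(\<lambda>n. K (x (r n))) \<longlonglongrightarrow> l"
    using compact_blinfun_convergent_subseq[OF K, of x] x by (metis order_refl)
  have "Cauchy (\<lambda>n. K (x (r n)))" using l by (rule LIMSEQ_imp_Cauchy)
  then obtain M where "\<And>m n. m \<ge> M \<Longrightarrow> n \<ge> M \<Longrightarrow> norm (K (x (r m)) - K (x (r n))) < 1"
    by (metis CauchyD zero_less_one)
  then have "norm (K (x (r M)) - K (x (r (Suc M)))) < 1" by simp
  moreover have "r M < r (Suc M)" using r by (simp add: strict_mono_Suc_iff)
  ultimately show ?thesis by blast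
qed

text \<open>Otherwise there are unit vectors with \<open>X x\<close> tending to 0. Since
  \<open>x = X x - K x\<close>, a subsequence converges, and its limit is a unit vector of
  \<open>M\<close> in the kernel.\<close>

lemma riesz_bounded_below:
  assumes M: "closed M" "subspace M" and inj: "\<And>x. x \<in> M \<Longrightarrow> X x = 0 \<Longrightarrow> x = 0"
  obtains \<delta> where "0 < \<delta>" "\<And>x. x \<in> M \<Longrightarrow> \<delta> * norm x \<le> norm (X x)"
proof (rule ccontr)
  assume contra: "\<not> thesis"
  have "\<exists>x\<in>M. norm x = 1 \<and> norm (X x) \<le> inverse (real (Suc n))" for n
  proof (rule ccontr)
    assume a: "\<not> ?thesis"
    have "inverse (real (Suc n)) * norm x \<le> norm (X x)" if x: "x \<in> M" for x
    proof (cases "x = 0")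
      case False
      then have "inverse (norm x) *\<^sub>R x \<in> M \<and> norm (inverse (norm x) *\<^sub>R x) = 1"
        using x M(2) by (simp add: subspace_mul)
      then have "inverse (real (Suc n)) < norm (X (inverse (norm x) *\<^sub>R x))"
        using a by force
      then show ?thesis using False by (simp add: blinfun.scaleR_right field_simps)
    qed simp
    then show False using contra that[of "inverse (real (Suc n))"] by auto
  qed
  then obtain x where x: "\<And>n. x n \<in> M" "\<And>n. norm (x n) = 1" "\<And>n. norm (X (x n)) \<le> inverse (real (Suc n))"
    by metis
  obtain l r where r: "strict_mono (r :: nat \<Rightarrow> nat)" and l: "(\<lambda>n. K (x (r n))) \<longlonglongrightarrow> l"
    using compact_blinfun_convergent_subseq[OF K, of x] x by (metis order_refl)
  have "(\<lambda>n. X (x n)) \<longlonglongrightarrow> 0"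
    by (rule Lim_null_comparison[OF _ LIMSEQ_inverse_real_of_nat]) (use x(3) in auto)
  then have X0: "(\<lambda>n. X (x (r n))) \<longlonglongrightarrow> 0"
    using r LIMSEQ_subseq_LIMSEQ[of "\<lambda>n. X (x n)" 0 r] by (simp add: o_def)
  have "(\<lambda>n. X (x (r n)) - K (x (r n))) \<longlonglongrightarrow> 0 - l"
    by (intro tendsto_diff X0 l)
  then have lim: "(\<lambda>n. x (r n)) \<longlonglongrightarrow> - l" by (simp add: riesz_X_apply)
  have "- l \<in> M" using M(1) x(1) lim closed_sequentially by metis
  moreover have "X (- l) = 0"
    using LIMSEQ_unique[OF bounded_linear.tendsto[OF blinfun.bounded_linear_right lim] X0] .
  ultimately have "- l = 0" by (rule inj)
  moreover have "norm (- l) = 1"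
    using LIMSEQ_unique[OF tendsto_norm[OF lim], of 1] x(2) by simp
  ultimately show False by simp
qed

text \<open>\<open>X\<close> may fail to be injective on \<open>M\<close>. The orthogonal complement
  \<open>M'\<close> of the kernel within \<open>M\<close> has the same image, and there
  \<open>X\<close> is bounded below.\<close>

lemma riesz_closed_image:
  assumes M: "closed M" "subspace M"
  shows "closed (blinfun_apply X ` M)"
proof -
  define k where "k = {x \<in> M. X x = 0}"
  define M' where "M' = {x \<in> M. \<forall>y\<in>k. inner x y = 0}"
  have kc: "closed k"
    unfolding k_def
    using M(1) by (intro closed_Collect_conj[of "\<lambda>x. x \<in> M", simplified]) (auto intro!: closed_Collect_eq continuous_intros)
  have ks: "subspace k"
    using M(2) by (auto simp: k_def subspace_def blinfun.add_right blinfun.scaleR_right)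
  have M'_eq: "M' = M \<inter> (\<Inter>y\<in>k. {x. inner x y = 0})" by (auto simp: M'_def)
  have M'c: "closed M'"
    unfolding M'_eq using M(1) by (auto intro!: closed_Int closed_INT closed_Collect_eq continuous_intros)
  have M's: "subspace M'"
    using M(2) by (auto simp: M'_def subspace_def inner_add_left)
  have "x = 0" if "x \<in> M'" "X x = 0" for x
  proof -
    have "inner x x = 0" using that by (auto simp: M'_def k_def)
    then show ?thesis by simp
  qed
  then obtain \<delta> where d: "0 < \<delta>" "\<And>x. x \<in> M' \<Longrightarrow> \<delta> * norm x \<le> norm (X x)"
    using riesz_bounded_below[OF M'c M's] by metis
  have "complete (blinfun_apply X ` M')"
    using complete_isometric_image[OF d(1) M's blinfun.bounded_linear_right[of X]] d(2) M'c
    by (simp add: complete_eq_closed)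
  moreover have "blinfun_apply X ` M = blinfun_apply X ` M'"
  proof
    show "blinfun_apply X ` M \<subseteq> blinfun_apply X ` M'"
    proof
      fix z assume "z \<in> blinfun_apply X ` M"
      then obtain x where x: "x \<in> M" "z = X x" by auto
      obtain p where p: "p \<in> k" "\<And>y. y \<in> k \<Longrightarrow> inner (x - p) y = 0"
        using orthogonal_projection_exists[OF kc ks] by blast
      have "x - p \<in> M'" using x p M(2) by (auto simp: M'_def k_def subspace_diff)
      moreover have "z = X (x - p)" using x p by (simp add: k_def blinfun.diff_right)
      ultimately show "z \<in> blinfun_apply X ` M'" by blast
    qed
  qed (auto simp: M'_def)
  ultimately show ?thesis by (simp add: complete_eq_closed)
qed

lemma riesz_ascent: "\<exists>p. {x. (blinfun_apply X ^^ p) x = 0} = {x. (blinfun_apply X ^^ Suc p) x = 0}"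
proof (rule ccontr)
  define N where "N n = {x. (blinfun_apply X ^^ n) x = 0}" for n
  assume "\<not> ?thesis"
  then have ne: "N n \<noteq> N (Suc n)" for n unfolding N_def by blast
  have sub: "subspace (N n)" and clo: "closed (N n)" for n
  proof -
    interpret bounded_linear "blinfun_apply X ^^ n" by (rule funpow_bounded_linear)
    show "subspace (N n)" by (auto simp: N_def subspace_def zero add scaleR)
    show "closed (N n)"
      unfolding N_def
      by (intro closed_Collect_eq continuous_on_const linear_continuous_on funpow_bounded_linear)
  qed
  have step: "N n \<subseteq> N (Suc n)" for n by (auto simp: N_def)
  have mono: "N n \<subseteq> N m" if "n \<le> m" for n m
    using lift_Suc_mono_le[of N, OF step that] .
  have XN: "X x \<in> N n" if "x \<in> N (Suc n)" for x n
    using that by (simp add: N_def funpow_swap1 del: funpow.simps) (simp add: funpow_swap1)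
  have "\<exists>v. v \<in> N (Suc n) \<and> norm v = 1 \<and> (\<forall>y\<in>N n. inner v y = 0)" for n
    using unit_vector_orthogonal[OF clo sub sub step ne] by metis
  then obtain v where v: "\<And>n. v n \<in> N (Suc n)" "\<And>n. norm (v n) = 1" "\<And>n y. y \<in> N n \<Longrightarrow> inner (v n) y = 0"
    by metis
  obtain n m where nm: "n < m" "norm (K (v n) - K (v m)) < 1"
    using riesz_no_separated_sequence[of v] v(2) by blast
  \<comment> \<open>\<open>K (v n) - K (v m)\<close> is \<open>v m\<close> minus this vector of
    \<open>N m\<close>; since \<open>v m\<close> is orthogonal to \<open>N m\<close>, its norm is at
    least 1.\<close>
  have "X (v m) - X (v n) + v n \<in> N m"
    using v(1) XN sub[of m] mono[of "Suc n" m] mono[of n m] nm(1)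
    by (intro subspace_add subspace_diff) (auto simp: Suc_le_eq)
  then have "norm (v m) \<le> norm ((X (v m) - X (v n) + v n) - v m)"
    by (intro norm_diff_orthogonal_ge v(3))
  then show False
    using nm(2) v(2) by (simp add: riesz_X_apply norm_minus_commute algebra_simps)
qed

lemma riesz_closed_range_funpow: "closed (range (blinfun_apply X ^^ n))" "subspace (range (blinfun_apply X ^^ n))"
proof -
  show "subspace (range (blinfun_apply X ^^ n))" for n
    by (rule linear_subspace_image) (simp_all add: funpow_bounded_linear bounded_linear.linear)
  then show "closed (range (blinfun_apply X ^^ n))"
    by (induction n) (simp_all add: image_comp[symmetric] riesz_closed_image del: comp_apply)
qed

lemma riesz_descent: "\<exists>p. range (blinfun_apply X ^^ p) = range (blinfun_apply X ^^ Suc p)"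
proof (rule ccontr)
  define R where "R n = range (blinfun_apply X ^^ n)" for n
  assume "\<not> ?thesis"
  then have ne: "R (Suc n) \<noteq> R n" for n unfolding R_def by metis
  have sub: "subspace (R n)" and clo: "closed (R n)" for n
    by (simp_all only: R_def riesz_closed_range_funpow)
  have step: "R (Suc n) \<subseteq> R n" for n
    by (auto simp: R_def funpow_swap1)
  have mono: "R m \<subseteq> R n" if "n \<le> m" for n m
    using lift_Suc_antimono_le[of R, OF step that] .
  have XR: "X x \<in> R (Suc n)" if "x \<in> R n" for x n
    using that by (auto simp: R_def)
  have "\<exists>v. v \<in> R n \<and> norm v = 1 \<and> (\<forall>y\<in>R (Suc n). inner v y = 0)" for n
    using unit_vector_orthogonal[OF clo sub sub step ne] by metis
  then obtain v where v: "\<And>n. v n \<in> R n" "\<And>n. norm (v n) = 1" "\<And>n y. y \<in> R (Suc n) \<Longrightarrow> inner (v n) y = 0"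
    by metis
  obtain n m where nm: "n < m" "norm (K (v n) - K (v m)) < 1"
    using riesz_no_separated_sequence[of v] v(2) by blast
  \<comment> \<open>As for the ascent, but ranges decrease, so now the vector with the smaller index
    is orthogonal to the rest.\<close>
  have "X (v n) - X (v m) + v m \<in> R (Suc n)"
    using v(1) XR sub[of "Suc n"] mono[of "Suc n" m] mono[of n m] nm(1)
    by (intro subspace_add subspace_diff) (auto simp: Suc_le_eq subset_iff)
  then have "norm (v n) \<le> norm ((X (v n) - X (v m) + v m) - v n)"
    by (intro norm_diff_orthogonal_ge v(3))
  then show False
    using nm(2) v(2) by (simp add: riesz_X_apply norm_minus_commute algebra_simps)
qed

text \<open>Beyond ascent and descent, kernel and range of the \<open>m\<close>-th power are
  complementary, and \<open>X\<close> is bijective and bounded below on the closed range. The lower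
  bound makes the projection and the partial inverse bounded.\<close>

theorem riesz_decomposition:
  obtains m and E Z :: "'a \<Rightarrow>\<^sub>L 'a" where "0 < m"
    "\<And>x. (blinfun_apply X ^^ m) (E x) = 0" "\<And>x. X (Z x) = x - E x" "\<And>x. Z (X x) = x - E x"
    "\<And>x. Z (E x) = 0" "\<And>x. E (Z x) = 0"
proof -
  define N where "N n = {x. (blinfun_apply X ^^ n) x = 0}" for n
  define R where "R n = range (blinfun_apply X ^^ n)" for n
  obtain p where p: "N p = N (Suc p)" using riesz_ascent unfolding N_def by blast
  obtain q where q: "R q = R (Suc q)" using riesz_descent unfolding R_def by blast
  have N1: "N (p + i) = N p" for i
  proof (induction i)
    case (Suc i)
    have "x \<in> N (Suc (p + i)) \<longleftrightarrow> X x \<in> N (p + i)" for x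
      by (simp add: N_def funpow_swap1)
    moreover have "x \<in> N (Suc p) \<longleftrightarrow> X x \<in> N p" for x
      by (simp add: N_def funpow_swap1)
    ultimately have "N (Suc (p + i)) = N (Suc p)" using Suc.IH by blast
    then show ?case using p[symmetric] by simp
  qed simp
  have R1: "R (q + i) = R q" for i
  proof (induction i)
    case (Suc i)
    have "R (Suc k) = blinfun_apply X ` R k" for k by (auto simp: R_def)
    then have "R (Suc (q + i)) = R (Suc q)" using Suc.IH by metis
    then show ?case using q[symmetric] by simp
  qed simp
  \<comment> \<open>\<open>m\<close> is past both stabilisation indices, and the successor keeps it
    positive.\<close>
  define m where "m = Suc (p + q)"
  have N2: "N (m + m) = N m" and R2: "R (m + m) = R m" "R (Suc m) = R m"
    using N1[of "Suc q"] N1[of "Suc q + m"] R1[of "Suc p"] R1[of "Suc p + m"] R1[of "Suc (Suc p)"]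
    by (simp_all add: m_def algebra_simps)
  let ?X = "blinfun_apply X"
  interpret Xm: bounded_linear "?X ^^ m" by (rule funpow_bounded_linear)
  have sub: "subspace (R m)" and clo: "closed (R m)"
    by (simp_all only: R_def riesz_closed_range_funpow)
  have XR: "X x \<in> R m" if "x \<in> R m" for x
    using that by (auto simp: R_def funpow_swap1)
  have disj: "x = 0" if x: "x \<in> R m" "(?X ^^ m) x = 0" for x
  proof -
    obtain z where z: "x = (?X ^^ m) z" using x(1) unfolding R_def by blast
    then have "z \<in> N (m + m)" using x(2) by (simp add: N_def funpow_add)
    then have "z \<in> N m" by (simp add: N2)
    then show ?thesis by (simp add: z N_def)
  qed
  have "x = 0" if "x \<in> R m" "X x = 0" for x
  proof (rule disj[OF that(1)])
    have "(?X ^^ m) x = (?X ^^ (p + q)) (X x)"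
      by (simp add: m_def funpow_swap1)
    then show "(?X ^^ m) x = 0"
      using that(2) linear_0[OF bounded_linear.linear[OF funpow_bounded_linear]] by metis
  qed
  then obtain \<delta> where d: "0 < \<delta>" "\<And>x. x \<in> R m \<Longrightarrow> \<delta> * norm x \<le> norm (X x)"
    using riesz_bounded_below[OF clo sub] by metis
  have dm: "\<delta> ^ n * norm x \<le> norm ((?X ^^ n) x) \<and> (?X ^^ n) x \<in> R m" if "x \<in> R m" for x n
  proof (induction n)
    case (Suc n)
    have "\<delta> ^ Suc n * norm x = \<delta> * (\<delta> ^ n * norm x)" by simp
    also have "\<dots> \<le> \<delta> * norm ((?X ^^ n) x)"
      using Suc d(1) by (intro mult_left_mono) auto
    also have "\<dots> \<le> norm (X ((?X ^^ n) x))" using Suc d(2) by blast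
    finally show ?case using Suc XR by simp
  qed (simp add: that)
  have ex1: "\<exists>y\<in>R m. (?X ^^ m) y = (?X ^^ m) x" for x
  proof -
    have "(?X ^^ m) x \<in> R (m + m)" by (simp only: R2) (simp add: R_def)
    then obtain z where "(?X ^^ m) x = (?X ^^ (m + m)) z" by (auto simp only: R_def)
    then show ?thesis by (intro bexI[of _ "(?X ^^ m) z"]) (simp_all add: R_def funpow_add)
  qed
  have dm': "\<delta> ^ m * norm y \<le> norm ((?X ^^ m) y)" if "y \<in> R m" for y
    using dm[OF that] by blast
  have d0: "0 < \<delta> ^ m" using d(1) by simp
  \<comment> \<open>\<open>S\<close> is the projection onto \<open>R m\<close> along
    \<open>N m\<close>: \<open>S x\<close> is the only vector of \<open>R m\<close> with the same
    image as \<open>x\<close> under the \<open>m\<close>-th power of \<open>X\<close>.\<close>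
  obtain S where S': "(\<forall>x. blinfun_apply S x \<in> R m) \<and> (\<forall>x. (?X ^^ m) (blinfun_apply S x) = (?X ^^ m) x)"
    by (rule exE[OF bounded_linear_solution[OF funpow_bounded_linear[of m X] funpow_bounded_linear[of m X] sub d0 dm' ex1]])
  have S: "S x \<in> R m" "(?X ^^ m) (S x) = (?X ^^ m) x" for x
    using S' by simp_all
  have S_id: "S x = x" if "x \<in> R m" for x
  proof -
    have "S x - x = 0"
      by (rule disj) (use that S[of x] sub in \<open>simp_all add: subspace_diff Xm.diff\<close>)
    then show ?thesis by simp
  qed
  have ex2: "\<exists>y\<in>R m. X y = S x" for x
  proof -
    have "S x \<in> R (Suc m)" using S(1) by (simp add: R2)
    then show ?thesis by (auto simp: R_def)
  qed
  \<comment> \<open>\<open>Z\<close> is \<open>S\<close> followed by the inverse of \<open>X\<close>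
    on \<open>R m\<close>.\<close>
  obtain Z where Z': "(\<forall>x. blinfun_apply Z x \<in> R m) \<and> (\<forall>x. X (blinfun_apply Z x) = S x)"
    by (rule exE[OF bounded_linear_solution[OF blinfun.bounded_linear_right[of X] blinfun.bounded_linear_right[of S] sub d ex2]])
  have Z: "Z x \<in> R m" "X (Z x) = S x" for x
    using Z' by simp_all
  have X_inj: "x = y" if "x \<in> R m" "y \<in> R m" "X x = X y" for x y
  proof -
    have "\<delta> * norm (x - y) \<le> norm (X (x - y))" using that sub by (intro d) (simp add: subspace_diff)
    then show ?thesis using that d(1) by (simp add: blinfun.diff_right mult_le_0_iff)
  qed
  have SX: "S (X x) = X (S x)" for x
  proof -
    have e: "(?X ^^ m) (S (X x) - X (S x)) = 0"
      using S(2)[of x] by (simp add: Xm.diff S(2) funpow_swap1[symmetric])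
    have "S (X x) - X (S x) = 0"
      by (rule disj) (use S(1) XR sub e in \<open>simp_all add: subspace_diff\<close>)
    then show ?thesis by simp
  qed
  have ZX: "Z (X x) = S x" for x
    by (rule X_inj[OF Z(1) S(1)]) (simp add: Z(2) SX)
  have Z0: "Z x = 0" if "S x = 0" for x
    by (rule X_inj) (use Z[of x] that subspace_0[OF sub] in simp_all)
  show ?thesis
  proof (rule that[of m "id_blinfun - S" Z])
    show "0 < m" by (simp add: m_def)
    show "(?X ^^ m) ((id_blinfun - S) x) = 0" for x
      by (simp add: blinfun.diff_left Xm.diff S(2))
    show "Z ((id_blinfun - S) x) = 0" for x
      by (rule Z0) (simp add: blinfun.diff_left blinfun.diff_right S_id S(1))
  qed (simp_all add: blinfun.diff_left Z ZX S_id)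
qed

end

section \<open>Complex-linear operators\<close>

abbreviation (input) "cspan \<equiv> complex_vector.span"
abbreviation (input) "csubspace \<equiv> complex_vector.subspace"
abbreviation (input) "cindependent \<equiv> complex_vector.independent"

definition clinear_blinfun :: "('a::complex_hilbert_space \<Rightarrow>\<^sub>L 'b::complex_hilbert_space) \<Rightarrow> bool" where
  "clinear_blinfun T \<longleftrightarrow> (\<forall>a x. T (a *\<^sub>C x) = a *\<^sub>C T x)"

lemma clinear_blinfunD: "clinear_blinfun T \<Longrightarrow> T (a *\<^sub>C x) = a *\<^sub>C T x"
  by (simp add: clinear_blinfun_def)

lemma clinear_blinfun_intros:
  "clinear_blinfun id_blinfun" "clinear_blinfun 0"
  "clinear_blinfun S \<Longrightarrow> clinear_blinfun T \<Longrightarrow> clinear_blinfun (S + T)"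
  "clinear_blinfun S \<Longrightarrow> clinear_blinfun T \<Longrightarrow> clinear_blinfun (S - T)"
  "clinear_blinfun S \<Longrightarrow> clinear_blinfun R \<Longrightarrow> clinear_blinfun (S o\<^sub>L R)"
  "clinear_blinfun S \<Longrightarrow> clinear_blinfun (cscale c S)"
  "clinear_blinfun S \<Longrightarrow> clinear_blinfun (b *\<^sub>R S)"
  by (simp_all add: clinear_blinfun_def blinfun.add_left blinfun.diff_left scaleC_add_right
      complex_vector.scale_right_diff_distrib blinfun.scaleR_left scaleC_scaleR_commute
      complex_vector.scale_left_commute)

lemma norm_cscale_le: "norm (cscale c T) \<le> cmod c * norm T"
  by (rule norm_blinfun_bound)
    (auto simp: norm_scaleC mult.assoc intro!: mult_left_mono norm_blinfun)

lemma cscale_of_real: "cscale (of_real a) T = a *\<^sub>R T"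
  by (rule blinfun_eqI) (simp add: scaleC_of_real blinfun.scaleR_left)

lemma cscale_cscale: "cscale a (cscale b T) = cscale (a * b) T"
  by (rule blinfun_eqI) (simp add: scaleC_scaleC)

lemma cscale_sum_right: "cscale a (\<Sum>i\<in>I. T i) = (\<Sum>i\<in>I. cscale a (T i))"
  by (rule blinfun_eqI) (simp add: blinfun.sum_left complex_vector.scale_sum_right)

lemma bounded_bilinear_cscale:
  "bounded_bilinear (cscale :: complex \<Rightarrow> ('a::complex_hilbert_space \<Rightarrow>\<^sub>L 'b::complex_hilbert_space) \<Rightarrow> _)"
proof
  show "cscale (a + a') b = cscale a b + cscale a' b" for a a' and b :: "'a \<Rightarrow>\<^sub>L 'b"
    by (rule blinfun_eqI) (simp add: blinfun.add_left scaleC_add_left)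
  show "cscale a (b + b') = cscale a b + cscale a b'" for a and b b' :: "'a \<Rightarrow>\<^sub>L 'b"
    by (rule blinfun_eqI) (simp add: blinfun.add_left scaleC_add_right)
  show "cscale (r *\<^sub>R a) b = r *\<^sub>R cscale a b" for r a and b :: "'a \<Rightarrow>\<^sub>L 'b"
    by (simp add: scaleR_conv_of_real flip: cscale_of_real cscale_cscale)
  show "cscale a (r *\<^sub>R b) = r *\<^sub>R cscale a b" for r a and b :: "'a \<Rightarrow>\<^sub>L 'b"
    by (simp add: cscale_cscale mult.commute flip: cscale_of_real)
  show "\<exists>K. \<forall>a. \<forall>b::'a \<Rightarrow>\<^sub>L 'b. norm (cscale a b) \<le> norm a * norm b * K"
    by (rule exI[of _ 1]) (simp add: norm_cscale_le)
qed

lemma cscale_cancel: "a \<noteq> 0 \<Longrightarrow> cscale a S = cscale a T \<longleftrightarrow> S = T"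
  by (metis cscale_cscale left_inverse cscale_of_real of_real_1 scaleR_one)

lemma blinfun_eq_cinner:
  assumes "\<And>x y. cinner y (blinfun_apply S x) = cinner y (blinfun_apply T x)"
  shows "S = T"
  by (intro blinfun_eqI cinner_ext_right assms)

lemma compact_blinfun_comp_left:
  fixes S :: "'b::real_normed_vector \<Rightarrow>\<^sub>L 'c::real_normed_vector"
  assumes "compact_blinfun (K :: 'a::real_normed_vector \<Rightarrow>\<^sub>L 'b)"
  shows "compact_blinfun (S o\<^sub>L K)"
proof -
  let ?C = "blinfun_apply S ` closure (blinfun_apply K ` cball 0 1)"
  have c: "compact ?C"
    using assms unfolding compact_blinfun_def
    by (intro compact_continuous_image linear_continuous_on blinfun.bounded_linear_right)
  have "blinfun_apply (S o\<^sub>L K) ` cball 0 1 \<subseteq> ?C"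
    using closure_subset by fastforce
  then have "closure (blinfun_apply (S o\<^sub>L K) ` cball 0 1) \<subseteq> ?C"
    by (simp add: closure_minimal c compact_imp_closed)
  then show ?thesis
    unfolding compact_blinfun_def using c compact_Int_closed[OF c closed_closure] by (metis inf.absorb_iff2)
qed

lemma compact_blinfun_comp_right:
  fixes S :: "'a::real_normed_vector \<Rightarrow>\<^sub>L 'b::real_normed_vector"
  assumes "compact_blinfun (K :: 'b \<Rightarrow>\<^sub>L 'c::real_normed_vector)"
  shows "compact_blinfun (K o\<^sub>L S)"
proof -
  define n where "n = norm S + 1"
  have n: "n > 0" by (simp add: n_def add_nonneg_pos)
  let ?C = "(\<lambda>x. n *\<^sub>R x) ` closure (blinfun_apply K ` cball 0 1)"
  have c: "compact ?C"
    using assms unfolding compact_blinfun_def by (rule compact_scaling)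
  have "blinfun_apply (K o\<^sub>L S) ` cball 0 1 \<subseteq> ?C"
  proof clarify
    fix x :: 'a assume x: "x \<in> cball 0 1"
    have "norm (S x) \<le> norm S * norm x" by (rule norm_blinfun)
    also have "\<dots> \<le> n * 1" using x by (intro mult_mono) (auto simp: n_def)
    finally have "inverse n *\<^sub>R S x \<in> cball 0 1" using n by (simp add: field_simps)
    then have "K (inverse n *\<^sub>R S x) \<in> closure (blinfun_apply K ` cball 0 1)"
      by (rule subsetD[OF closure_subset, OF imageI])
    then show "(K o\<^sub>L S) x \<in> ?C"
      using n by (intro image_eqI[where x = "K (inverse n *\<^sub>R S x)"]) (simp_all add: blinfun.scaleR_right)
  qed
  then have "closure (blinfun_apply (K o\<^sub>L S) ` cball 0 1) \<subseteq> ?C"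
    by (simp add: closure_minimal c compact_imp_closed)
  then show ?thesis
    unfolding compact_blinfun_def using c compact_Int_closed[OF c closed_closure] by (metis inf.absorb_iff2)
qed

lemma compact_blinfun_cscale:
  assumes "compact_blinfun K"
  shows "compact_blinfun (cscale c K)"
proof -
  have "cscale c K = cscale c id_blinfun o\<^sub>L K"
    by (rule blinfun_eqI) simp
  then show ?thesis using compact_blinfun_comp_left[OF assms] by simp
qed

lemma compact_blinfun_limit:
  fixes K :: "'a::real_normed_vector \<Rightarrow>\<^sub>L 'b::banach"
  assumes lim: "(f \<longlongrightarrow> K) F" and F: "F \<noteq> bot" and f: "\<forall>\<^sub>F y in F. compact_blinfun (f y)"
  shows "compact_blinfun K"
  unfolding compact_blinfun_def compact_eq_totally_bounded
proof (intro conjI allI impI)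
  show "complete (closure (blinfun_apply K ` cball 0 1))"
    by (simp add: complete_eq_closed)
  fix e :: real assume e: "0 < e"
  have "\<forall>\<^sub>F y in F. dist (f y) K < e/3" using lim e by (intro tendstoD) auto
  then obtain y where y: "dist (f y) K < e/3" "compact_blinfun (f y)"
    using eventually_happens'[OF F eventually_conj[OF _ f]] by blast
  obtain k where k: "finite k" "closure (blinfun_apply (f y) ` cball 0 1) \<subseteq> (\<Union>x\<in>k. ball x (e/3))"
    using y(2) e unfolding compact_blinfun_def compact_eq_totally_bounded
    by (metis divide_pos_pos zero_less_numeral)
  have "closure (blinfun_apply K ` cball 0 1) \<subseteq> (\<Union>x\<in>k. cball x (2 * e/3))"
  proof (rule closure_minimal)
    show "closed (\<Union>x\<in>k. cball x (2 * e/3))" using k(1) by (auto intro: closed_UN)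
    show "blinfun_apply K ` cball 0 1 \<subseteq> (\<Union>x\<in>k. cball x (2 * e/3))"
    proof clarify
      fix x :: 'a assume x: "x \<in> cball 0 1"
      have "f y x \<in> closure (blinfun_apply (f y) ` cball 0 1)"
        by (rule subsetD[OF closure_subset, OF imageI, OF x])
      then obtain c where c: "c \<in> k" "dist c (f y x) < e/3" using k(2) by auto
      have "dist (f y x) (K x) = norm ((f y - K) x)" by (simp add: dist_norm blinfun.diff_left)
      also have "\<dots> \<le> norm (f y - K) * norm x" by (rule norm_blinfun)
      also have "\<dots> \<le> (e/3) * 1" using x y(1) e by (intro mult_mono) (auto simp: dist_norm)
      finally have "dist c (K x) \<le> 2 * e/3" using c(2) dist_triangle[of c "K x" "f y x"] by simp
      then show "K x \<in> (\<Union>x\<in>k. cball x (2 * e/3))" using c(1) by auto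
    qed
  qed
  also have "\<dots> \<subseteq> (\<Union>x\<in>k. ball x e)" using e by fastforce
  finally show "\<exists>k. finite k \<and> closure (blinfun_apply K ` cball 0 1) \<subseteq> (\<Union>x\<in>k. ball x e)"
    using k(1) by blast
qed

section \<open>Small perturbations of the identity\<close>

text \<open>Surjectivity comes from the Banach fixed point of \<open>y = x - M y\<close>; the lower
  bound \<open>1 - norm M\<close> gives injectivity and the norm estimate.\<close>

lemma neumann_inverse:
  fixes M :: "'a::banach \<Rightarrow>\<^sub>L 'a"
  assumes M: "norm M < 1"
  shows "\<exists>I. (id_blinfun + M) o\<^sub>L I = id_blinfun \<and> I o\<^sub>L (id_blinfun + M) = id_blinfun \<and>
    norm I \<le> 1 / (1 - norm M)"
proof -
  have below: "(1 - norm M) * norm x \<le> norm (x + M x)" for x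
  proof -
    have "norm x \<le> norm (x + M x) + norm (M x)"
      using norm_triangle_ineq4[of "x + M x" "M x"] by simp
    then show ?thesis using norm_blinfun[of M x] by (simp add: algebra_simps)
  qed
  have "\<exists>y. y + M y = x" for x
  proof -
    have "dist (x - M u) (x - M y) \<le> norm M * dist u y" for u y
      using norm_blinfun[of M "y - u"] by (simp add: dist_norm norm_minus_commute[of u] blinfun.diff_right)
    then have "\<exists>!y. x - M y = y"
      using M by (intro banach_fix_type[of "norm M"]) auto
    then show ?thesis by (metis diff_add_cancel)
  qed
  then have "\<exists>g. (\<forall>x. blinfun_apply g x \<in> UNIV) \<and> (\<forall>x. (id_blinfun + M) (blinfun_apply g x) = id_blinfun x)"
    using below M
    by (intro bounded_linear_solution[where \<delta> = "1 - norm M"] blinfun.bounded_linear_right)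
      (auto simp: blinfun.add_left)
  then obtain I where I: "\<And>x. blinfun_apply I x + M (blinfun_apply I x) = x" by (auto simp: blinfun.add_left)
  have inj: "x = y" if "x + M x = y + M y" for x y
  proof -
    have "x - y + M (x - y) = 0" using that by (simp add: blinfun.diff_right algebra_simps)
    then have "(1 - norm M) * norm (x - y) \<le> 0" using below[of "x - y"] by simp
    then show ?thesis using M by (simp add: mult_le_0_iff)
  qed
  show ?thesis
  proof (intro exI[of _ I] conjI)
    show "I o\<^sub>L (id_blinfun + M) = id_blinfun"
      by (rule blinfun_eqI, rule inj) (simp add: I blinfun.add_left)
    show "norm I \<le> 1 / (1 - norm M)"
    proof (rule norm_blinfun_bound)
      show "norm (I x) \<le> 1 / (1 - norm M) * norm x" for x
        using below[of "I x"] M by (simp add: I field_simps)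
    qed (use M in simp)
  qed (auto intro!: blinfun_eqI simp: blinfun.add_left I)
qed

lemma blinfun_inverse_diff:
  fixes X Y I I' :: "'a::real_normed_vector \<Rightarrow>\<^sub>L 'a"
  assumes "I o\<^sub>L X = id_blinfun" "Y o\<^sub>L I' = id_blinfun"
  shows "I - I' = I o\<^sub>L (Y - X) o\<^sub>L I'"
proof (rule blinfun_eqI)
  fix x
  have 1: "I (X y) = y" "Y (I' y) = y" for y
    using assms by (metis blinfun_apply_blinfun_compose blinfun_apply_id_blinfun id_apply)+
  show "(I - I') x = (I o\<^sub>L (Y - X) o\<^sub>L I') x"
    by (simp add: blinfun.diff_left blinfun.diff_right 1)
qed

text \<open>By \<open>blinfun_inverse_diff\<close> inverses converge with the operators as soon as
  they are uniformly bounded; norms below 1/2 give the bound 2.\<close>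

lemma tendsto_neumann_inverse:
  fixes M0 :: "'a::banach \<Rightarrow>\<^sub>L 'a"
  assumes lim: "(M \<longlongrightarrow> M0) F" and small: "norm M0 < 1/2"
    and I0: "(id_blinfun + M0) o\<^sub>L I0 = id_blinfun"
    and I: "\<forall>\<^sub>F y in F. I y o\<^sub>L (id_blinfun + M y) = id_blinfun"
  shows "(I \<longlongrightarrow> I0) F"
proof (rule Lim_transform2)
  show "((\<lambda>_. I0) \<longlongrightarrow> I0) F" by simp
  have sm: "\<forall>\<^sub>F y in F. norm (M y) < 1/2"
    using order_tendstoD(2)[OF tendsto_norm[OF lim] small] .
  have "\<forall>\<^sub>F y in F. norm (I0 - I y) \<le> norm (M y - M0) * (2 * norm I0)"
    using sm I
  proof eventually_elim
    case (elim y)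
    obtain I' where I': "(id_blinfun + M y) o\<^sub>L I' = id_blinfun" "norm I' \<le> 1 / (1 - norm (M y))"
      using neumann_inverse[of "M y"] elim(1) by auto
    have "I y = I'"
      using blinfun_inverse_diff[OF elim(2) I'(1)] by simp
    moreover have "1 / (1 - norm (M y)) \<le> 2" using elim(1) by (simp add: field_simps)
    ultimately have nI: "norm (I y) \<le> 2" using I'(2) by simp
    have "norm (I0 - I y) = norm (I y o\<^sub>L (M0 - M y) o\<^sub>L I0)"
      using blinfun_inverse_diff[OF elim(2) I0] by (metis add_diff_cancel_left norm_minus_commute)
    also have "\<dots> \<le> norm (I y) * norm (M0 - M y) * norm I0"
      by (rule order_trans[OF norm_blinfun_compose mult_right_mono[OF norm_blinfun_compose norm_ge_zero]])
    also have "\<dots> \<le> 2 * norm (M0 - M y) * norm I0"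
      using nI by (intro mult_right_mono) auto
    finally show ?case by (simp add: norm_minus_commute mult_ac)
  qed
  moreover have "((\<lambda>y. norm (M y - M0) * (2 * norm I0)) \<longlongrightarrow> 0) F"
    using tendsto_mult_right[OF tendsto_norm[OF LIM_zero[OF lim]], of "2 * norm I0"] by simp
  ultimately show "((\<lambda>y. I0 - I y) \<longlongrightarrow> 0) F"
    by (rule Lim_null_comparison)
qed

section \<open>The Riesz splitting at a point of a linear pencil\<close>

lemma funpow_pos: "0 < n \<Longrightarrow> (f ^^ n) y = (f ^^ (n - 1)) (f y)"
  by (cases n) (simp_all only: funpow_Suc_right o_apply diff_Suc_1)

text \<open>\<open>E\<close> is the projection onto the generalized kernel of \<open>X\<close> along its generalized range and
  \<open>Z\<close> inverts \<open>X\<close> on the latter.\<close>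

locale riesz_splitting =
  fixes X E Z :: "'a::real_normed_vector \<Rightarrow>\<^sub>L 'a" and m :: nat
  assumes m_pos: "0 < m" and X_funpow_E: "\<And>x. (blinfun_apply X ^^ m) (E x) = 0"
    and X_Z: "\<And>x. X (Z x) = x - E x" and Z_X: "\<And>x. Z (X x) = x - E x"
    and Z_E [simp]: "\<And>x. Z (E x) = 0" and E_Z [simp]: "\<And>x. E (Z x) = 0"
begin

lemma funpow_X: "bounded_linear (blinfun_apply X ^^ n)"
  by (rule funpow_bounded_linear)

lemma X_E: "X (E x) = E (X x)"
proof -
  have "X (x - E x) = X x - E (X x)" by (metis X_Z Z_X)
  then show ?thesis by (simp add: blinfun.diff_right)
qed

lemma E_E [simp]: "E (E x) = E x"
proof -
  have "E x - E (E x) = Z (E (X x))" by (metis Z_X X_E)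
  then show ?thesis by simp
qed

lemma X_eq_0_E: "X d = 0 \<Longrightarrow> E d = d"
  using Z_X[of d] by simp

lemma E_fixes_generalized_kernel: "(blinfun_apply X ^^ n) x = 0 \<Longrightarrow> E x = x"
proof (induction n arbitrary: x)
  case (Suc n)
  have "(blinfun_apply X ^^ n) (X x) = 0" using Suc.prems by (simp add: funpow_swap1)
  then have "E (X x) = X x" by (rule Suc.IH)
  then have "X (x - E x) = 0" by (simp add: blinfun.diff_right X_E)
  then have "E (x - E x) = x - E x" by (rule X_eq_0_E)
  then show ?case by (simp add: blinfun.diff_right)
qed simp

lemma X_funpow_Z_funpow: "E y = 0 \<Longrightarrow> (blinfun_apply X ^^ n) ((blinfun_apply Z ^^ n) y) = y"
proof (induction n)
  case (Suc n)
  have "E ((blinfun_apply Z ^^ n) y) = 0" using Suc.prems by (cases n) auto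
  then have "X (Z ((blinfun_apply Z ^^ n) y)) = (blinfun_apply Z ^^ n) y" by (simp add: X_Z)
  then show ?case using Suc by (simp add: funpow_swap1)
qed simp

lemma intertwine_funpow:
  assumes "\<And>x. T (X x) = X (T x)"
  shows "(blinfun_apply X ^^ n) (T x) = T ((blinfun_apply X ^^ n) x)"
  by (induction n) (simp_all add: assms)

text \<open>\<open>T\<close> preserves the generalized kernel, and also its complement, which
  consists of \<open>m\<close>-th powers of \<open>X\<close> applied to vectors. Additivity is the
  only linearity assumed, so complex scalar multiplication is an admissible \<open>T\<close>; this
  is how complex linearity of \<open>E\<close> and \<open>Z\<close> is obtained.\<close>

lemma commute_E:
  assumes T: "Modules.additive T" and comm: "\<And>x. T (X x) = X (T x)"
  shows "T (E x) = E (T x)"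
proof -
  interpret T: Modules.additive T by fact
  have 1: "E (T (E x)) = T (E x)" for x
    by (rule E_fixes_generalized_kernel[of m]) (simp add: intertwine_funpow[of T, OF comm] X_funpow_E T.zero)
  have "E (T (x - E x)) = 0"
  proof -
    define y where "y = x - E x"
    define w where "w = (blinfun_apply Z ^^ m) y"
    have "E y = 0" by (simp add: y_def blinfun.diff_right)
    then have "(blinfun_apply X ^^ m) w = y" unfolding w_def by (rule X_funpow_Z_funpow)
    then have "E (T y) = E ((blinfun_apply X ^^ m) (T w))"
      by (simp add: intertwine_funpow[of T, OF comm])
    also have "\<dots> = (blinfun_apply X ^^ m) (E (T w))"
      by (rule intertwine_funpow[of E, symmetric]) (simp add: X_E)
    finally show ?thesis by (simp add: y_def X_funpow_E)
  qed
  then show ?thesis by (simp add: T.diff blinfun.diff_right 1)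
qed

text \<open>The difference of the two sides is in the kernel of \<open>X\<close>, hence fixed by
  \<open>E\<close>, while \<open>E\<close> annihilates both sides.\<close>

lemma commute_Z:
  assumes T: "Modules.additive T" and comm: "\<And>x. T (X x) = X (T x)"
  shows "T (Z x) = Z (T x)"
proof -
  interpret T: Modules.additive T by fact
  note TE = commute_E[OF T comm]
  have "X (Z (T x) - T (Z x)) = 0"
    by (simp add: blinfun.diff_right X_Z flip: comm) (simp add: X_Z T.diff TE)
  then have "E (Z (T x) - T (Z x)) = Z (T x) - T (Z x)" by (rule X_eq_0_E)
  then show ?thesis by (simp add: blinfun.diff_right flip: TE) (simp add: T.zero)
qed

end

locale pencil_splitting = riesz_splitting X E Z m
  for X E Z :: "'k::complex_hilbert_space \<Rightarrow>\<^sub>L 'k" and m +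
  fixes A :: "'k \<Rightarrow>\<^sub>L 'k" and c :: complex
  assumes X_eq: "X = id_blinfun + cscale c A" and A_clinear: "clinear_blinfun A"
begin

lemma X_apply: "X x = x + c *\<^sub>C A x"
  by (simp add: X_eq blinfun.add_left)

lemma additive_blinfun: "Modules.additive (blinfun_apply T)"
  by unfold_locales (simp add: blinfun.add_right)

lemma A_X: "A (X x) = X (A x)"
  by (simp add: X_apply blinfun.add_right clinear_blinfunD[OF A_clinear])

lemma A_E: "A (E x) = E (A x)"
  by (rule commute_E[OF additive_blinfun A_X])

lemma scaleC_X: "a *\<^sub>C X x = X (a *\<^sub>C x)"
  by (simp add: X_apply scaleC_add_right clinear_blinfunD[OF A_clinear] complex_vector.scale_left_commute)

lemma additive_scaleC: "Modules.additive (\<lambda>x::'k. a *\<^sub>C x)"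
  by unfold_locales (simp add: scaleC_add_right)

lemma clinear_X: "clinear_blinfun X"
  by (simp add: clinear_blinfun_def scaleC_X)

lemma clinear_E: "clinear_blinfun E"
  by (simp add: clinear_blinfun_def commute_E[OF additive_scaleC scaleC_X])

lemma clinear_Z: "clinear_blinfun Z"
  by (simp add: clinear_blinfun_def commute_Z[OF additive_scaleC scaleC_X])

text \<open>\<open>nilp\<close> is \<open>- A\<^sup>-\<^sup>1 X\<close> on the range of \<open>E\<close>; there \<open>c A = - (1 - X)\<close> is inverted by a finite geometric series.\<close>

definition nilp :: "'k \<Rightarrow>\<^sub>L 'k" where
  "nilp = cscale c (\<Sum>k<m. Blinfun (blinfun_apply X ^^ Suc k) o\<^sub>L E)"

lemma nilp_apply: "nilp x = c *\<^sub>C (\<Sum>k<m. (blinfun_apply X ^^ Suc k) (E x))"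
  by (simp add: nilp_def blinfun.sum_left bounded_linear_Blinfun_apply[OF funpow_X] del: funpow.simps)

lemma commute_nilp:
  assumes T: "Modules.additive T" and comm: "\<And>x. T (X x) = X (T x)" and sc: "\<And>a x. T (a *\<^sub>C x) = a *\<^sub>C T x"
  shows "T (nilp x) = nilp (T x)"
proof -
  interpret T: Modules.additive T by fact
  show ?thesis
    by (simp add: nilp_apply sc T.sum commute_E[OF T comm] intertwine_funpow[of T, OF comm, symmetric] del: funpow.simps)
qed

lemma clinear_nilp: "clinear_blinfun nilp"
  unfolding clinear_blinfun_def
  by (auto intro!: commute_nilp[symmetric] additive_scaleC scaleC_X simp: complex_vector.scale_left_commute)

lemma A_nilp_commute: "A (nilp x) = nilp (A x)"
  by (rule commute_nilp[OF additive_blinfun A_X]) (simp add: clinear_blinfunD[OF A_clinear])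

lemma X_nilp_commute: "X (nilp x) = nilp (X x)"
  by (rule commute_nilp[OF additive_blinfun]) (simp_all add: scaleC_X)

lemma E_nilp_commute: "E (nilp x) = nilp (E x)"
  by (rule commute_nilp[OF additive_blinfun]) (simp_all add: X_E clinear_blinfunD[OF clinear_E])

lemma nilp_E [simp]: "nilp (E x) = nilp x"
  by (simp add: nilp_apply)

lemma E_nilp [simp]: "E (nilp x) = nilp x"
  by (simp add: E_nilp_commute)

lemma A_nilp: "A (nilp x) = - X (E x)"
proof -
  have cA: "c *\<^sub>C A y = X y - y" for y by (simp add: X_apply)
  have "A (nilp x) = (\<Sum>k<m. c *\<^sub>C A ((blinfun_apply X ^^ Suc k) (E x)))"
    by (simp add: nilp_apply clinear_blinfunD[OF A_clinear] blinfun.sum_right complex_vector.scale_sum_right del: funpow.simps)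
  also have "\<dots> = (\<Sum>k<m. (blinfun_apply X ^^ Suc (Suc k)) (E x) - (blinfun_apply X ^^ Suc k) (E x))"
    unfolding cA by simp
  also have "\<dots> = (blinfun_apply X ^^ Suc m) (E x) - (blinfun_apply X ^^ Suc 0) (E x)"
    by (rule sum_lessThan_telescope)
  finally show ?thesis by (simp add: X_funpow_E)
qed

text \<open>If \<open>A u = 0\<close> then \<open>X u = u\<close>, but \<open>X\<close> is nilpotent
  on the range of \<open>E\<close>.\<close>

lemma A_injective_on_E:
  assumes "E u = u" "A u = 0"
  shows "u = 0"
proof -
  have "X u = u" using assms(2) by (simp add: X_apply)
  then have "(blinfun_apply X ^^ n) u = u" for n by (induction n) auto
  then show ?thesis using X_funpow_E[of u] assms(1) by simp
qed

lemma funpow_E_fixed: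
  assumes "\<And>x. E (T x) = T (E x)" "E u = u"
  shows "E ((T ^^ n) u) = (T ^^ n) u"
  by (induction n) (simp_all add: assms)

text \<open>On the range of \<open>E\<close> one has \<open>X = - A nilp\<close>, where
  \<open>A\<close> is injective and commutes with everything involved, so powers of \<open>X\<close>
  and of \<open>nilp\<close> have the same kernels.\<close>

lemma nilp_funpow_eq_0_iff:
  assumes "E u = u"
  shows "(blinfun_apply nilp ^^ n) u = 0 \<longleftrightarrow> (blinfun_apply X ^^ n) u = 0"
  using assms
proof (induction n arbitrary: u)
  case (Suc n)
  have "(blinfun_apply X ^^ Suc n) u = (blinfun_apply X ^^ n) (X (E u))"
    using Suc.prems by (simp add: funpow_swap1)
  also have "\<dots> = (blinfun_apply X ^^ n) (A (- nilp u))"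
    by (simp add: blinfun.minus_right A_nilp)
  also have "\<dots> = A ((blinfun_apply X ^^ n) (- nilp u))"
    by (rule intertwine_funpow[of A, OF A_X])
  also have "\<dots> = - A ((blinfun_apply X ^^ n) (nilp u))"
    using linear_neg[OF bounded_linear.linear[OF funpow_X]] by (simp add: blinfun.minus_right)
  finally have "(blinfun_apply X ^^ Suc n) u = 0 \<longleftrightarrow> A ((blinfun_apply X ^^ n) (nilp u)) = 0" by simp
  also have "\<dots> \<longleftrightarrow> (blinfun_apply X ^^ n) (nilp u) = 0"
    using A_injective_on_E[OF funpow_E_fixed[of X "nilp u" n]] by (auto simp: X_E)
  also have "\<dots> \<longleftrightarrow> (blinfun_apply nilp ^^ n) (nilp u) = 0"
    using Suc.IH[of "nilp u"] by simp
  finally show ?case by (simp add: funpow_swap1)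
qed simp

lemma nilp_nilpotent: "(blinfun_apply nilp ^^ m) x = 0"
proof -
  have "(blinfun_apply nilp ^^ m) x = (blinfun_apply nilp ^^ m) (E x)"
    by (simp add: funpow_pos[OF m_pos])
  then show ?thesis using nilp_funpow_eq_0_iff[of "E x" m] by (simp add: X_funpow_E)
qed

text \<open>\<open>X + h A\<close> is the pencil moved by \<open>h\<close>. On the range of
  \<open>E\<close> the equation says \<open>nilp (E y) = h *\<^sub>C E y\<close>, impossible for a
  nilpotent operator unless \<open>E y = 0\<close>. On the complement \<open>y = Z (X y)\<close>,
  and the equation becomes \<open>(1 + h A Z) (X y) = 0\<close>.\<close>

lemma perturbed_injective:
  assumes h: "h \<noteq> 0" and I: "I o\<^sub>L (id_blinfun + cscale h (A o\<^sub>L Z)) = id_blinfun"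
    and y: "X y + h *\<^sub>C A y = 0"
  shows "y = 0"
proof -
  have "X (E y) + h *\<^sub>C A (E y) = E (X y + h *\<^sub>C A y)"
    by (simp add: X_E A_E blinfun.add_right clinear_blinfunD[OF clinear_E])
  then have 0: "X (E y) + h *\<^sub>C A (E y) = 0" by (simp add: y)
  then have "A (h *\<^sub>C E y - nilp y) = 0"
    by (simp add: blinfun.diff_right A_nilp clinear_blinfunD[OF A_clinear] add.commute)
  then have "h *\<^sub>C E y - nilp y = 0"
    by (rule A_injective_on_E[rotated]) (simp add: blinfun.diff_right clinear_blinfunD[OF clinear_E])
  then have N: "nilp (E y) = h *\<^sub>C E y" by simp
  have "(blinfun_apply nilp ^^ n) (E y) = h ^ n *\<^sub>C E y" for n
  proof (induction n)
    case (Suc n)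
    have "(blinfun_apply nilp ^^ Suc n) (E y) = nilp (h ^ n *\<^sub>C E y)" using Suc by simp
    also have "\<dots> = h ^ Suc n *\<^sub>C E y"
      by (simp only: clinear_blinfunD[OF clinear_nilp] N scaleC_scaleC) (simp add: mult.commute)
    finally show ?case .
  qed simp
  from this[of m] have "E y = 0" using h by (simp add: nilp_nilpotent)
  then have y': "y = Z (X y)" by (simp add: Z_X)
  have "(id_blinfun + cscale h (A o\<^sub>L Z)) (X y) = 0"
    using y by (simp add: blinfun.add_left flip: y')
  then have "X y = 0" using I by (metis blinfun.zero_right blinfun_apply_blinfun_compose blinfun_apply_id_blinfun id_apply)
  then show ?thesis using y' by simp
qed

text \<open>On the range of \<open>E\<close> the pencil is \<open>A (h - nilp)\<close>, whose
  inverse is a finite geometric series in \<open>nilp / h\<close>: this is the principal part. On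
  the complement the pencil is \<open>(1 + h A Z) X\<close>, which gives the summand with
  \<open>I\<close>, regular at \<open>h = 0\<close>.\<close>

lemma perturbed_solution:
  assumes h: "h \<noteq> 0" and I: "(id_blinfun + cscale h (A o\<^sub>L Z)) o\<^sub>L I = id_blinfun"
  defines "B \<equiv> (\<Sum>k<m. cscale (inverse (h ^ Suc k)) (Blinfun (blinfun_apply nilp ^^ k) o\<^sub>L E)) + (Z o\<^sub>L I o\<^sub>L (id_blinfun - E) o\<^sub>L A)"
  shows "X (B x) + h *\<^sub>C A (B x) = A x"
proof -
  define u where "u = (\<Sum>k<m. inverse (h ^ Suc k) *\<^sub>C (blinfun_apply nilp ^^ k) (E x))"
  define w where "w = I (A x - E (A x))"
  have Bx: "B x = u + Z w"
    by (simp add: B_def u_def w_def blinfun.add_left blinfun.sum_left blinfun.diff_left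
        bounded_linear_Blinfun_apply[OF funpow_bounded_linear])
  have Eu: "E u = u"
    by (simp add: u_def blinfun.sum_right clinear_blinfunD[OF clinear_E] funpow_E_fixed E_nilp_commute)
  \<comment> \<open>The series telescopes to \<open>E x\<close>, because the \<open>m\<close>-th
    power of \<open>nilp\<close> vanishes.\<close>
  have "h *\<^sub>C u - nilp u = (\<Sum>k<m. inverse (h ^ k) *\<^sub>C (blinfun_apply nilp ^^ k) (E x)
      - inverse (h ^ Suc k) *\<^sub>C (blinfun_apply nilp ^^ Suc k) (E x))"
    using h by (simp add: u_def blinfun.sum_right complex_vector.scale_sum_right sum_subtractf
        clinear_blinfunD[OF clinear_nilp] scaleC_scaleC mult.assoc[symmetric])
  also have "\<dots> = inverse (h ^ 0) *\<^sub>C (blinfun_apply nilp ^^ 0) (E x) - inverse (h ^ m) *\<^sub>C (blinfun_apply nilp ^^ m) (E x)"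
    by (rule sum_lessThan_telescope')
  finally have "h *\<^sub>C u - nilp u = E x" by (simp add: nilp_nilpotent)
  then have "A (h *\<^sub>C u - nilp u) = A (E x)" by simp
  then have 1: "X u + h *\<^sub>C A u = A (E x)"
    by (simp add: blinfun.diff_right A_nilp Eu clinear_blinfunD[OF A_clinear] add.commute)
  have w: "w + h *\<^sub>C A (Z w) = A x - E (A x)"
  proof -
    have "((id_blinfun + cscale h (A o\<^sub>L Z)) o\<^sub>L I) (A x - E (A x)) = A x - E (A x)"
      by (simp add: I)
    then show ?thesis by (simp add: w_def blinfun.add_left)
  qed
  then have "E (w + h *\<^sub>C A (Z w)) = 0" by (simp add: blinfun.diff_right)
  then have "E w = 0" by (simp add: blinfun.add_right clinear_blinfunD[OF clinear_E] flip: A_E)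
  then have 2: "X (Z w) + h *\<^sub>C A (Z w) = A x - E (A x)" by (simp add: X_Z w)
  have "X (B x) + h *\<^sub>C A (B x) = (X u + h *\<^sub>C A u) + (X (Z w) + h *\<^sub>C A (Z w))"
    by (simp only: Bx blinfun.add_right scaleC_add_right add_ac)
  then show ?thesis unfolding 1 2 by (simp add: A_E)
qed

end

lemma pencil_splitting_exists:
  fixes A :: "'k::complex_hilbert_space \<Rightarrow>\<^sub>L 'k"
  assumes "compact_blinfun A" "clinear_blinfun A"
  shows "\<exists>E Z m. pencil_splitting (id_blinfun + cscale c A) E Z m A c"
proof (rule riesz_decomposition[OF compact_blinfun_cscale[OF assms(1)] refl, of c])
  fix m and E Z :: "'k \<Rightarrow>\<^sub>L 'k"
  let ?X = "id_blinfun + cscale c A"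
  assume "0 < m" "\<And>x. (blinfun_apply ?X ^^ m) (E x) = 0" "\<And>x. ?X (Z x) = x - E x"
    "\<And>x. Z (?X x) = x - E x" "\<And>x. Z (E x) = 0" "\<And>x. E (Z x) = 0"
  then have "pencil_splitting ?X E Z m A c"
    by (intro pencil_splitting.intro riesz_splitting.intro pencil_splitting_axioms.intro assms(2) refl)
  then show ?thesis by blast
qed

section \<open>Holomorphic and meromorphic operator functions\<close>

lemma op_holomorphic_on_subset: "op_holomorphic_on f S \<Longrightarrow> T \<subseteq> S \<Longrightarrow> op_holomorphic_on f T"
  unfolding op_holomorphic_on_def by (meson has_derivative_subset subset_iff)

lemma op_holomorphic_on_const: "op_holomorphic_on (\<lambda>_. T) S"
  unfolding op_holomorphic_on_def
  by (auto intro!: exI[of _ 0] simp: bounded_bilinear.zero_right[OF bounded_bilinear_cscale])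

lemma op_holomorphic_on_add:
  assumes "op_holomorphic_on f S" "op_holomorphic_on g S"
  shows "op_holomorphic_on (\<lambda>w. f w + g w) S"
  unfolding op_holomorphic_on_def
proof
  fix z assume z: "z \<in> S"
  obtain D where "(f has_derivative (\<lambda>h. cscale h D)) (at z within S)"
    using assms(1) z unfolding op_holomorphic_on_def by blast
  moreover obtain D' where "(g has_derivative (\<lambda>h. cscale h D')) (at z within S)"
    using assms(2) z unfolding op_holomorphic_on_def by blast
  ultimately have "((\<lambda>w. f w + g w) has_derivative (\<lambda>h. cscale h D + cscale h D')) (at z within S)"
    by (rule has_derivative_add)
  then show "\<exists>D. ((\<lambda>w. f w + g w) has_derivative (\<lambda>h. cscale h D)) (at z within S)"
    by (intro exI[of _ "D + D'"]) (simp add: bounded_bilinear.add_right[OF bounded_bilinear_cscale])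
qed

lemma op_holomorphic_on_sum:
  assumes "\<And>i. i \<in> I \<Longrightarrow> op_holomorphic_on (f i) S"
  shows "op_holomorphic_on (\<lambda>w. \<Sum>i\<in>I. f i w) S"
  using assms
  by (induction I rule: infinite_finite_induct) (simp_all add: op_holomorphic_on_const op_holomorphic_on_add)

lemma op_holomorphic_on_cscale:
  assumes "\<phi> holomorphic_on S" "op_holomorphic_on g S"
  shows "op_holomorphic_on (\<lambda>w. cscale (\<phi> w) (g w)) S"
  unfolding op_holomorphic_on_def
proof
  fix z assume z: "z \<in> S"
  obtain D where D: "(g has_derivative (\<lambda>h. cscale h D)) (at z within S)"
    using assms(2) z unfolding op_holomorphic_on_def by blast
  obtain d where "(\<phi> has_field_derivative d) (at z within S)"
    using assms(1) z unfolding holomorphic_on_def field_differentiable_def by blast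
  then have d: "(\<phi> has_derivative (\<lambda>h. d * h)) (at z within S)"
    by (simp add: has_field_derivative_def)
  have "((\<lambda>w. cscale (\<phi> w) (g w)) has_derivative (\<lambda>h. cscale (\<phi> z) (cscale h D) + cscale (d * h) (g z))) (at z within S)"
    by (rule bounded_bilinear.FDERIV[OF bounded_bilinear_cscale d D])
  moreover have "cscale (\<phi> z) (cscale h D) + cscale (d * h) (g z) = cscale h (cscale (\<phi> z) D + cscale d (g z))" for h
    by (simp add: bounded_bilinear.add_right[OF bounded_bilinear_cscale] cscale_cscale mult.commute)
  ultimately show "\<exists>D. ((\<lambda>w. cscale (\<phi> w) (g w)) has_derivative (\<lambda>h. cscale h D)) (at z within S)"
    by auto
qed

lemma op_holomorphic_on_compose:
  assumes L: "clinear_blinfun L" and f: "op_holomorphic_on f S"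
  shows "op_holomorphic_on (\<lambda>w. L o\<^sub>L f w o\<^sub>L R) S"
  unfolding op_holomorphic_on_def
proof
  fix z assume z: "z \<in> S"
  obtain D where D: "(f has_derivative (\<lambda>h. cscale h D)) (at z within S)"
    using f z unfolding op_holomorphic_on_def by blast
  have bl: "bounded_linear (\<lambda>T. L o\<^sub>L T o\<^sub>L R)"
    by (intro bounded_linear_compose[OF bounded_bilinear.bounded_linear_left bounded_bilinear.bounded_linear_right]
        bounded_bilinear_blinfun_compose)
  have "((\<lambda>w. L o\<^sub>L f w o\<^sub>L R) has_derivative (\<lambda>h. L o\<^sub>L cscale h D o\<^sub>L R)) (at z within S)"
    by (rule bounded_linear.has_derivative[OF bl D])
  moreover have "L o\<^sub>L cscale h D o\<^sub>L R = cscale h (L o\<^sub>L D o\<^sub>L R)" for h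
    by (rule blinfun_eqI) (simp add: clinear_blinfunD[OF L])
  ultimately show "\<exists>D. ((\<lambda>w. L o\<^sub>L f w o\<^sub>L R) has_derivative (\<lambda>h. cscale h D)) (at z within S)"
    by auto
qed

lemma op_holomorphic_on_continuous: "op_holomorphic_on f S \<Longrightarrow> continuous_on S f"
  unfolding op_holomorphic_on_def continuous_on_eq_continuous_within
  using has_derivative_continuous by blast

lemma op_holomorphic_on_cinner:
  assumes "op_holomorphic_on f S"
  shows "(\<lambda>w. cinner y (f w x)) holomorphic_on S"
  unfolding holomorphic_on_def field_differentiable_def
proof
  fix z assume z: "z \<in> S"
  obtain D where D: "(f has_derivative (\<lambda>h. cscale h D)) (at z within S)"
    using assms z unfolding op_holomorphic_on_def by blast
  have bl: "bounded_linear (\<lambda>T. cinner y (blinfun_apply T x))"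
    by (intro bounded_linear_compose[OF bounded_linear_cinner_right blinfun.bounded_linear_left])
  have "((\<lambda>w. cinner y (f w x)) has_derivative (\<lambda>h. cinner y (cscale h D x))) (at z within S)"
    by (rule bounded_linear.has_derivative[OF bl D])
  then show "\<exists>f'. ((\<lambda>w. cinner y (f w x)) has_field_derivative f') (at z within S)"
    by (intro exI[of _ "cinner y (D x)"])
      (simp add: has_field_derivative_def cinner_scaleC_right mult.commute[of _ "cinner y (D x)"])
qed

lemma islimpt_delete: "x islimpt (S - {a}) \<longleftrightarrow> x islimpt S"
  for x :: "'a::t1_space"
  by (metis insert_Diff_single islimpt_insert)

lemma clinear_inverse:
  fixes X I :: "'a::complex_hilbert_space \<Rightarrow>\<^sub>L 'a"
  assumes "clinear_blinfun X" "I o\<^sub>L X = id_blinfun" "X o\<^sub>L I = id_blinfun"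
  shows "clinear_blinfun I"
  unfolding clinear_blinfun_def
proof (intro allI)
  fix a x
  have 1: "I (X y) = y" "X (I y) = y" for y
    using assms(2,3) by (metis blinfun_apply_blinfun_compose blinfun_apply_id_blinfun id_apply)+
  have "I (a *\<^sub>C x) = I (X (a *\<^sub>C I x))"
    by (simp add: clinear_blinfunD[OF assms(1)] 1)
  then show "I (a *\<^sub>C x) = a *\<^sub>C I x" by (simp add: 1)
qed

text \<open>The identity \<open>I w - I z = (z - w) I w M I z\<close> makes \<open>I\<close>
  Lipschitz, thanks to the uniform bound; used a second time it gives the derivative
  \<open>- I z M I z\<close>.\<close>

lemma op_holomorphic_on_inverse:
  fixes M :: "'a::complex_hilbert_space \<Rightarrow>\<^sub>L 'a"
  assumes M: "clinear_blinfun M"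
    and I: "\<And>w. w \<in> S \<Longrightarrow> (id_blinfun + cscale (w - r) M) o\<^sub>L I w = id_blinfun"
      "\<And>w. w \<in> S \<Longrightarrow> I w o\<^sub>L (id_blinfun + cscale (w - r) M) = id_blinfun"
    and bound: "\<And>w. w \<in> S \<Longrightarrow> norm (I w) \<le> 2"
  shows "op_holomorphic_on I S"
  unfolding op_holomorphic_on_def
proof
  fix z assume z: "z \<in> S"
  have Icl: "clinear_blinfun (I w)" if "w \<in> S" for w
    by (rule clinear_inverse[OF _ I(2)[OF that] I(1)[OF that]]) (intro clinear_blinfun_intros M)
  have d: "I w - I z = cscale (z - w) (I w o\<^sub>L M o\<^sub>L I z)" if w: "w \<in> S" for w
  proof -
    have "I w - I z = I w o\<^sub>L ((id_blinfun + cscale (z - r) M) - (id_blinfun + cscale (w - r) M)) o\<^sub>L I z"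
      by (rule blinfun_inverse_diff[OF I(2)[OF w] I(1)[OF z]])
    also have "(id_blinfun + cscale (z - r) M) - (id_blinfun + cscale (w - r) M) = cscale (z - w) M"
      by (simp add: bounded_bilinear.diff_left[OF bounded_bilinear_cscale])
    also have "I w o\<^sub>L cscale (z - w) M o\<^sub>L I z = cscale (z - w) (I w o\<^sub>L M o\<^sub>L I z)"
      by (rule blinfun_eqI) (simp add: clinear_blinfunD[OF Icl[OF w]])
    finally show ?thesis .
  qed
  define D where "D = - (I z o\<^sub>L M o\<^sub>L I z)"
  have comp3: "norm (P o\<^sub>L M o\<^sub>L I z) \<le> norm P * (norm M * 2)" for P :: "'a \<Rightarrow>\<^sub>L 'a"
  proof -
    have "norm (P o\<^sub>L M o\<^sub>L I z) \<le> norm P * norm M * norm (I z)"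
      by (rule order_trans[OF norm_blinfun_compose mult_right_mono[OF norm_blinfun_compose norm_ge_zero]])
    also have "\<dots> \<le> norm P * norm M * 2" using bound[OF z] by (intro mult_left_mono) auto
    finally show ?thesis by (simp add: mult.assoc)
  qed
  have "(I has_derivative (\<lambda>h. cscale h D)) (at z within S)"
  \<comment> \<open>The constant 8 is the product of the Lipschitz factor \<open>4 * norm M\<close>
    from \<open>n1\<close> and the factor \<open>norm M * 2\<close> from
    \<open>comp3\<close>.\<close>
  proof (rule has_derivativeI_sandwich[where e = 1 and H = "\<lambda>w. cmod (w - z) * (8 * norm M * norm M)"])
    show "bounded_linear (\<lambda>h. cscale h D)"
      by (rule bounded_bilinear.bounded_linear_left[OF bounded_bilinear_cscale])
    fix w assume w: "w \<in> S" "w \<noteq> z"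
    have eq: "I w - I z - cscale (w - z) D = cscale (z - w) ((I w - I z) o\<^sub>L M o\<^sub>L I z)"
    proof (rule blinfun_eqI)
      fix x
      have "(I w - I z) x = cscale (z - w) (I w o\<^sub>L M o\<^sub>L I z) x" by (simp add: d[OF w(1)])
      then show "(I w - I z - cscale (w - z) D) x = cscale (z - w) ((I w - I z) o\<^sub>L M o\<^sub>L I z) x"
        by (simp add: D_def blinfun.diff_left blinfun.minus_left complex_vector.scale_right_diff_distrib
            complex_vector.scale_left_diff_distrib)
    qed
    have n1: "norm (I w - I z) \<le> cmod (w - z) * (4 * norm M)"
    proof -
      have "norm (I w - I z) \<le> cmod (z - w) * norm (I w o\<^sub>L M o\<^sub>L I z)"
        unfolding d[OF w(1)] by (rule norm_cscale_le)
      also have "\<dots> \<le> cmod (z - w) * (2 * (norm M * 2))"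
        using bound[OF w(1)] by (intro mult_left_mono order_trans[OF comp3] mult_right_mono) auto
      finally show ?thesis by (simp add: norm_minus_commute)
    qed
    have "norm (I w - I z - cscale (w - z) D) \<le> cmod (z - w) * norm ((I w - I z) o\<^sub>L M o\<^sub>L I z)"
      unfolding eq by (rule norm_cscale_le)
    also have "\<dots> \<le> cmod (z - w) * ((cmod (w - z) * (4 * norm M)) * (norm M * 2))"
      using n1 by (intro mult_left_mono order_trans[OF comp3] mult_right_mono) auto
    finally have "norm (I w - I z - cscale (w - z) D) \<le> cmod (w - z) * (cmod (w - z) * (8 * norm M * norm M))"
      by (simp add: norm_minus_commute mult_ac)
    then show "norm (I w - I z - cscale (w - z) D) / norm (w - z) \<le> cmod (w - z) * (8 * norm M * norm M)"
      using w(2) by (simp add: divide_le_eq mult_ac)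
  next
    have "((\<lambda>w. cmod (w - z) * (8 * norm M * norm M)) \<longlongrightarrow> cmod (z - z) * (8 * norm M * norm M)) (at z within S)"
      by (intro tendsto_intros)
    then show "((\<lambda>w. cmod (w - z) * (8 * norm M * norm M)) \<longlongrightarrow> 0) (at z within S)" by simp
  qed simp
  then show "\<exists>D. (I has_derivative (\<lambda>h. cscale h D)) (at z within S)" by blast
qed

text \<open>Near every point both functions become holomorphic after multiplication by the same power of
  \<open>w - z\<close>, so the set of points near which they agree is open and closed.\<close>

lemma op_meromorphic_identity:
  fixes f g :: "complex \<Rightarrow> 'a::complex_hilbert_space \<Rightarrow>\<^sub>L 'b::complex_hilbert_space"
  assumes f: "op_meromorphic f" and g: "op_meromorphic g"
    and eq: "\<And>w. w \<in> T \<Longrightarrow> f w = g w" and z0: "z0 islimpt T"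
  shows "\<exists>e>0. \<forall>w\<in>ball z e - {z}. f w = g w"
proof -
  define U where "U = {z. \<exists>e>0. \<forall>w\<in>ball z e - {z}. f w = g w}"
  \<comment> \<open>The radius depends on \<open>z\<close> only and serves every accumulation point
    \<open>p\<close> in the ball. This uniformity is what shows that the complement of
    \<open>U\<close> is open.\<close>
  have local: "\<exists>e>0. \<forall>T p. p \<in> ball z e \<longrightarrow> p islimpt T \<longrightarrow> (\<forall>w\<in>T. f w = g w) \<longrightarrow>
      (\<forall>w\<in>ball z e - {z}. f w = g w)" for z
  proof -
    obtain n F e1 where F: "e1 > 0" "op_holomorphic_on F (ball z e1)"
      "\<And>w. w \<in> ball z e1 - {z} \<Longrightarrow> f w = cscale (inverse ((w - z) ^ n)) (F w)"
      using f unfolding op_meromorphic_def by metis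
    obtain n' G e2 where G: "e2 > 0" "op_holomorphic_on G (ball z e2)"
      "\<And>w. w \<in> ball z e2 - {z} \<Longrightarrow> g w = cscale (inverse ((w - z) ^ n')) (G w)"
      using g unfolding op_meromorphic_def by metis
    define e where "e = min e1 e2"
    have e: "e > 0" "ball z e \<subseteq> ball z e1" "ball z e \<subseteq> ball z e2" using F(1) G(1) by (auto simp: e_def)
    have "f w = g w" if T: "p \<in> ball z e" "p islimpt T" "\<forall>w\<in>T. f w = g w" and w: "w \<in> ball z e - {z}" for T p w
    proof (rule blinfun_eq_cinner)
      fix x y
      \<comment> \<open>Both poles are cleared by cross-multiplication; away from \<open>z\<close>
        the function \<open>v\<close> vanishes exactly where the matrix elements of \<open>f\<close>
        and \<open>g\<close> agree.\<close>
      define v where "v u = (u - z) ^ n' * cinner y (F u x) - (u - z) ^ n * cinner y (G u x)" for u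
      have fv: "cinner y (f u x) = cinner y (g u x) \<longleftrightarrow> v u = 0" if u: "u \<in> ball z e - {z}" for u
      proof -
        have "f u = cscale (inverse ((u - z) ^ n)) (F u)" "g u = cscale (inverse ((u - z) ^ n')) (G u)"
          using u e F(3) G(3) by blast+
        moreover have "u - z \<noteq> 0" using u by auto
        ultimately show ?thesis
          by (simp add: v_def cinner_scaleC_right field_simps)
      qed
      have "v w = 0"
      proof (rule analytic_continuation[where f = v and S = "ball z e" and U = "T \<inter> (ball z e - {z})" and \<xi> = p])
        show "v holomorphic_on ball z e"
          unfolding v_def
          by (intro holomorphic_intros op_holomorphic_on_cinner op_holomorphic_on_subset[OF F(2) e(2)]
              op_holomorphic_on_subset[OF G(2) e(3)])
        have "p islimpt (T \<inter> ball z e)"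
          using T(1,2) by (intro islimpt_Int_eventually eventually_at_in_open') auto
        then have "p islimpt (T \<inter> ball z e - {z})"
          by (simp add: islimpt_delete)
        then show "p islimpt T \<inter> (ball z e - {z})" by (simp add: Int_Diff)
        show "v u = 0" if "u \<in> T \<inter> (ball z e - {z})" for u
          using that fv[of u] T(3) by auto
      qed (use T(1) w in auto)
      then show "cinner y (f w x) = cinner y (g w x)" using fv[OF w] by simp
    qed
    then show ?thesis using e(1) by (intro exI[of _ e]) blast
  qed
  have UI: "z \<in> U" if "z islimpt T" "\<forall>w\<in>T. f w = g w" for z T
  proof -
    obtain e where e: "e > 0" "\<forall>T p. p \<in> ball z e \<longrightarrow> p islimpt T \<longrightarrow> (\<forall>w\<in>T. f w = g w) \<longrightarrow>
      (\<forall>w\<in>ball z e - {z}. f w = g w)" using local by blast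
    have "z \<in> ball z e" using e(1) by simp
    then have "\<forall>w\<in>ball z e - {z}. f w = g w" using e(2) that by blast
    then show ?thesis using e(1) by (auto simp: U_def)
  qed
  have "z0 \<in> U" using UI[OF z0] eq by blast
  have lim: "u islimpt (ball u e - {u})" if "e > 0" for u :: complex and e
    using that by (simp add: islimpt_delete interior_limit_point)
  have "open U"
    unfolding open_contains_ball
  proof
    fix z assume "z \<in> U"
    then obtain e where e: "e > 0" "\<forall>w\<in>ball z e - {z}. f w = g w" by (auto simp: U_def)
    have "w \<in> U" if w: "w \<in> ball z e" for w
    proof (rule UI[OF _ e(2)])
      show "w islimpt ball z e - {z}" using w by (simp add: islimpt_delete interior_limit_point)
    qed
    then show "\<exists>e>0. ball z e \<subseteq> U" using e(1) by blast
  qed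
  moreover have "open (- U)"
    unfolding open_contains_ball
  proof
    fix z assume z: "z \<in> - U"
    obtain e where e: "e > 0" "\<forall>T p. p \<in> ball z e \<longrightarrow> p islimpt T \<longrightarrow> (\<forall>w\<in>T. f w = g w) \<longrightarrow>
      (\<forall>w\<in>ball z e - {z}. f w = g w)" using local by blast
    have "p \<notin> U" if p: "p \<in> ball z e" for p
    proof
      assume "p \<in> U"
      then obtain d where d: "d > 0" "\<forall>w\<in>ball p d - {p}. f w = g w" by (auto simp: U_def)
      then have "\<forall>w\<in>ball z e - {z}. f w = g w" using e(2) p lim[OF d(1)] by blast
      then show False using z e(1) by (auto simp: U_def)
    qed
    then show "\<exists>e>0. ball z e \<subseteq> - U" using e(1) by blast
  qed
  ultimately have "U = {} \<or> U = UNIV"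
    using connected_UNIV clopen by (metis closed_def)
  then have "z \<in> U" using \<open>z0 \<in> U\<close> by auto
  then show ?thesis by (simp add: U_def)
qed

section \<open>Residues\<close>

text \<open>Cauchy's formula for the derivatives of the constant function 1, all of which vanish for
  \<open>k > 0\<close>.\<close>

lemma has_contour_integral_inverse_power:
  assumes "0 < \<epsilon>"
  shows "((\<lambda>w. inverse ((w - r) ^ Suc k)) has_contour_integral (if k = 0 then 2 * pi * \<i> else 0)) (circlepath r \<epsilon>)"
proof -
  have "((\<lambda>u. 1 / (u - r) ^ Suc k) has_contour_integral (2 * pi * \<i>) / (fact k) * (deriv ^^ k) (\<lambda>_. 1) r) (circlepath r \<epsilon>)"
    using assms by (intro Cauchy_has_contour_integral_higher_derivative_circlepath) auto
  then show ?thesis by (simp add: inverse_eq_divide split: if_splits)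
qed

lemma has_op_contour_integral_cscale:
  assumes "(\<phi> has_contour_integral i) \<gamma>"
  shows "has_op_contour_integral (\<lambda>w. cscale (\<phi> w) T) (cscale i T) \<gamma>"
proof -
  have "((\<lambda>c. cscale c T) \<circ> (\<lambda>t. \<phi> (\<gamma> t) * vector_derivative \<gamma> (at t within {0..1})) has_integral cscale i T) {0..1}"
    using assms unfolding has_contour_integral_def
    by (rule has_integral_linear) (rule bounded_bilinear.bounded_linear_left[OF bounded_bilinear_cscale])
  then show ?thesis
    by (simp add: has_op_contour_integral_def o_def cscale_cscale mult.commute)
qed

lemma has_op_contour_integral_add:
  "has_op_contour_integral f I \<gamma> \<Longrightarrow> has_op_contour_integral g K \<gamma> \<Longrightarrow>
    has_op_contour_integral (\<lambda>w. f w + g w) (I + K) \<gamma>"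
  unfolding has_op_contour_integral_def bounded_bilinear.add_right[OF bounded_bilinear_cscale]
  by (rule has_integral_add)

lemma has_op_contour_integral_sum:
  assumes "finite A" "\<And>i. i \<in> A \<Longrightarrow> has_op_contour_integral (f i) (I i) \<gamma>"
  shows "has_op_contour_integral (\<lambda>w. \<Sum>i\<in>A. f i w) (\<Sum>i\<in>A. I i) \<gamma>"
  using has_integral_sum[OF assms(1), of "\<lambda>i t. cscale (vector_derivative \<gamma> (at t within {0..1})) (f i (\<gamma> t))" I] assms(2)
  by (simp add: has_op_contour_integral_def cscale_sum_right)

text \<open>Continuity gives existence of the operator integral; its value is tested on matrix
  elements, to which the scalar Cauchy theorem applies.\<close>

lemma has_op_contour_integral_holomorphic:
  fixes R :: "complex \<Rightarrow> 'a::complex_hilbert_space \<Rightarrow>\<^sub>L 'b::complex_hilbert_space"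
  assumes R: "op_holomorphic_on R (ball r e)" and \<epsilon>: "0 < \<epsilon>" "\<epsilon> < e"
  shows "has_op_contour_integral R 0 (circlepath r \<epsilon>)"
proof -
  let ?\<gamma> = "circlepath r \<epsilon>"
  let ?f = "\<lambda>t. cscale (vector_derivative ?\<gamma> (at t within {0..1})) (R (?\<gamma> t))"
  have img: "path_image ?\<gamma> \<subseteq> ball r e" using \<epsilon> by auto
  have "continuous_on {0..1} (\<lambda>t. cscale (2 * pi * \<i> * \<epsilon> * exp (2 * of_real pi * \<i> * of_real t)) (R (?\<gamma> t)))"
  proof (intro bounded_bilinear.continuous_on[OF bounded_bilinear_cscale] continuous_intros)
    show "continuous_on {0..1} (\<lambda>t. R (?\<gamma> t))"
    proof (rule continuous_on_compose2[OF op_holomorphic_on_continuous[OF R]])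
      show "continuous_on {0..1} ?\<gamma>" using path_circlepath[of r \<epsilon>] by (simp add: path_def)
      show "?\<gamma> ` {0..1} \<subseteq> ball r e" using img by (simp add: path_image_def)
    qed
  qed
  then have "continuous_on {0..1} ?f"
    by (rule continuous_on_eq) (simp add: vector_derivative_circlepath01)
  then have "?f integrable_on {0..1}" by (rule integrable_continuous_real)
  then obtain I where I: "(?f has_integral I) {0..1}" by blast
  have "I = 0"
  proof (rule blinfun_eq_cinner)
    fix x :: 'a and y :: 'b
    have bl: "bounded_linear (\<lambda>T :: 'a \<Rightarrow>\<^sub>L 'b. cinner y (blinfun_apply T x))"
      by (intro bounded_linear_compose[OF bounded_linear_cinner_right blinfun.bounded_linear_left])
    have "((\<lambda>w. cinner y (R w x)) has_contour_integral cinner y (I x)) ?\<gamma>"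
      using has_integral_linear[OF I bl]
      by (simp add: has_contour_integral_def o_def cinner_scaleC_right mult.commute)
    moreover have "((\<lambda>w. cinner y (R w x)) has_contour_integral 0) ?\<gamma>"
      using img by (intro Cauchy_theorem_disc_simple[of _ r e] op_holomorphic_on_cinner R) auto
    ultimately have "cinner y (I x) = 0" by (rule has_contour_integral_unique)
    then show "cinner y (I x) = cinner y ((0 :: 'a \<Rightarrow>\<^sub>L 'b) x)" by simp
  qed
  then show ?thesis using I by (simp add: has_op_contour_integral_def)
qed

lemma op_residue_eq:
  assumes e: "0 < e" and m: "0 < m" and R: "op_holomorphic_on R (ball r e)"
    and f: "\<And>w. w \<in> ball r e - {r} \<Longrightarrow> f w = (\<Sum>k<m. cscale (inverse ((w - r) ^ Suc k)) (C k)) + R w"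
  shows "op_residue f r = C 0"
proof -
  have int: "has_op_contour_integral f (cscale (2 * pi * \<i>) (C 0)) (circlepath r \<epsilon>)" if \<epsilon>: "0 < \<epsilon>" "\<epsilon> < e" for \<epsilon>
  proof -
    let ?g = "\<lambda>w. (\<Sum>k<m. cscale (inverse ((w - r) ^ Suc k)) (C k)) + R w"
    have 1: "has_op_contour_integral ?g
       ((\<Sum>k<m. cscale (if k = 0 then 2 * pi * \<i> else 0) (C k)) + 0) (circlepath r \<epsilon>)"
    proof (rule has_op_contour_integral_add[OF has_op_contour_integral_sum])
      show "has_op_contour_integral R 0 (circlepath r \<epsilon>)"
        by (rule has_op_contour_integral_holomorphic[OF R \<epsilon>])
    qed (simp_all only: finite_lessThan has_op_contour_integral_cscale[OF has_contour_integral_inverse_power[OF \<epsilon>(1)]])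
    have 2: "(\<Sum>k<m. cscale (if k = 0 then 2 * pi * \<i> else 0) (C k)) = (\<Sum>k\<in>{0}. cscale (2 * pi * \<i>) (C k))"
      using m by (intro sum.mono_neutral_cong_right) (auto simp: bounded_bilinear.zero_left[OF bounded_bilinear_cscale])
    have 3: "f (circlepath r \<epsilon> t) = ?g (circlepath r \<epsilon> t)" if "t \<in> {0..1}" for t
    proof (rule f)
      have "circlepath r \<epsilon> t \<in> path_image (circlepath r \<epsilon>)" using that by (auto simp: path_image_def)
      then show "circlepath r \<epsilon> t \<in> ball r e - {r}" using \<epsilon> by auto
    qed
    have "has_op_contour_integral ?g (cscale (2 * pi * \<i>) (C 0)) (circlepath r \<epsilon>)"
      using 1 unfolding 2 by simp
    then show ?thesis
      unfolding has_op_contour_integral_def by (rule has_integral_eq[rotated]) (simp only: 3)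
  qed
  show ?thesis
    unfolding op_residue_def
  proof (rule some_equality)
    show "\<exists>e>0. \<forall>\<epsilon>>0. \<epsilon> < e \<longrightarrow> has_op_contour_integral f (cscale (2 * pi * \<i>) (C 0)) (circlepath r \<epsilon>)"
      using int e by blast
    fix T assume "\<exists>e>0. \<forall>\<epsilon>>0. \<epsilon> < e \<longrightarrow> has_op_contour_integral f (cscale (2 * pi * \<i>) T) (circlepath r \<epsilon>)"
    then obtain d where d: "d > 0" "\<And>\<epsilon>. 0 < \<epsilon> \<Longrightarrow> \<epsilon> < d \<Longrightarrow> has_op_contour_integral f (cscale (2 * pi * \<i>) T) (circlepath r \<epsilon>)"
      by blast
    \<comment> \<open>A circle below both radii carries both integrals, so the residue selected by
      \<open>SOME\<close> is unique.\<close>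
    define \<epsilon> where "\<epsilon> = min d e / 2"
    have \<epsilon>: "0 < \<epsilon>" "\<epsilon> < d" "\<epsilon> < e" using d(1) e by (auto simp: \<epsilon>_def min_def)
    have "cscale (2 * pi * \<i>) T = cscale (2 * pi * \<i>) (C 0)"
      by (rule has_integral_unique[OF d(2)[OF \<epsilon>(1,2), unfolded has_op_contour_integral_def]
            int[OF \<epsilon>(1,3), unfolded has_op_contour_integral_def]])
    then show "T = C 0" by (simp add: cscale_cancel)
  qed
qed

section \<open>Meromorphic extension of a linear pencil\<close>

text \<open>This is \<open>(1 + (w - s0) A)^-1 A\<close>, described by the equation it solves; where
  the pencil is singular the value carries no meaning.\<close>

definition pencil_resolvent ::
    "('k::complex_hilbert_space \<Rightarrow>\<^sub>L 'k) \<Rightarrow> complex \<Rightarrow> complex \<Rightarrow> 'k \<Rightarrow>\<^sub>L 'k" where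
  "pencil_resolvent A s0 w = (THE B. \<forall>x. blinfun_apply B x + (w - s0) *\<^sub>C A (blinfun_apply B x) = A x)"

lemma pencil_resolvent_eq:
  fixes A B :: "'k::complex_hilbert_space \<Rightarrow>\<^sub>L 'k"
  assumes sol: "\<And>x. B x + (w - s0) *\<^sub>C A (blinfun_apply B x) = A x"
    and inj: "\<And>y. y + (w - s0) *\<^sub>C A y = 0 \<Longrightarrow> y = 0"
  shows "pencil_resolvent A s0 w = B"
  unfolding pencil_resolvent_def
proof (rule the_equality)
  fix B' :: "'k \<Rightarrow>\<^sub>L 'k" assume B': "\<forall>x. B' x + (w - s0) *\<^sub>C A (blinfun_apply B' x) = A x"
  show "B' = B"
  proof (rule blinfun_eqI)
    fix x
    have "(B' x + (w - s0) *\<^sub>C A (B' x)) - (B x + (w - s0) *\<^sub>C A (B x)) = 0"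
      using sol B' by simp
    then have "(B' x - B x) + (w - s0) *\<^sub>C A (B' x - B x) = 0"
      by (simp add: blinfun.diff_right complex_vector.scale_right_diff_distrib algebra_simps)
    then have "B' x - B x = 0" by (rule inj)
    then show "B' x = B x" by simp
  qed
qed (use sol in blast)

context pencil_splitting
begin

text \<open>The coefficient of the power \<open>-(k + 1)\<close> of \<open>w - r\<close>; index 0
  gives the residue \<open>E\<close> and index 1 gives \<open>nilp\<close>.\<close>

definition laurent_coeff :: "nat \<Rightarrow> 'k \<Rightarrow>\<^sub>L 'k" where
  "laurent_coeff k = Blinfun (blinfun_apply nilp ^^ k) o\<^sub>L E"

lemma laurent_coeff_apply: "laurent_coeff k x = (blinfun_apply nilp ^^ k) (E x)"
  by (simp add: laurent_coeff_def bounded_linear_Blinfun_apply[OF funpow_bounded_linear])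

lemma pencil_resolvent_expansion:
  assumes c: "c = r - s0"
  shows "\<exists>e>0. \<exists>R. op_holomorphic_on R (ball r e) \<and> (\<forall>w\<in>ball r e - {r}.
    pencil_resolvent A s0 w = (\<Sum>k<m. cscale (inverse ((w - r) ^ Suc k)) (laurent_coeff k)) + R w)"
proof -
  define M where "M = A o\<^sub>L Z"
  have M: "clinear_blinfun M"
    unfolding M_def by (intro clinear_blinfun_intros A_clinear clinear_Z)
  \<comment> \<open>Chosen so that \<open>(w - r) M\<close> has norm at most 1/2 and its Neumann
    inverse norm at most 2; adding 1 keeps the denominator positive when
    \<open>M = 0\<close>.\<close>
  define e where "e = 1 / (2 * (norm M + 1))"
  have e: "e > 0" by (simp add: e_def add_nonneg_pos)
  have "\<exists>I. (id_blinfun + cscale (w - r) M) o\<^sub>L I = id_blinfun \<and> I o\<^sub>L (id_blinfun + cscale (w - r) M) = id_blinfun \<and> norm I \<le> 2"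
    if w: "w \<in> ball r e" for w
  proof -
    have "norm (cscale (w - r) M) \<le> cmod (w - r) * norm M" by (rule norm_cscale_le)
    also have "\<dots> \<le> e * (norm M + 1)"
      using w e by (intro mult_mono) (auto simp: dist_norm norm_minus_commute)
    also have "\<dots> = 1/2"
    proof -
      have "norm M + 1 > 0" by (simp add: add_nonneg_pos)
      then show ?thesis by (simp add: e_def)
    qed
    finally have n: "norm (cscale (w - r) M) \<le> 1/2" .
    then obtain I where I: "(id_blinfun + cscale (w - r) M) o\<^sub>L I = id_blinfun" "I o\<^sub>L (id_blinfun + cscale (w - r) M) = id_blinfun"
      "norm I \<le> 1 / (1 - norm (cscale (w - r) M))"
      using neumann_inverse[of "cscale (w - r) M"] by auto
    moreover have "1 / (1 - norm (cscale (w - r) M)) \<le> 2" using n by (simp add: field_simps)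
    ultimately show ?thesis by (intro exI[of _ I]) simp
  qed
  then obtain I where I': "\<forall>w\<in>ball r e. (id_blinfun + cscale (w - r) M) o\<^sub>L I w = id_blinfun \<and>
      I w o\<^sub>L (id_blinfun + cscale (w - r) M) = id_blinfun \<and> norm (I w) \<le> 2"
    using bchoice[of "ball r e" "\<lambda>w I. (id_blinfun + cscale (w - r) M) o\<^sub>L I = id_blinfun \<and>
      I o\<^sub>L (id_blinfun + cscale (w - r) M) = id_blinfun \<and> norm I \<le> 2"] by blast
  have I: "(id_blinfun + cscale (w - r) M) o\<^sub>L I w = id_blinfun"
    "I w o\<^sub>L (id_blinfun + cscale (w - r) M) = id_blinfun" "norm (I w) \<le> 2" if "w \<in> ball r e" for w
    using I' that by blast+
  define R where "R w = Z o\<^sub>L I w o\<^sub>L ((id_blinfun - E) o\<^sub>L A)" for w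
  have "op_holomorphic_on R (ball r e)"
    unfolding R_def by (intro op_holomorphic_on_compose clinear_Z op_holomorphic_on_inverse[OF M I])
  moreover have "pencil_resolvent A s0 w = (\<Sum>k<m. cscale (inverse ((w - r) ^ Suc k)) (laurent_coeff k)) + R w"
    if w: "w \<in> ball r e - {r}" for w
  proof (rule pencil_resolvent_eq)
    have h: "w - r \<noteq> 0" and wb: "w \<in> ball r e" using w by auto
    have X': "y + (w - s0) *\<^sub>C A y = X y + (w - r) *\<^sub>C A y" for y
    proof -
      have "w - s0 = c + (w - r)" by (simp add: c)
      then show ?thesis by (simp only: X_apply scaleC_add_left add.assoc)
    qed
    show "y = 0" if "y + (w - s0) *\<^sub>C A y = 0" for y
      by (rule perturbed_injective[OF h I(2)[OF wb, unfolded M_def]]) (use that in \<open>simp only: X'\<close>)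
    have eq: "(\<Sum>k<m. cscale (inverse ((w - r) ^ Suc k)) (laurent_coeff k)) + R w =
        (\<Sum>k<m. cscale (inverse ((w - r) ^ Suc k)) (Blinfun (blinfun_apply nilp ^^ k) o\<^sub>L E))
        + (Z o\<^sub>L I w o\<^sub>L (id_blinfun - E) o\<^sub>L A)"
      unfolding laurent_coeff_def R_def by (rule arg_cong2[of _ _ _ _ "(+)", OF refl]) (rule blinfun_eqI, simp)
    show "blinfun_apply ((\<Sum>k<m. cscale (inverse ((w - r) ^ Suc k)) (laurent_coeff k)) + R w) x +
       (w - s0) *\<^sub>C A (blinfun_apply ((\<Sum>k<m. cscale (inverse ((w - r) ^ Suc k)) (laurent_coeff k)) + R w) x) = A x" for x
      unfolding X' eq by (rule perturbed_solution[OF h I(1)[OF wb, unfolded M_def]])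
  qed
  ultimately show ?thesis by (intro exI[of _ e] conjI e exI[of _ R] ballI)
qed

lemma op_residues_eq:
  assumes c: "c = r - s0" and d: "d > 0"
    and f: "\<And>w. w \<in> ball r d - {r} \<Longrightarrow> f w = pencil_resolvent A s0 w"
  shows "op_residue f r = E" "op_residue (\<lambda>w. cscale (w - r) (f w)) r = nilp"
proof -
  obtain e R where e: "e > 0" and R: "op_holomorphic_on R (ball r e)"
    and exp: "\<And>w. w \<in> ball r e - {r} \<Longrightarrow>
      pencil_resolvent A s0 w = (\<Sum>k<m. cscale (inverse ((w - r) ^ Suc k)) (laurent_coeff k)) + R w"
    using pencil_resolvent_expansion[OF c] by blast
  define a where "a = min d e"
  have a: "a > 0" "ball r a \<subseteq> ball r d" "ball r a \<subseteq> ball r e" using d e by (auto simp: a_def)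
  have f': "f w = (\<Sum>k<m. cscale (inverse ((w - r) ^ Suc k)) (laurent_coeff k)) + R w"
    if w: "w \<in> ball r a - {r}" for w
  proof -
    have "w \<in> ball r d - {r}" "w \<in> ball r e - {r}" using w a(2,3) by blast+
    then show ?thesis using f exp by simp
  qed
  have Ra: "op_holomorphic_on R (ball r a)" by (rule op_holomorphic_on_subset[OF R a(3)])
  have l0: "laurent_coeff 0 = E" by (rule blinfun_eqI) (simp add: laurent_coeff_apply)
  have l1: "laurent_coeff (Suc 0) = nilp" by (rule blinfun_eqI) (simp add: laurent_coeff_apply)
  \<comment> \<open>Multiplication by \<open>w - r\<close> shifts the coefficients by one. This zero
    coefficient fills the vacated last place, so the sum keeps its length, also when
    \<open>m = 1\<close>.\<close>
  have lm: "laurent_coeff m = 0" by (rule blinfun_eqI) (simp add: laurent_coeff_apply nilp_nilpotent)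
  show "op_residue f r = E"
    using op_residue_eq[OF a(1) m_pos Ra f'] by (simp add: l0)
  have "op_residue (\<lambda>w. cscale (w - r) (f w)) r = laurent_coeff (Suc 0)"
  proof (rule op_residue_eq[OF a(1) m_pos, of "\<lambda>w. laurent_coeff 0 + cscale (w - r) (R w)" r _ "\<lambda>k. laurent_coeff (Suc k)"])
    show "op_holomorphic_on (\<lambda>w. laurent_coeff 0 + cscale (w - r) (R w)) (ball r a)"
      by (intro op_holomorphic_on_add op_holomorphic_on_const op_holomorphic_on_cscale Ra holomorphic_intros)
    fix w assume w: "w \<in> ball r a - {r}"
    let ?h = "w - r"
    have h: "?h \<noteq> 0" using w by auto
    have "cscale ?h (f w) = (\<Sum>k<m. cscale (inverse (?h ^ k)) (laurent_coeff k)) + cscale ?h (R w)"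
      unfolding f'[OF w] using h
      by (simp add: bounded_bilinear.add_right[OF bounded_bilinear_cscale] cscale_sum_right cscale_cscale mult.assoc[symmetric])
    also have "(\<Sum>k<m. cscale (inverse (?h ^ k)) (laurent_coeff k)) = (\<Sum>k<Suc m. cscale (inverse (?h ^ k)) (laurent_coeff k))"
      by (simp add: lm bounded_bilinear.zero_right[OF bounded_bilinear_cscale])
    also have "\<dots> = cscale (inverse (?h ^ 0)) (laurent_coeff 0) + (\<Sum>k<m. cscale (inverse (?h ^ Suc k)) (laurent_coeff (Suc k)))"
      by (rule sum.lessThan_Suc_shift)
    also have "cscale (inverse (?h ^ 0)) (laurent_coeff 0) = laurent_coeff 0"
      by (rule blinfun_eqI) simp
    finally show "cscale ?h (f w) = (\<Sum>k<m. cscale (inverse (?h ^ Suc k)) (laurent_coeff (Suc k)))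
        + (laurent_coeff 0 + cscale ?h (R w))"
      by (simp add: ac_simps)
  qed
  then show "op_residue (\<lambda>w. cscale (w - r) (f w)) r = nilp" by (simp add: l1)
qed

end

lemma op_meromorphic_pencil_resolvent:
  assumes "compact_blinfun A" "clinear_blinfun A"
  shows "op_meromorphic (pencil_resolvent A s0)"
  unfolding op_meromorphic_def
proof
  fix z
  obtain E Z m where "pencil_splitting (id_blinfun + cscale (z - s0) A) E Z m A (z - s0)"
    using pencil_splitting_exists[OF assms] by blast
  then interpret pencil_splitting "id_blinfun + cscale (z - s0) A" E Z m A "z - s0" .
  obtain e R where e: "e > 0" and R: "op_holomorphic_on R (ball z e)"
    and exp: "\<And>w. w \<in> ball z e - {z} \<Longrightarrow>
      pencil_resolvent A s0 w = (\<Sum>k<m. cscale (inverse ((w - z) ^ Suc k)) (laurent_coeff k)) + R w"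
    using pencil_resolvent_expansion[OF refl] by blast
  \<comment> \<open>\<open>m\<close> bounds the order of the pole, so the expansion times
    \<open>(w - z) ^ m\<close> has no negative powers.\<close>
  define g where "g w = (\<Sum>k<m. cscale ((w - z) ^ (m - Suc k)) (laurent_coeff k)) + cscale ((w - z) ^ m) (R w)" for w
  have "op_holomorphic_on g (ball z e)"
    unfolding g_def
    by (intro op_holomorphic_on_add op_holomorphic_on_sum op_holomorphic_on_cscale op_holomorphic_on_const R holomorphic_intros)
  moreover have "pencil_resolvent A s0 w = cscale (inverse ((w - z) ^ m)) (g w)" if w: "w \<in> ball z e - {z}" for w
  proof -
    have h: "w - z \<noteq> 0" using w by auto
    have "cscale (inverse ((w - z) ^ m)) (g w) =
      (\<Sum>k<m. cscale (inverse ((w - z) ^ m) * (w - z) ^ (m - Suc k)) (laurent_coeff k)) + cscale (inverse ((w - z) ^ m) * (w - z) ^ m) (R w)"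
      by (simp add: g_def bounded_bilinear.add_right[OF bounded_bilinear_cscale] cscale_sum_right cscale_cscale)
    also have "(\<Sum>k<m. cscale (inverse ((w - z) ^ m) * (w - z) ^ (m - Suc k)) (laurent_coeff k)) =
        (\<Sum>k<m. cscale (inverse ((w - z) ^ Suc k)) (laurent_coeff k))"
    proof (rule sum.cong[OF refl])
      fix k assume "k \<in> {..<m}"
      then have "m = (m - Suc k) + Suc k" by simp
      then have "(w - z) ^ m = (w - z) ^ (m - Suc k) * (w - z) ^ Suc k" by (metis power_add)
      then have "inverse ((w - z) ^ m) * (w - z) ^ (m - Suc k) = inverse ((w - z) ^ Suc k)"
        using h by (simp add: field_simps)
      then show "cscale (inverse ((w - z) ^ m) * (w - z) ^ (m - Suc k)) (laurent_coeff k) =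
        cscale (inverse ((w - z) ^ Suc k)) (laurent_coeff k)" by simp
    qed
    also have "inverse ((w - z) ^ m) * (w - z) ^ m = 1" using h by simp
    also have "cscale 1 (R w) = R w" by (rule blinfun_eqI) simp
    finally show ?thesis using exp[OF w] by simp
  qed
  ultimately show "\<exists>n g. \<exists>e>0. op_holomorphic_on g (ball z e) \<and>
        (\<forall>w\<in>ball z e - {z}. pencil_resolvent A s0 w = cscale (inverse ((w - z) ^ n)) (g w))"
    using e by blast
qed

text \<open>The extension is chosen by \<open>SOME\<close>, but it agrees with
  \<open>pencil_resolvent\<close> on a real interval around \<open>s0\<close>, hence on a punctured
  disc around \<open>r\<close>, and residues see nothing else.\<close>

lemma meromorphic_extension_residues:
  fixes A :: "'k::complex_hilbert_space \<Rightarrow>\<^sub>L 'k" and r s0 \<delta> :: real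
  assumes A: "compact_blinfun A" "clinear_blinfun A"
    and S: "\<delta> > 0" "\<And>s. \<bar>s - s0\<bar> < \<delta> \<Longrightarrow> s \<in> S"
    and f: "\<And>s x. s \<in> S \<Longrightarrow> blinfun_apply (f s) x + (s - s0) *\<^sub>R A (blinfun_apply (f s) x) = A x"
    and inj: "\<And>s y. s \<in> S \<Longrightarrow> y + (s - s0) *\<^sub>R A y = 0 \<Longrightarrow> y = 0"
    and splitting: "pencil_splitting X E Z m A (of_real (r - s0))"
  shows "op_residue (meromorphic_extension S f) (of_real r) = E"
    and "op_residue (\<lambda>s. cscale (s - of_real r) (meromorphic_extension S f s)) (of_real r) =
      pencil_splitting.nilp X E m (of_real (r - s0))"
proof -
  let ?P = "pencil_resolvent A (of_real s0)"
  let ?G = "meromorphic_extension S f"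
  have P: "?P (of_real s) = f s" if s: "s \<in> S" for s
  proof (rule pencil_resolvent_eq)
    have sc: "(complex_of_real s - complex_of_real s0) *\<^sub>C y = (s - s0) *\<^sub>R y" for y :: 'k
      by (simp only: of_real_diff[symmetric] scaleC_of_real)
    show "f s x + (complex_of_real s - complex_of_real s0) *\<^sub>C A (f s x) = A x" for x
      using f[OF s] by (simp add: sc)
    show "y = 0" if "y + (complex_of_real s - complex_of_real s0) *\<^sub>C A y = 0" for y
      by (rule inj[OF s]) (use that in \<open>simp only: sc\<close>)
  qed
  have mer: "op_meromorphic ?P" by (rule op_meromorphic_pencil_resolvent[OF A])
  have G: "op_meromorphic ?G \<and> (\<forall>s\<in>S. ?G (of_real s) = f s)"
  proof -
    have ex: "\<exists>g. op_meromorphic g \<and> (\<forall>s\<in>S. g (complex_of_real s) = f s)"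
      by (rule exI[of _ ?P]) (simp add: mer P)
    show ?thesis unfolding meromorphic_extension_def by (rule someI_ex[OF ex])
  qed
  have "complex_of_real s0 islimpt (of_real ` S)"
    unfolding islimpt_approachable
  proof (intro allI impI)
    fix e :: real assume e: "e > 0"
    define s where "s = s0 + min \<delta> e / 2"
    have s: "\<bar>s - s0\<bar> < \<delta>" "s \<noteq> s0" "\<bar>s - s0\<bar> < e" using S(1) e by (auto simp: s_def min_def)
    have "s \<in> S" by (rule S(2)[OF s(1)])
    with s show "\<exists>x'\<in>complex_of_real ` S. x' \<noteq> complex_of_real s0 \<and> dist x' (complex_of_real s0) < e"
      by (intro bexI[of _ "of_real s"]) (auto simp: dist_norm simp flip: of_real_diff)
  qed
  moreover have "?G w = ?P w" if "w \<in> of_real ` S" for w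
    using that G P by auto
  ultimately obtain d where d: "d > 0" "\<forall>w\<in>ball (of_real r) d - {of_real r}. ?G w = ?P w"
    using op_meromorphic_identity[OF conjunct1[OF G] mer] by blast
  have d': "?G w = ?P w" if "w \<in> ball (of_real r) d - {of_real r}" for w
    using d(2) that by blast
  interpret pencil_splitting X E Z m A "of_real (r - s0)" by fact
  show "op_residue ?G (of_real r) = E"
    "op_residue (\<lambda>s. cscale (s - of_real r) (?G s)) (of_real r) = nilp"
    by (rule op_residues_eq[OF of_real_diff d(1) d'], assumption)+
qed

section \<open>The sandwiched resolvent\<close>

lemma eq_on_dense:
  fixes f g :: "'a::topological_space \<Rightarrow> 'b::t2_space"
  assumes "closure S = UNIV" "continuous_on UNIV f" "continuous_on UNIV g" "\<And>x. x \<in> S \<Longrightarrow> f x = g x"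
  shows "f x = g x"
proof -
  have "closed {x. f x = g x}" using assms(2,3) by (rule closed_Collect_eq)
  then have "closure S \<subseteq> {x. f x = g x}" using assms(4) by (intro closure_minimal) auto
  then show ?thesis using assms(1) by auto
qed

lemma compact_op_blinfunD:
  assumes "compact_op (op_graph T)"
  shows "compact_blinfun T" "clinear_blinfun T"
proof -
  have "op_graph T `` cball 0 1 = blinfun_apply T ` cball 0 1" by (auto simp: op_graph_def)
  then show "compact_blinfun T" using assms by (simp add: compact_op_def compact_blinfun_def)
  have lin: "linear_operator (op_graph T)" using assms by (simp add: compact_op_def)
  have "(a *\<^sub>C x, a *\<^sub>C T x) \<in> op_graph T" for a x
    by (rule linear_operatorD(4)[OF lin]) (auto simp: op_graph_def)
  then show "clinear_blinfun T" by (auto simp: op_graph_def clinear_blinfun_def)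
qed

lemma adjoint_opD: "(y, w) \<in> adjoint_op G \<Longrightarrow> (x, u) \<in> G \<Longrightarrow> cinner u y = cinner x w"
  by (auto simp: adjoint_op_def)

lemma adjoint_op_add:
  assumes "(y, w) \<in> adjoint_op G" "(y', w') \<in> adjoint_op G"
  shows "(y + y', w + w') \<in> adjoint_op G"
  using assms by (fastforce simp: adjoint_op_def cinner_add_right)

lemma adjoint_op_scaleR:
  assumes "(y, w) \<in> adjoint_op G"
  shows "(a *\<^sub>R y, a *\<^sub>R w) \<in> adjoint_op G"
  using assms by (fastforce simp: adjoint_op_def cinner_scaleR_right)

context resonance_line
begin

abbreviation "H s \<equiv> line_op F J H\<^sub>0 s"
abbreviation "T z s \<equiv> sandwiched_resolvent F (H s) z"

lemma dense_domain_adjoint: "closure (Domain (adjoint_op F)) = UNIV"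
  by (rule densely_defined_adjoint[OF linear_F closed_F])

lemma clinear_J: "clinear_blinfun J"
proof -
  have lin: "linear_operator (op_graph J)" using self_adjoint_J by (simp add: self_adjoint_def)
  have "(a *\<^sub>C x, a *\<^sub>C J x) \<in> op_graph J" for a x
    by (rule linear_operatorD(4)[OF lin]) (auto simp: op_graph_def)
  then show ?thesis by (auto simp: op_graph_def clinear_blinfun_def)
qed

lemma J_symmetric: "cinner (J x) y = cinner x (J y)"
proof -
  have "(y, J y) \<in> adjoint_op (op_graph J)"
    using self_adjoint_J by (auto simp: self_adjoint_def op_graph_def)
  then show ?thesis by (rule adjoint_opD) (auto simp: op_graph_def)
qed

lemma H_symmetric:
  assumes "(x, y) \<in> H s" "(x', y') \<in> H s"
  shows "cinner y x' = cinner x y'"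
proof -
  have "(x', y') \<in> adjoint_op (H s)" using self_adjoint_line[of s] assms(2) by (simp add: self_adjoint_def)
  then show ?thesis using assms(1) by (rule adjoint_opD)
qed

text \<open>Surjectivity of \<open>H s - z\<close> is read off from relative compactness, which
  makes the composite of the resolvent with \<open>V\<close> defined everywhere.\<close>

lemma resolvent_total:
  assumes "Im z \<noteq> 0"
  shows "\<exists>x. (x, v + z *\<^sub>C x) \<in> H s"
proof -
  have "Domain (resolvent (H s) z O perturbation F J) = UNIV"
    using relatively_compact_V[of s] assms by (simp add: relatively_compact_def compact_op_def)
  then obtain x where "(v, x) \<in> resolvent (H s) z" by blast
  then show ?thesis by (auto simp: resolvent_def intro!: exI[of _ x])
qed

text \<open>Every \<open>u\<close> in the domain of \<open>F\<^sup>*\<close> determines \<open>x = (H\<^sub>s - z)\<^sup>-\<^sup>1 F\<^sup>* u\<close>.\<close>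

lemma sandwich_witness:
  assumes z: "Im z \<noteq> 0" and u: "u \<in> Domain (adjoint_op F)"
  obtains v x f w where "(u, v) \<in> adjoint_op F" "(x, v + z *\<^sub>C x) \<in> H s" "(x, f) \<in> F"
    "(J f, w) \<in> adjoint_op F" "(x, w) \<in> perturbation F J"
proof -
  obtain v where v: "(u, v) \<in> adjoint_op F" using u by blast
  obtain x where x: "(x, v + z *\<^sub>C x) \<in> H s" using resolvent_total[OF z] by blast
  have "x \<in> D" using x common_domain by blast
  then obtain w where w: "(x, w) \<in> perturbation F J" using D_subset by blast
  then obtain f where "(x, f) \<in> F" "(J f, w) \<in> adjoint_op F"
    by (auto simp: perturbation_def op_graph_def)
  then show ?thesis using that v x w by blast
qed

text \<open>This discharges the \<open>THE\<close>: two bounded extensions agree on the dense domain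
  of the adjoint of \<open>F\<close>, hence everywhere.\<close>

lemma sandwiched_resolvent_spec:
  assumes z: "Im z \<noteq> 0"
  shows "compact_op (op_graph (T z s)) \<and> adjoint_op F O resolvent (H s) z O F \<subseteq> op_graph (T z s)"
proof -
  obtain S where S: "compact_op (op_graph S)" "adjoint_op F O resolvent (H s) z O F \<subseteq> op_graph S"
    using compact_sandwiched_resolvent[OF z] by blast
  have "S' = S" if S': "adjoint_op F O resolvent (H s) z O F \<subseteq> op_graph S'" for S'
  proof (rule blinfun_eqI)
    show "S' u = S u" for u
    proof (rule eq_on_dense[OF dense_domain_adjoint, where f = "blinfun_apply S'" and g = "blinfun_apply S"])
      fix u assume "u \<in> Domain (adjoint_op F)"
      then obtain v x f where "(u, v) \<in> adjoint_op F" "(x, v + z *\<^sub>C x) \<in> H s" "(x, f) \<in> F"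
        using sandwich_witness[OF z] by metis
      moreover from this have "(v, x) \<in> resolvent (H s) z" by (force simp: resolvent_def)
      ultimately have "(u, f) \<in> adjoint_op F O resolvent (H s) z O F" by blast
      then have "(u, f) \<in> op_graph S" "(u, f) \<in> op_graph S'" using S(2) S' by blast+
      then show "S' u = S u" by (simp add: op_graph_def)
    qed (intro linear_continuous_on blinfun.bounded_linear_right)+
  qed
  then have "T z s = S" unfolding sandwiched_resolvent_def using S(2) by (intro the_equality)
  then show ?thesis using S by simp
qed

lemma sandwiched_resolvent_eq:
  assumes z: "Im z \<noteq> 0" and "(u, v) \<in> adjoint_op F" "(x, v + z *\<^sub>C x) \<in> H s" "(x, f) \<in> F"
  shows "T z s u = f"
proof -
  have "(v, x) \<in> resolvent (H s) z" using assms(3) by (force simp: resolvent_def)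
  then have "(u, f) \<in> adjoint_op F O resolvent (H s) z O F" using assms by blast
  then have "(u, f) \<in> op_graph (T z s)" using sandwiched_resolvent_spec[OF z] by blast
  then show ?thesis by (simp add: op_graph_def)
qed

lemma compact_T: "Im z \<noteq> 0 \<Longrightarrow> compact_blinfun (T z s)"
  and clinear_T: "Im z \<noteq> 0 \<Longrightarrow> clinear_blinfun (T z s)"
  using sandwiched_resolvent_spec compact_op_blinfunD by blast+

lemma line_op_shift:
  assumes "(x, y) \<in> H s" "(x, w) \<in> perturbation F J"
  shows "(x, y + (r - s) *\<^sub>R w) \<in> H r"
proof -
  obtain y0 w' where y0: "(x, y0) \<in> H\<^sub>0" "(x, w') \<in> perturbation F J" "y = y0 + s *\<^sub>R w'"
    using assms(1) by (auto simp: line_op_def)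
  have "linear_operator (perturbation F J)" using self_adjoint_V by (simp add: self_adjoint_def)
  then have "w' = w" by (rule linear_operatorD(1)) (use y0 assms in auto)
  then have "y + (r - s) *\<^sub>R w = y0 + r *\<^sub>R w" using y0 by (simp add: algebra_simps)
  then show ?thesis using y0 assms(2) unfolding line_op_def by blast
qed

text \<open>The vector \<open>x\<close> solving \<open>(H s - z) x = F* u\<close> also solves
  \<open>(H r - z) x = F* (u + (r - s) J F x)\<close>. Comparing \<open>F x\<close> gives the
  identity on a dense set.\<close>

lemma resolvent_identity:
  assumes z: "Im z \<noteq> 0"
  shows "T z s u = T z r (u + (r - s) *\<^sub>R J (T z s u))"
proof (rule eq_on_dense[OF dense_domain_adjoint, where f = "blinfun_apply (T z s)"
      and g = "\<lambda>u. T z r (u + (r - s) *\<^sub>R J (T z s u))"])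
  fix u assume "u \<in> Domain (adjoint_op F)"
  then obtain v x f w where w: "(u, v) \<in> adjoint_op F" "(x, v + z *\<^sub>C x) \<in> H s" "(x, f) \<in> F"
    "(J f, w) \<in> adjoint_op F" "(x, w) \<in> perturbation F J"
    using sandwich_witness[OF z] by metis
  have Tu: "T z s u = f" by (rule sandwiched_resolvent_eq[OF z w(1-3)])
  have "T z r (u + (r - s) *\<^sub>R J f) = f"
  proof (rule sandwiched_resolvent_eq[OF z _ _ w(3)])
    show "(u + (r - s) *\<^sub>R J f, v + (r - s) *\<^sub>R w) \<in> adjoint_op F"
      by (intro adjoint_op_add adjoint_op_scaleR w)
    show "(x, v + (r - s) *\<^sub>R w + z *\<^sub>C x) \<in> H r"
      using line_op_shift[OF w(2,5), of r] by (simp add: algebra_simps)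
  qed
  then show "T z s u = T z r (u + (r - s) *\<^sub>R J (T z s u))" by (simp add: Tu)
qed (intro continuous_intros linear_continuous_on blinfun.bounded_linear_right)+

text \<open>For \<open>u\<close> and \<open>u'\<close> in the domain of \<open>F*\<close> this is
  symmetry of \<open>H s\<close>; continuity then extends it in one argument at a time.\<close>

lemma sandwiched_resolvent_adjoint:
  assumes z: "Im z \<noteq> 0"
  shows "cinner (T z s u) u' = cinner u (T (cnj z) s u')"
proof -
  have z': "Im (cnj z) \<noteq> 0" using z by simp
  have base: "cinner (T z s u) u' = cinner u (T (cnj z) s u')"
    if u: "u \<in> Domain (adjoint_op F)" "u' \<in> Domain (adjoint_op F)" for u u'
  proof -
    obtain v x f where w: "(u, v) \<in> adjoint_op F" "(x, v + z *\<^sub>C x) \<in> H s" "(x, f) \<in> F"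
      using sandwich_witness[OF z u(1)] by metis
    obtain v' x' f' where w': "(u', v') \<in> adjoint_op F" "(x', v' + cnj z *\<^sub>C x') \<in> H s" "(x', f') \<in> F"
      using sandwich_witness[OF z' u(2)] by metis
    have "cinner f u' = cinner x v'" by (rule adjoint_opD[OF w'(1) w(3)])
    moreover have "cinner f' u = cinner x' v" by (rule adjoint_opD[OF w(1) w'(3)])
    then have "cinner u f' = cinner v x'" by (metis cinner_commute)
    moreover have "cinner (v + z *\<^sub>C x) x' = cinner x (v' + cnj z *\<^sub>C x')" by (rule H_symmetric[OF w(2) w'(2)])
    ultimately show ?thesis
      by (simp add: sandwiched_resolvent_eq[OF z w] sandwiched_resolvent_eq[OF z' w'] cinner_add_left
          cinner_add_right cinner_scaleC_left cinner_scaleC_right)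
  qed
  have base': "cinner (T z s u) u' = cinner u (T (cnj z) s u')" if u': "u' \<in> Domain (adjoint_op F)" for u u'
    by (rule eq_on_dense[OF dense_domain_adjoint])
      (intro continuous_on_cinner continuous_intros linear_continuous_on blinfun.bounded_linear_right base u' | assumption)+
  show ?thesis
    by (rule eq_on_dense[OF dense_domain_adjoint, where x = u'])
      (intro continuous_on_cinner continuous_intros linear_continuous_on blinfun.bounded_linear_right base' | assumption)+
qed

text \<open>With \<open>x = (H s - z)^-1 F* u\<close>, the imaginary part of
  \<open>cinner u (T z s u)\<close> is \<open>Im z\<close> times the squared norm of
  \<open>x\<close>. The extra factor \<open>Im z\<close> treats both half-planes at once.\<close>

lemma sandwiched_resolvent_dissipative:
  assumes z: "Im z \<noteq> 0"
  shows "0 \<le> Im z * Im (cinner u (T z s u))"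
proof -
  let ?P = "{u. 0 \<le> Im z * Im (cinner u (T z s u))}"
  have "closed ?P"
    by (intro closed_Collect_le continuous_on_cinner continuous_intros linear_continuous_on blinfun.bounded_linear_right)
  moreover have "Domain (adjoint_op F) \<subseteq> ?P"
  proof
    fix u assume u: "u \<in> Domain (adjoint_op F)"
    obtain v x f where w: "(u, v) \<in> adjoint_op F" "(x, v + z *\<^sub>C x) \<in> H s" "(x, f) \<in> F"
      using sandwich_witness[OF z u] by metis
    have "cinner (v + z *\<^sub>C x) x = cinner x (v + z *\<^sub>C x)" by (rule H_symmetric[OF w(2) w(2)])
    then have eq: "cinner v x + cnj z * cinner x x = cinner x v + z * cinner x x"
      by (simp add: cinner_add_left cinner_add_right cinner_scaleC_left cinner_scaleC_right)
    have "cinner f u = cinner x v" by (rule adjoint_opD[OF w(1) w(3)])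
    then have uf: "cinner u f = cinner v x" by (metis cinner_commute)
    have "Im (cinner x v) = - Im (cinner v x)" by (metis cinner_commute cnj.sel(2))
    moreover have "Im (cnj z * cinner x x) = - (Im z * (norm x)\<^sup>2)" "Im (z * cinner x x) = Im z * (norm x)\<^sup>2"
      by (simp_all add: cinner_self)
    moreover have "Im (cinner v x) + Im (cnj z * cinner x x) = Im (cinner x v) + Im (z * cinner x x)"
      using arg_cong[OF eq, of Im] by simp
    ultimately have "Im (cinner v x) = Im z * (norm x)\<^sup>2" by simp
    then show "u \<in> ?P" by (simp add: sandwiched_resolvent_eq[OF z w] uf mult.assoc[symmetric])
  qed
  ultimately have "closure (Domain (adjoint_op F)) \<subseteq> ?P" by (intro closure_minimal)
  then show ?thesis using dense_domain_adjoint by auto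
qed

section \<open>Boundary values\<close>

context
  fixes lam :: real
begin

abbreviation "NR \<equiv> nonresonant_points F J H\<^sub>0 lam"
abbreviation "Tb \<sigma> s \<equiv> boundary_resolvent F (H s) lam \<sigma>"

lemma boundary_tendsto:
  assumes s: "s \<in> NR" and \<sigma>: "\<sigma> \<in> {1, -1}"
  shows "((\<lambda>y. T (Complex lam (\<sigma> * y)) s) \<longlongrightarrow> Tb \<sigma> s) (at_right 0)"
proof -
  obtain S where "((\<lambda>y. T (Complex lam (\<sigma> * y)) s) \<longlongrightarrow> S) (at_right 0)"
    using s \<sigma> unfolding nonresonant_points_def regular_points_def by blast
  then show ?thesis
    unfolding boundary_resolvent_def by (metis tendsto_Lim trivial_limit_at_right_real)
qed

lemma eventually_nonreal:
  assumes \<sigma>: "\<sigma> \<in> {1, -1}"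
  shows "\<forall>\<^sub>F y in at_right 0. Im (Complex lam (\<sigma> * y)) \<noteq> 0"
  using eventually_at_right_less[of "0::real"] by eventually_elim (use \<sigma> in auto)

lemma boundary_tendsto_apply:
  assumes "s \<in> NR" "\<sigma> \<in> {1, -1}"
  shows "((\<lambda>y. T (Complex lam (\<sigma> * y)) s u) \<longlongrightarrow> Tb \<sigma> s u) (at_right 0)"
  by (rule bounded_linear.tendsto[OF blinfun.bounded_linear_left boundary_tendsto[OF assms]])

lemma compact_boundary:
  assumes s: "s \<in> NR" and \<sigma>: "\<sigma> \<in> {1, -1}"
  shows "compact_blinfun (Tb \<sigma> s)"
  by (rule compact_blinfun_limit[OF boundary_tendsto[OF assms]])
    (use eventually_nonreal[OF \<sigma>] in \<open>auto elim!: eventually_mono intro: compact_T\<close>)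

lemma clinear_boundary:
  assumes s: "s \<in> NR" and \<sigma>: "\<sigma> \<in> {1, -1}"
  shows "clinear_blinfun (Tb \<sigma> s)"
  unfolding clinear_blinfun_def
proof (intro allI)
  fix a x
  have "\<forall>\<^sub>F y in at_right 0. T (Complex lam (\<sigma> * y)) s (a *\<^sub>C x) = a *\<^sub>C T (Complex lam (\<sigma> * y)) s x"
    using eventually_nonreal[OF \<sigma>] by eventually_elim (rule clinear_blinfunD[OF clinear_T])
  moreover have "((\<lambda>y. a *\<^sub>C T (Complex lam (\<sigma> * y)) s x) \<longlongrightarrow> a *\<^sub>C Tb \<sigma> s x) (at_right 0)"
    by (rule bounded_linear.tendsto[OF bounded_linear_scaleC boundary_tendsto_apply[OF assms]])
  ultimately have "((\<lambda>y. T (Complex lam (\<sigma> * y)) s (a *\<^sub>C x)) \<longlongrightarrow> a *\<^sub>C Tb \<sigma> s x) (at_right 0)"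
    by (simp add: tendsto_cong)
  then show "Tb \<sigma> s (a *\<^sub>C x) = a *\<^sub>C Tb \<sigma> s x"
    using boundary_tendsto_apply[OF assms] tendsto_unique trivial_limit_at_right_real by blast
qed

lemma boundary_resolvent_identity:
  assumes s: "s \<in> NR" and r: "r \<in> NR" and \<sigma>: "\<sigma> \<in> {1, -1}"
  shows "Tb \<sigma> s u = Tb \<sigma> r (u + (r - s) *\<^sub>R J (Tb \<sigma> s u))"
proof -
  let ?z = "\<lambda>y. Complex lam (\<sigma> * y)"
  have "((\<lambda>y. T (?z y) r (u + (r - s) *\<^sub>R J (T (?z y) s u))) \<longlongrightarrow> Tb \<sigma> r (u + (r - s) *\<^sub>R J (Tb \<sigma> s u))) (at_right 0)"
    by (intro bounded_bilinear.tendsto[OF bounded_bilinear_blinfun_apply] boundary_tendsto r \<sigma>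
        tendsto_add tendsto_const tendsto_scaleR bounded_linear.tendsto[OF blinfun.bounded_linear_right]
        boundary_tendsto_apply s)
  moreover have "\<forall>\<^sub>F y in at_right 0. T (?z y) s u = T (?z y) r (u + (r - s) *\<^sub>R J (T (?z y) s u))"
    using eventually_nonreal[OF \<sigma>] by eventually_elim (rule resolvent_identity)
  ultimately have "((\<lambda>y. T (?z y) s u) \<longlongrightarrow> Tb \<sigma> r (u + (r - s) *\<^sub>R J (Tb \<sigma> s u))) (at_right 0)"
    by (simp only: tendsto_cong)
  then show ?thesis
    using boundary_tendsto_apply[OF s \<sigma>] tendsto_unique trivial_limit_at_right_real by blast
qed

lemma boundary_adjoint:
  assumes s: "s \<in> NR" and \<sigma>: "\<sigma> \<in> {1, -1}"
  shows "cinner (Tb \<sigma> s u) v = cinner u (Tb (- \<sigma>) s v)"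
proof -
  have \<sigma>': "- \<sigma> \<in> {1, -1}" using \<sigma> by auto
  have "((\<lambda>y. cinner (T (Complex lam (\<sigma> * y)) s u) v) \<longlongrightarrow> cinner (Tb \<sigma> s u) v) (at_right 0)"
    by (intro tendsto_cinner boundary_tendsto_apply s \<sigma> tendsto_const)
  moreover have "\<forall>\<^sub>F y in at_right 0. cinner (T (Complex lam (\<sigma> * y)) s u) v = cinner u (T (Complex lam (- \<sigma> * y)) s v)"
    using eventually_nonreal[OF \<sigma>]
  proof eventually_elim
    case (elim y)
    have "cnj (Complex lam (\<sigma> * y)) = Complex lam (- \<sigma> * y)" by (simp add: complex_eq_iff)
    then show ?case using sandwiched_resolvent_adjoint[OF elim, of s u v] by simp
  qed
  ultimately have "((\<lambda>y. cinner u (T (Complex lam (- \<sigma> * y)) s v)) \<longlongrightarrow> cinner (Tb \<sigma> s u) v) (at_right 0)"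
    by (rule Lim_transform_eventually)
  moreover have "((\<lambda>y. cinner u (T (Complex lam (- \<sigma> * y)) s v)) \<longlongrightarrow> cinner u (Tb (- \<sigma>) s v)) (at_right 0)"
    by (intro tendsto_cinner boundary_tendsto_apply s \<sigma>' tendsto_const)
  ultimately show ?thesis
    using tendsto_unique trivial_limit_at_right_real by blast
qed

lemma boundary_dissipative:
  assumes s: "s \<in> NR" and \<sigma>: "\<sigma> \<in> {1, -1}"
  shows "0 \<le> \<sigma> * Im (cinner u (Tb \<sigma> s u))"
proof (rule tendsto_lowerbound)
  show "((\<lambda>y. \<sigma> * Im (cinner u (T (Complex lam (\<sigma> * y)) s u))) \<longlongrightarrow> \<sigma> * Im (cinner u (Tb \<sigma> s u))) (at_right 0)"
    by (intro tendsto_mult tendsto_const tendsto_Im tendsto_cinner boundary_tendsto_apply s \<sigma>)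
  show "\<forall>\<^sub>F y in at_right 0. 0 \<le> \<sigma> * Im (cinner u (T (Complex lam (\<sigma> * y)) s u))"
    using eventually_nonreal[OF \<sigma>] eventually_at_right_less[of "0::real"]
  proof eventually_elim
    case (elim y)
    have "0 \<le> y * (\<sigma> * Im (cinner u (T (Complex lam (\<sigma> * y)) s u)))"
      using sandwiched_resolvent_dissipative[OF elim(1), of u s] by (simp add: mult_ac)
    then show ?case using elim(2) by (simp add: zero_le_mult_iff)
  qed
qed simp

text \<open>The resolvent identity gives \<open>T z r = T z s (1 + (r - s) J T z s)^-1\<close>, and
  for small \<open>r - s\<close> the inverse converges together with \<open>T z s\<close>. The
  resulting interval feeds the identity theorem for the meromorphic extension.\<close>

lemma nonresonant_nearby:
  assumes s: "s \<in> NR"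
  shows "\<exists>\<delta>>0. \<forall>r. \<bar>r - s\<bar> < \<delta> \<longrightarrow> r \<in> NR"
proof -
  define N where "N = norm (J o\<^sub>L Tb 1 s) + norm (J o\<^sub>L Tb (- 1) s)"
  \<comment> \<open>Makes the limit operator \<open>M0\<close> below have norm less than 1/2; the
    sum \<open>N\<close> covers both signs.\<close>
  define \<delta> where "\<delta> = 1 / (2 * (N + 1))"
  have N: "0 \<le> N" by (simp add: N_def)
  have "\<exists>S. ((\<lambda>y. T (Complex lam (\<sigma> * y)) r) \<longlongrightarrow> S) (at_right 0)"
    if r: "\<bar>r - s\<bar> < \<delta>" and \<sigma>: "\<sigma> \<in> {1, -1}" for r \<sigma>
  proof -
    let ?z = "\<lambda>y. Complex lam (\<sigma> * y)"
    define M where "M y = (r - s) *\<^sub>R (J o\<^sub>L T (?z y) s)" for y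
    define M0 where "M0 = (r - s) *\<^sub>R (J o\<^sub>L Tb \<sigma> s)"
    have lim: "(M \<longlongrightarrow> M0) (at_right 0)"
      unfolding M_def M0_def
      by (intro tendsto_scaleR tendsto_const bounded_bilinear.tendsto[OF bounded_bilinear_blinfun_compose] boundary_tendsto s \<sigma>)
    have "norm (J o\<^sub>L Tb \<sigma> s) \<le> N" using \<sigma> by (auto simp: N_def)
    then have "norm M0 \<le> \<bar>r - s\<bar> * (N + 1)" by (simp add: M0_def mult_left_mono)
    also have "\<dots> < \<delta> * (N + 1)" using r N by (intro mult_strict_right_mono) auto
    also have "\<dots> = 1/2" using N by (simp add: \<delta>_def field_simps)
    finally have small: "norm M0 < 1/2" .
    then obtain I0 where I0: "(id_blinfun + M0) o\<^sub>L I0 = id_blinfun"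
      using neumann_inverse[of M0] by auto
    \<comment> \<open>The inverse exists only for \<open>y\<close> near 0, where
      \<open>norm (M y)\<close> is small; elsewhere the chosen value is arbitrary.\<close>
    define I where "I y = (SOME I. (id_blinfun + M y) o\<^sub>L I = id_blinfun \<and> I o\<^sub>L (id_blinfun + M y) = id_blinfun)" for y
    have "\<forall>\<^sub>F y in at_right 0. norm (M y) < 1/2"
      by (rule order_tendstoD(2)[OF tendsto_norm[OF lim] small])
    then have I: "\<forall>\<^sub>F y in at_right 0. (id_blinfun + M y) o\<^sub>L I y = id_blinfun \<and> I y o\<^sub>L (id_blinfun + M y) = id_blinfun"
    proof eventually_elim
      case (elim y)
      then have "\<exists>I. (id_blinfun + M y) o\<^sub>L I = id_blinfun \<and> I o\<^sub>L (id_blinfun + M y) = id_blinfun"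
        using neumann_inverse[of "M y"] by auto
      then show ?case unfolding I_def by (rule someI_ex)
    qed
    have "(I \<longlongrightarrow> I0) (at_right 0)"
      by (rule tendsto_neumann_inverse[OF lim small I0]) (use I in \<open>auto elim: eventually_mono\<close>)
    then have "((\<lambda>y. T (?z y) s o\<^sub>L I y) \<longlongrightarrow> Tb \<sigma> s o\<^sub>L I0) (at_right 0)"
      by (intro bounded_bilinear.tendsto[OF bounded_bilinear_blinfun_compose] boundary_tendsto s \<sigma>)
    moreover have "\<forall>\<^sub>F y in at_right 0. T (?z y) s o\<^sub>L I y = T (?z y) r"
      using I eventually_nonreal[OF \<sigma>]
    proof eventually_elim
      case (elim y)
      show ?case
      proof (rule blinfun_eqI)
        fix x
        have "T (?z y) s (I y x) = T (?z y) r ((id_blinfun + M y) (I y x))"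
          using resolvent_identity[OF elim(2), of s "I y x" r]
          by (simp add: M_def blinfun.add_left blinfun.scaleR_left)
        also have "(id_blinfun + M y) (I y x) = x"
          using elim(1) by (metis blinfun_apply_blinfun_compose blinfun_apply_id_blinfun id_apply)
        finally show "(T (?z y) s o\<^sub>L I y) x = T (?z y) r x" by simp
      qed
    qed
    ultimately show ?thesis by (blast intro: Lim_transform_eventually)
  qed
  then have "\<forall>r. \<bar>r - s\<bar> < \<delta> \<longrightarrow> r \<in> NR"
    unfolding nonresonant_points_def regular_points_def by blast
  moreover have "\<delta> > 0" using N by (simp add: \<delta>_def)
  ultimately show ?thesis by blast
qed

end

end

section \<open>The indefinite form on the spaces of resonance vectors\<close>

text \<open>\<open>A (nilp v) = - X v\<close> contains \<open>- v\<close>, so \<open>A\<close> is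
  inverted on the range of \<open>E\<close> by this explicit formula.\<close>

lemma (in pencil_splitting) A_surjective_on_E:
  assumes "E v = v"
  shows "v = A (- (nilp v + c *\<^sub>C v))"
  using assms by (simp add: blinfun.minus_right blinfun.add_right blinfun.diff_right A_nilp X_apply clinear_blinfunD[OF A_clinear])

text \<open>For a sign \<open>s\<close>, \<open>T s\<close> stands for the boundary value of the sandwiched resolvent at a base point
  \<open>s0\<close> of the line, and \<open>c = r - s0\<close>.\<close>

locale boundary_pair =
  fixes J :: "'k::complex_hilbert_space \<Rightarrow>\<^sub>L 'k" and T :: "real \<Rightarrow> 'k \<Rightarrow>\<^sub>L 'k" and c :: real
    and E Z :: "real \<Rightarrow> 'k \<Rightarrow>\<^sub>L 'k" and m :: "real \<Rightarrow> nat"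
  assumes J_clinear: "clinear_blinfun J" and J_sym: "\<And>x y. cinner (J x) y = cinner x (J y)"
    and T_adjoint: "\<And>s u v. s \<in> {1, -1} \<Longrightarrow> cinner (T s u) v = cinner u (T (- s) v)"
    and T_dissipative: "\<And>s u. s \<in> {1, -1} \<Longrightarrow> 0 \<le> s * Im (cinner u (T s u))"
    and split: "\<And>s. s \<in> {1, -1} \<Longrightarrow>
      pencil_splitting (id_blinfun + cscale (of_real c) (T s o\<^sub>L J)) (E s) (Z s) (m s) (T s o\<^sub>L J) (of_real c)"
begin

definition A where "A s = T s o\<^sub>L J"
definition X where "X s = id_blinfun + cscale (of_real c) (A s)"
definition N where "N s = pencil_splitting.nilp (X s) (E s) (m s) (of_real c)"
definition b where "b u v = cinner u (J v)"
definition ups where "ups s = {u. E s u = u}"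

lemma splitting: "s \<in> {1, -1} \<Longrightarrow> pencil_splitting (X s) (E s) (Z s) (m s) (A s) (of_real c)"
  using split by (simp add: X_def A_def)

lemma uminus_sign: "s \<in> {1, -1} \<Longrightarrow> - s \<in> {1, -1 :: real}" by auto

lemma b_add_right: "b u (v + w) = b u v + b u w"
  and b_diff_right: "b u (v - w) = b u v - b u w"
  and b_minus_right: "b u (- v) = - b u v"
  and b_scaleC_right: "b u (a *\<^sub>C v) = a * b u v"
  and b_zero_right: "b u 0 = 0"
  and b_add_left: "b (v + w) u = b v u + b w u"
  and b_diff_left: "b (v - w) u = b v u - b w u"
  and b_scaleC_left: "b (a *\<^sub>C v) u = cnj a * b v u"
  and b_scaleR_left: "b (t *\<^sub>R v) u = of_real t * b v u"
  and b_zero_left: "b 0 u = 0"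
  by (simp_all add: b_def blinfun.add_right blinfun.diff_right blinfun.minus_right blinfun.scaleR_right
      clinear_blinfunD[OF J_clinear] cinner_add_right cinner_diff_right cinner_minus_right cinner_scaleC_right
      cinner_scaleR_right cinner_add_left cinner_diff_left cinner_scaleC_left cinner_scaleR_left)

lemma b_commute: "b u v = cnj (b v u)"
  by (metis b_def cinner_commute J_sym)

lemma Im_b_self: "Im (b u u) = 0"
  using b_commute[of u u] by (metis add.inverse_unique cnj.sel(2) neg_equal_zero)

lemma b_A: "s \<in> {1, -1} \<Longrightarrow> b (A s u) v = b u (A (- s) v)"
  by (simp add: b_def A_def T_adjoint J_sym)

lemma b_X: "s \<in> {1, -1} \<Longrightarrow> b (X s u) v = b u (X (- s) v)"
  by (simp add: X_def blinfun.add_left b_add_left b_add_right b_A b_scaleC_left b_scaleC_right)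

lemma b_funpow:
  assumes "\<And>u v. b (f u) v = b u (g v)"
  shows "b ((f ^^ n) u) v = b u ((g ^^ n) v)"
  by (induction n arbitrary: u v) (simp_all add: assms funpow_swap1)

text \<open>A vector annihilated by \<open>E (- s)\<close> is a power of \<open>X (- s)\<close>
  applied to something; moved to the other side, the power kills \<open>E s u\<close>. So both sides
  equal \<open>b (E s u) (E (- s) v)\<close>.\<close>

lemma b_E: 
  assumes s: "s \<in> {1, -1}"
  shows "b (E s u) v = b u (E (- s) v)"
proof -
  have half: "b (E s u) v = b (E s u) (E (- s) v)" if s: "s \<in> {1, -1}" for s u v
  proof -
    interpret p: pencil_splitting "X s" "E s" "Z s" "m s" "A s" "of_real c" by (rule splitting[OF s])
    interpret q: pencil_splitting "X (- s)" "E (- s)" "Z (- s)" "m (- s)" "A (- s)" "of_real c"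
      by (rule splitting[OF uminus_sign[OF s]])
    let ?y = "v - E (- s) v"
    have "E (- s) ?y = 0" by (simp add: blinfun.diff_right)
    then have "?y = (blinfun_apply (X (- s)) ^^ m s) ((blinfun_apply (Z (- s)) ^^ m s) ?y)"
      by (rule q.X_funpow_Z_funpow[symmetric])
    then have "b (E s u) ?y = b ((blinfun_apply (X s) ^^ m s) (E s u)) ((blinfun_apply (Z (- s)) ^^ m s) ?y)"
      by (metis b_funpow[OF b_X[OF s]])
    also have "\<dots> = 0" by (simp only: p.X_funpow_E b_zero_left)
    finally show ?thesis by (simp add: b_diff_right)
  qed
  have "b u (E (- s) v) = cnj (b (E (- s) v) u)" by (rule b_commute)
  also have "\<dots> = cnj (b (E (- s) v) (E s u))"
    using half[OF uminus_sign[OF s], of v u] by simp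
  also have "\<dots> = b (E s u) (E (- s) v)" by (rule b_commute[symmetric])
  finally show ?thesis using half[OF s, of u v] by simp
qed

lemma E_E: "s \<in> {1, -1} \<Longrightarrow> E s (E s u) = E s u"
  and E_N: "s \<in> {1, -1} \<Longrightarrow> E s (N s u) = N s u"
  and N_E: "s \<in> {1, -1} \<Longrightarrow> N s (E s u) = N s u"
  and A_E: "s \<in> {1, -1} \<Longrightarrow> A s (E s u) = E s (A s u)"
  and A_N: "s \<in> {1, -1} \<Longrightarrow> A s (N s u) = - X s (E s u)"
  and A_N_commute: "s \<in> {1, -1} \<Longrightarrow> A s (N s u) = N s (A s u)"
  and clinear_E: "s \<in> {1, -1} \<Longrightarrow> clinear_blinfun (E s)"
  and clinear_N: "s \<in> {1, -1} \<Longrightarrow> clinear_blinfun (N s)"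
proof -
  assume s: "s \<in> {1, -1}"
  interpret p: pencil_splitting "X s" "E s" "Z s" "m s" "A s" "of_real c" by (rule splitting[OF s])
  show "E s (E s u) = E s u" "E s (N s u) = N s u" "N s (E s u) = N s u"
    "A s (E s u) = E s (A s u)" "A s (N s u) = - X s (E s u)"
    "A s (N s u) = N s (A s u)" "clinear_blinfun (E s)" "clinear_blinfun (N s)"
    unfolding N_def by (simp_all add: p.A_E p.A_nilp p.clinear_E p.clinear_nilp flip: p.A_nilp_commute)
qed

lemma X_apply: "X s u = u + c *\<^sub>R A s u"
  by (simp add: X_def blinfun.add_left scaleC_of_real)

lemma A_injective: "s \<in> {1, -1} \<Longrightarrow> u \<in> ups s \<Longrightarrow> A s u = 0 \<Longrightarrow> u = 0"
  using pencil_splitting.A_injective_on_E[OF splitting] by (simp add: ups_def)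

lemma X_kernel_subset: "s \<in> {1, -1} \<Longrightarrow> X s u = 0 \<Longrightarrow> u \<in> ups s"
  using riesz_splitting.X_eq_0_E[OF pencil_splitting.axioms(1)[OF splitting]] by (simp add: ups_def)

lemma kernel_X_funpow:
  assumes s: "s \<in> {1, -1}"
  shows "(blinfun_apply (X s) ^^ n) u = 0 \<longleftrightarrow> u \<in> ups s \<and> (blinfun_apply (N s) ^^ n) u = 0"
proof -
  interpret p: pencil_splitting "X s" "E s" "Z s" "m s" "A s" "of_real c" by (rule splitting[OF s])
  show ?thesis
    unfolding ups_def N_def mem_Collect_eq
    using p.E_fixes_generalized_kernel p.nilp_funpow_eq_0_iff by metis
qed

lemma J_injective: "s \<in> {1, -1} \<Longrightarrow> u \<in> ups s \<Longrightarrow> J u = 0 \<Longrightarrow> u = 0"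
  by (rule A_injective) (simp_all add: A_def)

text \<open>On \<open>ups s\<close> the operator \<open>N s\<close> is \<open>- A^-1 X\<close>.
  Writing \<open>E (- s) v\<close> as \<open>A (- s) v''\<close> removes the inverse and leaves the
  adjointness of \<open>A\<close> and of \<open>X\<close>.\<close>

lemma b_N:
  assumes s: "s \<in> {1, -1}"
  shows "b (N s u) v = b u (N (- s) v)"
proof -
  let ?\<tau> = "- s"
  note \<tau> = uminus_sign[OF s]
  interpret q: pencil_splitting "X ?\<tau>" "E ?\<tau>" "Z ?\<tau>" "m ?\<tau>" "A ?\<tau>" "of_real c" by (rule splitting[OF \<tau>])
  define v'' where "v'' = - (q.nilp (E ?\<tau> v) + of_real c *\<^sub>C E ?\<tau> v)"
  have v: "E ?\<tau> v = A ?\<tau> v''"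
    unfolding v''_def by (rule q.A_surjective_on_E) simp
  have v''E: "E ?\<tau> v'' = v''"
    by (simp add: v''_def blinfun.minus_right blinfun.add_right blinfun.diff_right clinear_blinfunD[OF q.clinear_E])
  have "b (N s u) v = b (E s (N s u)) v" by (simp add: E_N[OF s])
  also have "\<dots> = b (N s u) (A ?\<tau> v'')" by (simp only: b_E[OF s] v)
  also have "\<dots> = b (A s (N s u)) v''" by (simp only: b_A[OF s])
  also have "\<dots> = - b (X s (E s u)) v''" by (simp add: A_N[OF s] b_def cinner_minus_left)
  also have "\<dots> = - b u (E ?\<tau> (X ?\<tau> v''))" by (simp only: b_X[OF s] b_E[OF s])
  also have "\<dots> = b u (A ?\<tau> (N ?\<tau> v''))" by (simp add: A_N[OF \<tau>] b_minus_right q.X_E)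
  also have "\<dots> = b u (N ?\<tau> (E ?\<tau> v))" by (simp only: A_N_commute[OF \<tau>] v)
  finally show ?thesis by (simp add: N_E[OF \<tau>])
qed

text \<open>By \<open>b_E\<close> it suffices to test on \<open>ups (- s)\<close>, and
  \<open>J\<close> is injective on \<open>ups s\<close> because \<open>A s\<close> is
  \<open>T s\<close> after \<open>J\<close>.\<close>

lemma b_nondegenerate:
  assumes s: "s \<in> {1, -1}" and u: "u \<in> ups s" and 0: "\<And>v. v \<in> ups (- s) \<Longrightarrow> b u v = 0"
  shows "u = 0"
proof (rule J_injective[OF s u])
  have "b u v = 0" for v
  proof -
    have "b u v = b (E s u) v" using u by (simp add: ups_def)
    also have "\<dots> = b u (E (- s) v)" by (rule b_E[OF s])
    also have "\<dots> = 0" by (rule 0) (simp add: ups_def E_E[OF uminus_sign[OF s]])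
    finally show ?thesis .
  qed
  then have "cinner (J u) v = 0" for v by (simp add: b_def J_sym)
  then show "J u = 0" using cinner_eq_0_iff_all by blast
qed

text \<open>This is the Cauchy-Schwarz inequality for the semidefinite form \<open>s Im T\<^sub>s\<close>.\<close>

lemma T_eq_of_Im_zero:
  assumes s: "s \<in> {1, -1}" and v: "Im (cinner v (T s v)) = 0"
  shows "T s v = T (- s) v"
proof -
  have L: "Im (cinner w (T s v)) = Im (cinner w (T (- s) v))" for w
  proof -
    define L where "L = s * Im (cinner v (T s w) + cinner w (T s v))"
    define q where "q = s * Im (cinner w (T s w))"
    have q0: "0 \<le> q" unfolding q_def by (rule T_dissipative[OF s])
    have ineq: "0 \<le> t * L + t * t * q" for t
    proof -
      have "cinner (v + t *\<^sub>R w) (T s (v + t *\<^sub>R w)) =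
        cinner v (T s v) + of_real t * (cinner v (T s w) + cinner w (T s v)) + of_real (t * t) * cinner w (T s w)"
        by (simp add: blinfun.add_right blinfun.scaleR_right cinner_add_left cinner_add_right
            cinner_scaleR_left cinner_scaleR_right algebra_simps)
      then have "s * Im (cinner (v + t *\<^sub>R w) (T s (v + t *\<^sub>R w))) = t * L + t * t * q"
        by (simp add: v L_def q_def algebra_simps)
      then show ?thesis using T_dissipative[OF s, of "v + t *\<^sub>R w"] by simp
    qed
    have "L = 0"
    proof (rule ccontr)
      assume L: "L \<noteq> 0"
      \<comment> \<open>A small step against the sign of \<open>L\<close>: the linear term outweighs
        the quadratic one, and \<open>q + 1\<close> avoids dividing by zero.\<close>
      define t where "t = - L / (q + 1)"
      have "t * L + t * t * q = - (L * L) / ((q + 1) * (q + 1))"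
        using q0 unfolding t_def by (simp add: field_simps add_nonneg_eq_0_iff)
      also have "\<dots> < 0"
        using L q0 by (intro divide_neg_pos mult_pos_pos) (auto simp: zero_less_mult_iff linorder_neq_iff)
      finally show False using ineq[of t] by simp
    qed
    then have "Im (cinner v (T s w)) + Im (cinner w (T s v)) = 0" using s by (auto simp: L_def)
    moreover have "cinner v (T s w) = cnj (cinner w (T (- s) v))"
      using T_adjoint[OF s, of w v] by (metis cinner_commute)
    ultimately show ?thesis by simp
  qed
  show ?thesis
  proof (rule cinner_ext_right)
    fix w
    have "Re (cinner w (T s v)) = Re (cinner w (T (- s) v))"
      \<comment> \<open>Imaginary parts for \<open>\<i> *\<^sub>C w\<close> are real parts for
        \<open>w\<close>, up to sign.\<close>
      using L[of "\<i> *\<^sub>C w"] by (simp add: cinner_scaleC_left)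
    then show "cinner w (T s v) = cinner w (T (- s) v)" using L[of w] by (simp add: complex_eq_iff)
  qed
qed

lemma A_eq_of_Im_zero:
  assumes s: "s \<in> {1, -1}" and v: "Im (b v (A s v)) = 0"
  shows "A s v = A (- s) v"
proof -
  have "Im (cinner (J v) (T s (J v))) = 0" using v by (simp add: b_def A_def J_sym)
  then show ?thesis using T_eq_of_Im_zero[OF s] by (simp add: A_def)
qed

text \<open>Semidefiniteness turns one vanishing imaginary part into equality of \<open>A s\<close>
  and \<open>A (- s)\<close> at a vector, which carries membership in \<open>ups (- s)\<close> from
  \<open>N s w\<close> up to \<open>w\<close>.\<close>

lemma two_sided_step:
  assumes s: "s \<in> {1, -1}" and w: "w \<in> ups s" "N s w \<in> ups (- s)" and im: "Im (b w (N s w)) = 0"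
  shows "w \<in> ups (- s)" "N (- s) w = N s w"
proof -
  note \<tau> = uminus_sign[OF s]
  \<comment> \<open>On \<open>ups s\<close> this is \<open>- A^-1 w\<close>, so that
    \<open>Im (b v (A s v))\<close> equals \<open>Im (b w (N s w))\<close>, which vanishes.\<close>
  define v where "v = N s w + c *\<^sub>R w"
  have Av: "A s v = - w"
    using w(1) by (simp add: v_def blinfun.add_right blinfun.scaleR_right A_N[OF s] X_apply ups_def)
  have "Im (b v (A s v)) = - Im (b v w)" by (simp add: Av b_minus_right)
  also have "\<dots> = - Im (b (N s w) w)" by (simp add: v_def b_add_left b_scaleR_left Im_b_self)
  also have "\<dots> = 0" using im b_commute[of "N s w" w] by simp
  finally have A'v: "A (- s) v = - w" using A_eq_of_Im_zero[OF s] Av by metis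
  have "A (- s) (N s w) + c *\<^sub>R A (- s) w = - w"
    using A'v by (simp only: v_def blinfun.add_right blinfun.scaleR_right)
  then have "w + c *\<^sub>R A (- s) w + A (- s) (N s w) = 0" by (metis add.assoc add.commute add.right_inverse)
  then have w_eq: "w + c *\<^sub>R A (- s) w = - A (- s) (N s w)" by (simp only: eq_neg_iff_add_eq_0)
  have Ew: "E (- s) (w + c *\<^sub>R A (- s) w) = - A (- s) (N s w)"
    unfolding w_eq using w(2) A_E[OF \<tau>, of "N s w"] by (simp add: blinfun.minus_right ups_def)
  \<comment> \<open>\<open>X (- s) w = - A (- s) (N s w)\<close> lies in \<open>ups (- s)\<close>,
    so the component of \<open>w\<close> outside \<open>ups (- s)\<close> is in the kernel of
    \<open>X (- s)\<close>, which is part of \<open>ups (- s)\<close>.\<close>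
  have "X (- s) (w - E (- s) w) = (w + c *\<^sub>R A (- s) w) - E (- s) (w + c *\<^sub>R A (- s) w)"
    by (simp add: X_apply blinfun.diff_right blinfun.add_right blinfun.scaleR_right scaleR_diff_right A_E[OF \<tau>])
  then have "X (- s) (w - E (- s) w) = 0" by (simp only: Ew) (simp add: w_eq)
  then have "w - E (- s) w \<in> ups (- s)" by (rule X_kernel_subset[OF \<tau>])
  then show w': "w \<in> ups (- s)" by (simp add: ups_def blinfun.diff_right E_E[OF \<tau>])
  have "A (- s) (N (- s) w) = A (- s) (N s w)"
    using w' w_eq by (simp add: A_N[OF \<tau>] ups_def X_apply)
  then have "N (- s) w - N s w = 0"
    by (intro A_injective[OF \<tau>, of "N (- s) w - N s w"])
      (use w(2) in \<open>simp_all add: blinfun.diff_right ups_def E_N[OF \<tau>]\<close>)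
  then show "N (- s) w = N s w" by simp
qed

lemma N_funpow_ups: "s \<in> {1, -1} \<Longrightarrow> u \<in> ups s \<Longrightarrow> (blinfun_apply (N s) ^^ n) u \<in> ups s"
  by (cases n) (simp_all add: ups_def E_N)

text \<open>The lower half of a Jordan chain \<open>y\<^sub>0 = 0, y\<^sub>1, \<dots>, y\<^sub>n\<close> consists of vectors on which both
  signs agree, because \<open>b y\<^sub>i y\<^sub>l = b y\<^sub>0 y\<^bsub>i+l\<^esub> = 0\<close> for \<open>i + l \<le> n\<close> with \<open>i\<close> in the lower half.\<close>

lemma half_chain:
  assumes s: "s \<in> {1, -1}" and y0: "y 0 = 0" and y: "\<And>i. i \<le> n \<Longrightarrow> y i \<in> ups s"
    and chain: "\<And>i. i < n \<Longrightarrow> N s (y (Suc i)) = y i"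
    and i: "2 * i \<le> n + 1" "i \<le> n"
  shows "y i \<in> ups (- s) \<and> N (- s) (y i) = N s (y i)"
  using i
proof (induction i rule: less_induct)
  case (less i)
  show ?case
  proof (cases i)
    case 0
    then show ?thesis by (simp add: y0 ups_def)
  next
    case (Suc k)
    \<comment> \<open>Only the left vector must be two-sided: \<open>N s\<close> moves to the left
      as \<open>N (- s)\<close>, and \<open>less.IH\<close> lets that act on
      \<open>y (Suc a)\<close> like \<open>N s\<close>.\<close>
    have shift: "a \<le> k \<Longrightarrow> a + l \<le> n \<Longrightarrow> b (y a) (y l) = 0" for a l
    proof (induction a arbitrary: l)
      case 0
      then show ?case by (simp add: y0 b_zero_left)
    next
      case (Suc a)
      have "b (y (Suc a)) (y l) = b (y (Suc a)) (N s (y (Suc l)))"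
        using chain[of l] Suc.prems by simp
      also have "\<dots> = b (N (- s) (y (Suc a))) (y (Suc l))"
        using b_N[OF uminus_sign[OF s]] by simp
      also have "N (- s) (y (Suc a)) = y a"
        using less.IH[of "Suc a"] chain[of a] Suc.prems less.prems \<open>i = Suc k\<close> by simp
      finally show ?case using Suc.IH[of "Suc l"] Suc.prems by simp
    qed
    have "N s (y i) = y k" using chain[of k] less.prems Suc by simp
    moreover have "y k \<in> ups (- s)" using less.IH[of k] less.prems Suc by simp
    \<comment> \<open>Here \<open>k + i = 2 * i - 1\<close>, at most \<open>n\<close>: the origin of
      the bound on \<open>i\<close>.\<close>
    moreover have "b (y k) (y i) = 0" using shift[of k i] less.prems Suc by simp
    then have "b (y i) (y k) = 0" using b_commute[of "y i" "y k"] by simp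
    ultimately show ?thesis
      using two_sided_step[OF s y[OF less.prems(2)]] by simp
  qed
qed

text \<open>Going down \<open>p\<close> steps from the top of a chain of length \<open>p + q\<close>
  reaches index \<open>q\<close>, and \<open>2 * q \<le> p + q + 1\<close> is
  \<open>q \<le> p + 1\<close>.\<close>

lemma half_chain_power:
  assumes s: "s \<in> {1, -1}" and x: "x \<in> ups s" and n: "(blinfun_apply (N s) ^^ (p + q)) x = 0" and pq: "q \<le> p + 1"
  shows "(blinfun_apply (N s) ^^ p) x \<in> ups (- s)"
    and "N (- s) ((blinfun_apply (N s) ^^ p) x) = N s ((blinfun_apply (N s) ^^ p) x)"
proof -
  define y where "y i = (blinfun_apply (N s) ^^ (p + q - i)) x" for i
  have "y q \<in> ups (- s) \<and> N (- s) (y q) = N s (y q)"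
  proof (rule half_chain[OF s, where n = "p + q"])
    show "y 0 = 0" using n by (simp add: y_def)
    show "y i \<in> ups s" for i by (simp add: y_def N_funpow_ups[OF s x])
    show "N s (y (Suc i)) = y i" if "i < p + q" for i
    proof -
      have "p + q - i = Suc (p + q - Suc i)" using that by simp
      then show ?thesis by (simp add: y_def)
    qed
  qed (use pq in auto)
  then show "(blinfun_apply (N s) ^^ p) x \<in> ups (- s)"
    "N (- s) ((blinfun_apply (N s) ^^ p) x) = N s ((blinfun_apply (N s) ^^ p) x)"
    by (simp_all add: y_def)
qed

text \<open>Finite-dimensional duality for the pairing \<open>b\<close>. Each new vector
  \<open>u\<close> of \<open>B\<close> is handled by a \<open>w0\<close> dual to it: subtracting
  multiples of \<open>u\<close> and of \<open>w0\<close> restores orthogonality without spoiling it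
  on the previous vectors.\<close>

lemma separating_vector:
  assumes s: "s \<in> {1, -1}" and "finite B" "B \<subseteq> ups s" "z \<in> ups s" "z \<notin> cspan B"
  shows "\<exists>w\<in>ups (- s). (\<forall>u\<in>B. b w u = 0) \<and> b w z \<noteq> 0"
  using assms(2-)
proof (induction B arbitrary: z rule: finite_induct)
  case empty
  then have "z \<noteq> 0" by simp
  then obtain w where "w \<in> ups (- s)" "b z w \<noteq> 0"
    using b_nondegenerate[OF s, of z] empty by blast
  then show ?case using b_commute[of z w] by auto
next
  case (insert u B)
  have sub: "b w v = 0" if "\<forall>u\<in>B. b w u = 0" "v \<in> cspan B" for w v
    using that(2)
  proof (induction rule: complex_vector.span_induct_alt)
    case base
    show ?case by (rule b_zero_right)
  next
    case (step c x y)
    then show ?case using that(1) by (simp add: b_add_right b_scaleC_right)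
  qed
  show ?case
  proof (cases "u \<in> cspan B")
    case True
    then have "cspan (insert u B) = cspan B"
      by (rule complex_vector.span_redundant)
    then obtain w where "w \<in> ups (- s)" "\<forall>u\<in>B. b w u = 0" "b w z \<noteq> 0"
      using insert.IH[of z] insert.prems by auto
    then show ?thesis using sub[of w u] True by auto
  next
    case False
    then obtain w0 where w0: "w0 \<in> ups (- s)" "\<forall>u\<in>B. b w0 u = 0" "b w0 u \<noteq> 0"
      using insert.IH[of u] insert.prems by auto
    define t where "t = b w0 z / b w0 u"
    define z' where "z' = z - t *\<^sub>C u"
    have "z' \<notin> cspan B"
    proof
      assume "z' \<in> cspan B"
      then have "z' + t *\<^sub>C u \<in> cspan (insert u B)"
        by (meson complex_vector.span_add complex_vector.span_base complex_vector.span_mono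
            complex_vector.span_scale insertI1 subset_iff subset_insertI)
      then show False using insert.prems by (simp add: z'_def)
    qed
    moreover have "z' \<in> ups s"
      using insert.prems by (simp add: z'_def ups_def blinfun.diff_right clinear_blinfunD[OF clinear_E[OF s]])
    ultimately obtain w1 where w1: "w1 \<in> ups (- s)" "\<forall>u\<in>B. b w1 u = 0" "b w1 z' \<noteq> 0"
      using insert.IH[of z'] insert.prems by auto
    \<comment> \<open>The conjugate appears because \<open>b\<close> is conjugate-linear in its
      first argument.\<close>
    define a where "a = cnj (b w1 u / b w0 u)"
    define w where "w = w1 - a *\<^sub>C w0"
    have "w \<in> ups (- s)"
      using w0(1) w1(1) by (simp add: w_def ups_def blinfun.diff_right clinear_blinfunD[OF clinear_E[OF uminus_sign[OF s]]])
    moreover have wu: "b w u = 0"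
      using w0(3) by (simp add: w_def a_def b_diff_left b_scaleC_left)
    moreover have "\<forall>u\<in>B. b w u = 0"
      using w0(2) w1(2) by (simp add: w_def b_diff_left b_scaleC_left)
    moreover have "b w0 z' = 0"
      using w0(3) by (simp add: z'_def t_def b_diff_right b_scaleC_right)
    then have "b w z' = b w1 z'" by (simp add: w_def b_diff_left b_scaleC_left)
    then have "b w z \<noteq> 0"
      using w1(3) wu by (simp add: z'_def b_diff_right b_scaleC_right)
    ultimately show ?thesis by auto
  qed
qed

text \<open>The commutator defect of \<open>E s\<close> on a block is orthogonal to the two-sided vectors of the
  dual block, hence lies in the lower half of its target block \<open>Y\<close>; \<open>B\<close> spans the other blocks.\<close>

lemma defect_vanishes:
  assumes s: "s \<in> {1, -1}" and e: "e \<in> ups (- s)"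
    and B: "finite B" "B \<subseteq> ups s" "\<And>v. v \<in> ups s \<Longrightarrow> (blinfun_apply (N s) ^^ n) v \<in> cspan B"
    and Y: "\<And>y. y \<in> Y \<Longrightarrow> N s y \<in> Y" "\<And>y. y \<in> Y \<Longrightarrow> y \<in> cspan B \<Longrightarrow> y = 0" "Y \<subseteq> ups s"
    and defect: "N s (E s e) - E s (N (- s) e) \<in> Y" and q: "n \<le> 2 * q + 1"
  shows "(blinfun_apply (N s) ^^ q) (N s (E s e) - E s (N (- s) e)) = 0"
proof (rule ccontr)
  note \<tau> = uminus_sign[OF s]
  define y where "y = N s (E s e) - E s (N (- s) e)"
  define z where "z = (blinfun_apply (N s) ^^ q) y"
  assume "(blinfun_apply (N s) ^^ q) (N s (E s e) - E s (N (- s) e)) \<noteq> 0"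
  then have z: "z \<noteq> 0" by (simp add: z_def y_def)
  have YN: "(blinfun_apply (N s) ^^ k) y \<in> Y" for k
    using defect by (induction k) (simp_all add: y_def Y(1))
  then have zY: "z \<in> Y" by (simp add: z_def)
  then obtain w where w: "w \<in> ups (- s)" "\<forall>u\<in>B. b w u = 0" "b w z \<noteq> 0"
    using separating_vector[OF s B(1,2), of z] z Y(2,3) by blast
  have wspan: "b w v = 0" if "v \<in> cspan B" for v
    using that
  proof (induction rule: complex_vector.span_induct_alt)
    case base
    show ?case by (rule b_zero_right)
  next
    case (step c x y)
    then show ?case using w(2) by (simp add: b_add_right b_scaleC_right)
  qed
  have bN: "b ((blinfun_apply (N (- s)) ^^ k) u) v = b u ((blinfun_apply (N s) ^^ k) v)" for k u v
    using b_funpow[OF b_N[OF \<tau>]] by simp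
  \<comment> \<open>\<open>N s ^ n\<close> maps \<open>ups s\<close> into the other blocks, and
    \<open>w\<close> annihilates those.\<close>
  have Nw: "(blinfun_apply (N (- s)) ^^ n) w = 0"
  proof (rule b_nondegenerate[OF \<tau> N_funpow_ups[OF \<tau> w(1)]])
    fix v assume "v \<in> ups (- (- s))"
    then show "b ((blinfun_apply (N (- s)) ^^ n) w) v = 0"
      using bN wspan B(3) by simp
  qed
  have qn: "q < n"
  proof (rule ccontr)
    assume "\<not> q < n"
    then have "(blinfun_apply (N (- s)) ^^ q) w = (blinfun_apply (N (- s)) ^^ (q - n)) ((blinfun_apply (N (- s)) ^^ n) w)"
      by (metis funpow_add le_add_diff_inverse2 linorder_not_less o_apply)
    also have "\<dots> = 0" unfolding Nw by (rule linear_0[OF bounded_linear.linear[OF funpow_bounded_linear]])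
    finally have "b w z = 0" using bN[of q w y] by (simp add: z_def b_zero_left)
    then show False using w(3) by simp
  qed
  \<comment> \<open>The chain from \<open>w\<close> has length at most \<open>n\<close>, and
    \<open>n - q \<le> q + 1\<close>, so \<open>q\<close> steps down lead into the lower
    half.\<close>
  define v where "v = (blinfun_apply (N (- s)) ^^ q) w"
  have "(blinfun_apply (N (- s)) ^^ (q + (n - q))) w = 0" using Nw qn by simp
  then have v: "v \<in> ups s" "N s v = N (- s) v"
    using half_chain_power[OF \<tau> w(1), of q "n - q"] q qn by (simp_all add: v_def)
  have vE: "E (- s) v = v" using N_funpow_ups[OF \<tau> w(1), of q] by (simp add: v_def ups_def)
  \<comment> \<open>Since \<open>v\<close> is two-sided, both summands of the defect pair with it to
    \<open>b (N (- s) v) e\<close>; but \<open>b v y\<close> is also \<open>b w z\<close>.\<close>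
  have "b v y = b (N (- s) v) (E s e) - b v (E s (N (- s) e))"
    using b_N[OF \<tau>, of v "E s e"] by (simp add: y_def b_diff_right)
  also have "b (N (- s) v) (E s e) = b (N (- s) v) e"
    using b_E[OF \<tau>, of "N (- s) v" e] by (simp add: E_N[OF \<tau>])
  also have "b v (E s (N (- s) e)) = b v (N (- s) e)"
    using b_E[OF \<tau>, of v] by (simp add: vE)
  also have "\<dots> = b (N (- s) v) e"
    using b_N[OF s, of v e] v(2) by simp
  finally have "b v y = 0" by simp
  then show False using w(3) bN[of q w y] by (simp add: v_def z_def)
qed

text \<open>The order of \<open>e k\<close> is at most \<open>k\<close>, and the images must keep
  this bound although they need not form a chain. The defect in each step has order at most
  \<open>k\<close>, so the bound grows by one at a time.\<close>

lemma chain_image: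
  assumes s: "s \<in> {1, -1}" and e: "e 0 = 0" "\<And>k. k \<le> d \<Longrightarrow> e k \<in> ups (- s)"
    "\<And>k. k < d \<Longrightarrow> N (- s) (e (Suc k)) = e k"
    and B: "finite B" "B \<subseteq> ups s" "\<And>v. v \<in> ups s \<Longrightarrow> (blinfun_apply (N s) ^^ n) v \<in> cspan B"
    and Y: "\<And>y. y \<in> Y \<Longrightarrow> N s y \<in> Y" "\<And>y. y \<in> Y \<Longrightarrow> y \<in> cspan B \<Longrightarrow> y = 0" "Y \<subseteq> ups s"
    "\<And>y y'. y \<in> Y \<Longrightarrow> y' \<in> Y \<Longrightarrow> y - y' \<in> Y"
    and eY: "\<And>k. k \<le> d \<Longrightarrow> E s (e k) \<in> Y"
    and nd: "n \<le> d" and k: "k \<le> d"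
  shows "(blinfun_apply (N s) ^^ k) (E s (e k)) = 0"
  using k
proof (induction k)
  case 0
  then show ?case by (simp add: e)
next
  case (Suc k)
  have two_sided: "e i \<in> ups s \<and> N s (e i) = N (- s) (e i)" if "2 * i \<le> d + 1" "i \<le> d" for i
    using half_chain[OF uminus_sign[OF s], of e d, OF e(1,2,3) that] by simp
  show ?case
  proof (cases "2 * Suc k \<le> d + 1")
    case True
    \<comment> \<open>In the lower half both vectors are two-sided, so \<open>E s\<close> leaves the
      chain relation unchanged.\<close>
    then have "E s (e k) = e k" "E s (e (Suc k)) = e (Suc k)" "N s (e (Suc k)) = e k"
      using two_sided[of k] two_sided[of "Suc k"] Suc.prems e(3)[of k] by (auto simp: ups_def)
    then show ?thesis using Suc by (simp add: funpow_swap1)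
  next
    case False
    \<comment> \<open>Now \<open>n \<le> d \<le> 2 * k\<close>, so \<open>defect_vanishes\<close>
      applies with \<open>q = k\<close>; the induction hypothesis disposes of the summand
      \<open>E s (e k)\<close>.\<close>
    let ?y = "N s (E s (e (Suc k))) - E s (N (- s) (e (Suc k)))"
    have Ne: "N (- s) (e (Suc k)) = e k" using e(3)[of k] Suc.prems by simp
    have "?y \<in> Y" unfolding Ne using eY Suc.prems by (intro Y) simp_all
    then have 0: "(blinfun_apply (N s) ^^ k) ?y = 0"
      using False nd Suc.prems e(2) by (intro defect_vanishes[OF s _ B Y(1-3)]) simp_all
    have "(blinfun_apply (N s) ^^ Suc k) (E s (e (Suc k))) = (blinfun_apply (N s) ^^ k) (?y + E s (e k))"
      by (simp add: Ne funpow_swap1)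
    also have "\<dots> = (blinfun_apply (N s) ^^ k) ?y + (blinfun_apply (N s) ^^ k) (E s (e k))"
      by (rule linear_add[OF bounded_linear.linear[OF funpow_bounded_linear]])
    finally show ?thesis using 0 Suc by simp
  qed
qed

end

section \<open>Jordan bases\<close>

abbreviation clinear :: "('a::complex_hilbert_space \<Rightarrow> 'b::complex_hilbert_space) \<Rightarrow> bool" where
  "clinear f \<equiv> module_hom scaleC scaleC f"

lemma clinearI:
  assumes "\<And>x y. f (x + y) = f x + f y" "\<And>a x. f (a *\<^sub>C x) = a *\<^sub>C f x"
  shows "clinear f"
  by (simp add: module_hom_iff complex_vector.module_axioms assms)

lemma clinear_blinfun_imp: "clinear_blinfun S \<Longrightarrow> clinear (blinfun_apply S)"
  by (rule clinearI) (simp_all add: blinfun.add_right clinear_blinfunD)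

lemma clinear_compose: "clinear f \<Longrightarrow> clinear g \<Longrightarrow> clinear (\<lambda>x. f (g x))"
  by (rule clinearI) (simp_all add: module_hom.add module_hom.scale)

lemma clinear_funpow:
  fixes f :: "'a::complex_hilbert_space \<Rightarrow> 'a"
  shows "clinear f \<Longrightarrow> clinear (f ^^ n)"
proof (induction n)
  case 0
  show ?case by (rule clinearI) simp_all
next
  case (Suc n)
  then show ?case using clinear_compose[of f "f ^^ n"] by (simp add: o_def)
qed

lemma clinear_zero: "clinear f \<Longrightarrow> f 0 = 0"
  by (rule module_hom.zero)

lemma clinear_eq_0_on_span:
  assumes "clinear f" "\<And>x. x \<in> B \<Longrightarrow> f x = 0" "x \<in> cspan B"
  shows "f x = 0"
  using module_hom.eq_0_on_span[OF assms(1)] assms(2,3) by blast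

lemma clinear_span_into:
  assumes f: "clinear f" and B: "\<And>x. x \<in> B \<Longrightarrow> f x \<in> cspan C" and x: "x \<in> cspan B"
  shows "f x \<in> cspan C"
  using x
proof (induction rule: complex_vector.span_induct_alt)
  case base
  show ?case by (simp add: clinear_zero[OF f] complex_vector.span_zero)
next
  case (step c x y)
  then show ?case
    using B by (simp add: module_hom.add[OF f] module_hom.scale[OF f] complex_vector.span_add complex_vector.span_scale)
qed

lemma span_disjoint_independent:
  assumes "cindependent C" "S \<subseteq> C" "T \<subseteq> C" "S \<inter> T = {}"
    and x: "x \<in> cspan S" "x \<in> cspan T"
  shows "x = 0"
proof -
  let ?r = "complex_vector.representation C x"
  have eq: "?r = complex_vector.representation S x" "?r = complex_vector.representation T x"
    using complex_vector.representation_extend[OF assms(1)] assms(2,3) x by blast+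
  have "?r v = 0" for v
  proof (rule ccontr)
    assume "?r v \<noteq> 0"
    then have "v \<in> S" "v \<in> T" using eq complex_vector.representation_ne_zero by metis+
    then show False using assms(4) by blast
  qed
  moreover have "x \<in> cspan C" using assms(2) x(1) complex_vector.span_mono by blast
  ultimately show ?thesis
    using complex_vector.sum_nonzero_representation_eq[OF assms(1), of x] by simp
qed

lemma injective_selfmap_onto:
  fixes f :: "'a::complex_hilbert_space \<Rightarrow> 'a"
  assumes f: "clinear f" and W: "csubspace W" "W \<subseteq> cspan B" "finite B"
    and fW: "f ` W \<subseteq> W" and inj: "inj_on f W"
  shows "f ` W = W"
proof
  interpret f: module_hom scaleC scaleC f by fact
  obtain C where C: "C \<subseteq> W" "cindependent C" "W \<subseteq> cspan C"
    by (rule complex_vector.maximal_independent_subset)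
  have WC: "W = cspan C"
    using C W(1) complex_vector.span_minimal by blast
  have finC: "finite C"
    using complex_vector.independent_span_bound[OF W(3) C(2)] C(1) W(2) by blast
  have indep: "cindependent (f ` C)"
    using f.independent_injective_image[OF C(2)] inj by (simp add: WC)
  have card: "card (f ` C) = card C"
    using inj C(1) by (intro card_image) (rule inj_on_subset)
  show "W \<subseteq> f ` W"
  proof
    fix x assume x: "x \<in> W"
    have "x \<in> cspan (f ` C)"
    proof (rule ccontr)
      assume nx: "x \<notin> cspan (f ` C)"
      then have 1: "cindependent (insert x (f ` C))"
        using indep by (rule complex_vector.independent_insertI)
      have "f ` C \<subseteq> W" using fW image_mono[OF C(1), of f] by (rule subset_trans[rotated])
      then have 2: "insert x (f ` C) \<subseteq> cspan C"
        using x WC by simp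
      have "card (insert x (f ` C)) \<le> card C"
        by (rule conjunct2[OF complex_vector.independent_span_bound[OF finC 1 2]])
      moreover have "x \<notin> f ` C" using nx complex_vector.span_base[of x "f ` C"] by (rule contrapos_nn)
      ultimately show False using card finC by simp
    qed
    then show "x \<in> f ` W" by (simp add: f.span_image WC)
  qed
qed (rule fW)

lemma surjective_selfmap_injective:
  fixes f :: "'a::complex_hilbert_space \<Rightarrow> 'a"
  assumes f: "clinear f" and B: "finite B" and onto: "f ` cspan B = cspan B"
  shows "inj_on f (cspan B)"
proof -
  interpret f: module_hom scaleC scaleC f by fact
  obtain C where C: "C \<subseteq> B" "cindependent C" "B \<subseteq> cspan C"
    by (rule complex_vector.maximal_independent_subset)
  have span: "cspan B = cspan C"
    using C by (meson complex_vector.span_eq complex_vector.span_superset subset_trans)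
  have finC: "finite C" using C(1) B finite_subset by blast
  have fspan: "cspan (f ` C) = cspan C"
    using onto f.span_image[of C] span by simp
  have le: "card C \<le> card D" if "finite D" "cspan D = cspan C" for D
    using complex_vector.independent_span_bound[OF that(1) C(2)] that(2) complex_vector.span_superset by blast
  have card: "card (f ` C) = card C"
    using le[of "f ` C"] finC fspan card_image_le[OF finC, of f] by simp
  then have "inj_on f C" using finC by (rule eq_card_imp_inj_on[rotated])
  moreover have "cindependent (f ` C)"
  proof (rule ccontr)
    assume "\<not> ?thesis"
    then obtain a where a: "a \<in> f ` C" "a \<in> cspan (f ` C - {a})"
      unfolding complex_vector.dependent_def by blast
    have "cspan (f ` C - {a}) = cspan C"
      using complex_vector.span_redundant[OF a(2)] a(1) fspan by (simp add: insert_absorb)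
    then have "card C \<le> card (f ` C - {a})" using finC by (intro le) simp_all
    moreover have "card (f ` C - {a}) < card (f ` C)" using finC a(1) by (intro card_Diff1_less) simp_all
    ultimately show False using card by simp
  qed
  ultimately show ?thesis using f.inj_on_span_independent_image[of C] span by simp
qed

text \<open>\<open>f\<close> after \<open>g\<close> is an injective self-map of the
  finite-dimensional space \<open>W\<close>, hence onto, so \<open>f\<close> is onto
  \<open>W\<close>.\<close>

lemma bij_betw_of_mutual_injections:
  fixes f g :: "'a::complex_hilbert_space \<Rightarrow> 'a"
  assumes f: "clinear f" and g: "clinear g" and W: "csubspace W" "W \<subseteq> cspan B" "finite B"
    and fU: "f ` U \<subseteq> W" and gW: "g ` W \<subseteq> U" and inj: "inj_on f U" "inj_on g W"
  shows "bij_betw f U W"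
proof -
  have "(\<lambda>x. f (g x)) ` W = W"
  proof (rule injective_selfmap_onto[OF clinear_compose[OF f g] W])
    show "inj_on (\<lambda>x. f (g x)) W"
      using comp_inj_on[of g W f] inj gW inj_on_subset[OF inj(1) gW] by (simp add: o_def)
  qed (use fU gW in auto)
  then have "W \<subseteq> f ` U" using gW by blast
  then show ?thesis using fU inj(1) by (auto simp: bij_betw_def)
qed

section \<open>Kernels of powers in a Jordan basis\<close>

definition basis_index :: "nat \<Rightarrow> (nat \<Rightarrow> nat) \<Rightarrow> (nat \<times> nat) set" where
  "basis_index m d = (SIGMA \<nu>:{1..m}. {1..d \<nu>})"

lemma finite_basis_index: "finite (basis_index m d)"
  by (simp add: basis_index_def)

context
  fixes N :: "'k::complex_hilbert_space \<Rightarrow> 'k" and W m d u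
  assumes basis: "jordan_basis N W m d u" and N: "clinear N"
begin

lemma jordan_inj: "inj_on (\<lambda>(\<nu>, j). u \<nu> j) (basis_index m d)"
  and jordan_independent: "cindependent ((\<lambda>(\<nu>, j). u \<nu> j) ` basis_index m d)"
  and jordan_span: "cspan ((\<lambda>(\<nu>, j). u \<nu> j) ` basis_index m d) = W"
  using basis by (simp_all add: jordan_basis_def basis_index_def)

lemma jordan_zero: "\<nu> \<in> {1..m} \<Longrightarrow> u \<nu> 0 = 0"
  using basis by (auto simp: jordan_basis_def)

text \<open>Truncated subtraction and \<open>u \<nu> 0 = 0\<close> extend the rule to
  \<open>k = 0\<close>, so iterating it past the bottom of a chain needs no case
  distinction.\<close>

lemma jordan_step:
  assumes "\<nu> \<in> {1..m}" "k \<le> d \<nu>"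
  shows "N (u \<nu> k) = u \<nu> (k - 1)"
proof (cases "k = 0")
  case True
  then show ?thesis using assms(1) by (simp add: jordan_zero clinear_zero[OF N])
next
  case False
  then show ?thesis using assms basis by (auto simp: jordan_basis_def)
qed

lemma jordan_funpow:
  assumes "\<nu> \<in> {1..m}" "k \<le> d \<nu>"
  shows "(N ^^ i) (u \<nu> k) = u \<nu> (k - i)"
proof (induction i)
  case (Suc i)
  then show ?case using jordan_step[OF assms(1), of "k - i"] assms(2) by simp
qed simp

lemma jordan_in_W:
  assumes "\<nu> \<in> {1..m}" "k \<le> d \<nu>"
  shows "u \<nu> k \<in> W"
proof (cases "k = 0")
  case True
  then show ?thesis
    unfolding jordan_span[symmetric] by (simp only: jordan_zero[OF assms(1)] complex_vector.span_zero)
next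
  case False
  then have "(\<nu>, k) \<in> basis_index m d" using assms by (simp add: basis_index_def)
  then have "u \<nu> k \<in> (\<lambda>(\<nu>, j). u \<nu> j) ` basis_index m d" by force
  then show ?thesis unfolding jordan_span[symmetric] by (rule complex_vector.span_base)
qed

text \<open>The power \<open>N ^^ j\<close> sends the basis vectors of height above \<open>j\<close>
  injectively to basis vectors, so it is injective on their span; the component of \<open>v\<close>
  there must vanish.\<close>

lemma jordan_kernel:
  assumes v: "v \<in> W" "(N ^^ j) v = 0"
  shows "v \<in> cspan ((\<lambda>(\<nu>, j). u \<nu> j) ` {p \<in> basis_index m d. snd p \<le> j})"
proof -
  let ?U = "\<lambda>(\<nu>, j). u \<nu> j"
  let ?I = "basis_index m d"
  let ?I1 = "{p \<in> ?I. snd p \<le> j}" and ?I2 = "{p \<in> ?I. \<not> snd p \<le> j}"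
  note f = clinear_funpow[OF N, of j]
  have "?U ` ?I = ?U ` ?I1 \<union> ?U ` ?I2" by blast
  then have "v \<in> cspan (?U ` ?I1 \<union> ?U ` ?I2)" using v(1) jordan_span by simp
  then obtain v1 v2 where v12: "v = v1 + v2" "v1 \<in> cspan (?U ` ?I1)" "v2 \<in> cspan (?U ` ?I2)"
    unfolding complex_vector.span_Un by blast
  have "(N ^^ j) v1 = 0"
    by (rule clinear_eq_0_on_span[OF f _ v12(2)]) (auto simp: basis_index_def jordan_funpow jordan_zero)
  then have v2: "(N ^^ j) v2 = 0"
    using v(2) v12(1) module_hom.add[OF f, of v1 v2] by simp
  let ?s = "\<lambda>(\<nu>, k). (\<nu>, k - j)"
  have comp: "(N ^^ j) (?U p) = ?U (?s p)" "?s p \<in> ?I" if "p \<in> ?I2" for p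
    using that by (auto simp: basis_index_def jordan_funpow)
  have inj: "inj_on (\<lambda>p. ?U (?s p)) ?I2"
  proof (rule inj_onI)
    fix p q assume pq: "p \<in> ?I2" "q \<in> ?I2" "?U (?s p) = ?U (?s q)"
    then have "?s p = ?s q" using jordan_inj comp(2) by (meson inj_onD)
    then show "p = q" using pq(1,2) by (auto simp: basis_index_def)
  qed
  have "cindependent ((N ^^ j) ` (?U ` ?I2))"
  proof (rule complex_vector.independent_mono[OF jordan_independent])
    show "(N ^^ j) ` ?U ` ?I2 \<subseteq> ?U ` ?I"
    proof clarify
      fix a k assume "(a, k) \<in> ?I" "\<not> snd (a, k) \<le> j"
      then have p: "(a, k) \<in> ?I2" by simp
      show "(N ^^ j) (u a k) \<in> ?U ` ?I"
        using comp[OF p] by (metis (no_types, lifting) case_prod_conv imageI)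
    qed
  qed
  moreover have "inj_on (N ^^ j) (?U ` ?I2)"
  proof (rule inj_onI)
    fix x y assume xy: "x \<in> ?U ` ?I2" "y \<in> ?U ` ?I2" "(N ^^ j) x = (N ^^ j) y"
    then obtain p q where pq: "p \<in> ?I2" "q \<in> ?I2" "x = ?U p" "y = ?U q" by blast
    then have "?U (?s p) = ?U (?s q)" using xy(3) comp(1) by simp
    then have "p = q" using inj pq(1,2) by (meson inj_onD)
    then show "x = y" using pq by simp
  qed
  ultimately have inj': "inj_on (N ^^ j) (cspan (?U ` ?I2))"
    by (rule module_hom.inj_on_span_independent_image[OF f])
  have "v2 = 0"
    by (rule inj_onD[OF inj' _ v12(3) complex_vector.span_zero]) (simp only: v2 clinear_zero[OF f])
  then show ?thesis using v12 by simp
qed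

end

section \<open>Property C\<close>

context boundary_pair
begin

lemma clinear_E_fun: "s \<in> {1, -1} \<Longrightarrow> clinear (blinfun_apply (E s))"
  by (rule clinear_blinfun_imp[OF clinear_E])

lemma clinear_N_fun: "s \<in> {1, -1} \<Longrightarrow> clinear (blinfun_apply (N s))"
  by (rule clinear_blinfun_imp[OF clinear_N])

context
  fixes M :: nat and Y :: "real \<Rightarrow> nat \<Rightarrow> 'k set"
  assumes decomposition: "\<And>s. s \<in> {1, -1} \<Longrightarrow> jordan_decomposition (N s) (ups s) M (Y s)"
    and blocks: "\<And>s \<nu>. s \<in> {1, -1} \<Longrightarrow> \<nu> \<in> {1..M} \<Longrightarrow> E s ` Y (- s) \<nu> = Y s \<nu>"
begin

lemma decomposition_basis:
  assumes "s \<in> {1, -1}"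
  obtains d u where "jordan_basis (N s) (ups s) M d u" "\<And>\<nu>. \<nu> \<in> {1..M} \<Longrightarrow> Y s \<nu> = cspan (u \<nu> ` {1..d \<nu>})"
proof -
  obtain d u where du: "jordan_basis (N s) (ups s) M d u \<and> (\<forall>\<nu>\<in>{1..M}. Y s \<nu> = cspan (u \<nu> ` {1..d \<nu>}))"
    using decomposition[OF assms] unfolding jordan_decomposition_def by (elim exE)
  show ?thesis
    by (rule that[OF conjunct1[OF du]]) (rule bspec[OF conjunct2[OF du]])
qed

text \<open>By \<open>jordan_kernel\<close> it is enough to treat basis vectors of height at most
  \<open>j\<close>, and \<open>chain_image\<close> handles them block by block.\<close>

lemma E_generalized_kernel:
  assumes s: "s \<in> {1, -1}" and v: "v \<in> ups (- s)" "(blinfun_apply (N (- s)) ^^ j) v = 0"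
  shows "(blinfun_apply (N s) ^^ j) (E s v) = 0"
proof -
  note \<tau> = uminus_sign[OF s]
  obtain d' e where e: "jordan_basis (N (- s)) (ups (- s)) M d' e"
    and Y': "\<And>\<nu>. \<nu> \<in> {1..M} \<Longrightarrow> Y (- s) \<nu> = cspan (e \<nu> ` {1..d' \<nu>})"
    using decomposition_basis[OF \<tau>] by blast
  obtain d g where g: "jordan_basis (N s) (ups s) M d g"
    and Y: "\<And>\<nu>. \<nu> \<in> {1..M} \<Longrightarrow> Y s \<nu> = cspan (g \<nu> ` {1..d \<nu>})"
    using decomposition_basis[OF s] by blast
  let ?G = "(\<lambda>(\<nu>, j). g \<nu> j)"
  note gN = clinear_N_fun[OF s]
  note eN = clinear_N_fun[OF \<tau>]
  interpret E: module_hom scaleC scaleC "blinfun_apply (E s)" by (rule clinear_E_fun[OF s])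
  have key: "(blinfun_apply (N s) ^^ k) (E s (e \<nu> k)) = 0" if \<nu>: "\<nu> \<in> {1..M}" and k: "k \<le> d' \<nu>" for \<nu> k
  proof (rule chain_image[OF s, where e = "e \<nu>" and d = "d' \<nu>" and n = "d \<nu>" and Y = "Y s \<nu>"
        and B = "?G ` {p \<in> basis_index M d. fst p \<noteq> \<nu>}"])
    let ?B = "?G ` {p \<in> basis_index M d. fst p \<noteq> \<nu>}"
    show "e \<nu> 0 = 0" by (rule jordan_zero[OF e eN \<nu>])
    show "e \<nu> i \<in> ups (- s)" if "i \<le> d' \<nu>" for i by (rule jordan_in_W[OF e eN \<nu> that])
    show "N (- s) (e \<nu> (Suc i)) = e \<nu> i" if "i < d' \<nu>" for i
      using jordan_step[OF e eN \<nu>, of "Suc i"] that by simp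
    show "finite ?B" by (simp add: finite_basis_index)
    show "?B \<subseteq> ups s" using jordan_in_W[OF g gN] by (auto simp: basis_index_def)
    \<comment> \<open>\<open>d \<nu>\<close> steps kill block \<open>\<nu>\<close>, and the other
      blocks are invariant.\<close>
    show "(blinfun_apply (N s) ^^ d \<nu>) v \<in> cspan ?B" if "v \<in> ups s" for v
    proof (rule clinear_span_into[OF clinear_funpow[OF gN]])
      show "v \<in> cspan (?G ` basis_index M d)" using that by (simp only: jordan_span[OF g gN])
      fix x assume "x \<in> ?G ` basis_index M d"
      then obtain \<mu> i where i: "x = g \<mu> i" "\<mu> \<in> {1..M}" "i \<in> {1..d \<mu>}" by (auto simp: basis_index_def)
      have x: "(blinfun_apply (N s) ^^ d \<nu>) x = g \<mu> (i - d \<nu>)"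
        using i jordan_funpow[OF g gN, of \<mu> i "d \<nu>"] by simp
      show "(blinfun_apply (N s) ^^ d \<nu>) x \<in> cspan ?B"
      proof (cases "\<mu> = \<nu> \<or> i \<le> d \<nu>")
        case True
        then have "g \<mu> (i - d \<nu>) = 0" using i jordan_zero[OF g gN i(2)] by auto
        then show ?thesis unfolding x by (simp only: complex_vector.span_zero)
      next
        case False
        then have "(\<mu>, i - d \<nu>) \<in> {p \<in> basis_index M d. fst p \<noteq> \<nu>}" using i by (auto simp: basis_index_def)
        then have "g \<mu> (i - d \<nu>) \<in> ?B" by force
        then show ?thesis unfolding x by (rule complex_vector.span_base)
      qed
    qed
    show "N s y \<in> Y s \<nu>" if "y \<in> Y s \<nu>" for y
      unfolding Y[OF \<nu>]
    proof (rule clinear_span_into[OF gN])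
      show "y \<in> cspan (g \<nu> ` {1..d \<nu>})" using that by (simp only: Y[OF \<nu>])
      fix x assume "x \<in> g \<nu> ` {1..d \<nu>}"
      then obtain i where i: "x = g \<nu> i" "i \<in> {1..d \<nu>}" by blast
      show "N s x \<in> cspan (g \<nu> ` {1..d \<nu>})"
      proof (cases "i = 1")
        case True
        then have "N s x = 0" using i jordan_step[OF g gN \<nu>, of i] jordan_zero[OF g gN \<nu>] by simp
        then show ?thesis by (simp only: complex_vector.span_zero)
      next
        case False
        then have "N s x = g \<nu> (i - 1)" "i - 1 \<in> {1..d \<nu>}" using i jordan_step[OF g gN \<nu>, of i] by auto
        then have "N s x \<in> g \<nu> ` {1..d \<nu>}" by blast
        then show ?thesis by (rule complex_vector.span_base)
      qed
    qed
    have Gsub: "g \<nu> ` {1..d \<nu>} \<subseteq> ?G ` basis_index M d"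
      using \<nu> by (force simp: basis_index_def)
    show "y = 0" if "y \<in> Y s \<nu>" "y \<in> cspan ?B" for y
    proof (rule span_disjoint_independent[OF jordan_independent[OF g gN] Gsub])
      show "?B \<subseteq> ?G ` basis_index M d" by auto
      show "g \<nu> ` {1..d \<nu>} \<inter> ?B = {}"
      proof (rule ccontr)
        assume "g \<nu> ` {1..d \<nu>} \<inter> ?B \<noteq> {}"
        then obtain x where x: "x \<in> g \<nu> ` {1..d \<nu>}" "x \<in> ?B" by blast
        obtain i where i: "i \<in> {1..d \<nu>}" "x = g \<nu> i" using x(1) by blast
        obtain p where p: "p \<in> basis_index M d" "fst p \<noteq> \<nu>" "x = ?G p" using x(2) by blast
        obtain \<mu> k where \<mu>: "p = (\<mu>, k)" by (cases p)
        have ik: "i \<in> {1..d \<nu>}" "(\<mu>, k) \<in> basis_index M d" "\<mu> \<noteq> \<nu>" "g \<nu> i = g \<mu> k"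
          using i p \<mu> by simp_all
        have "(\<nu>, i) = (\<mu>, k)"
          by (rule inj_onD[OF jordan_inj[OF g gN]]) (use ik \<nu> in \<open>auto simp: basis_index_def\<close>)
        then show False using ik(3) by simp
      qed
    qed (use that in \<open>simp_all only: Y[OF \<nu>]\<close>)
    show "Y s \<nu> \<subseteq> ups s"
      using complex_vector.span_mono[OF Gsub] by (simp only: Y[OF \<nu>] jordan_span[OF g gN])
    show "y - y' \<in> Y s \<nu>" if "y \<in> Y s \<nu>" "y' \<in> Y s \<nu>" for y y'
      using that unfolding Y[OF \<nu>] by (rule complex_vector.span_diff)
    show "E s (e \<nu> i) \<in> Y s \<nu>" if i: "i \<le> d' \<nu>" for i
    proof -
      have "e \<nu> i \<in> cspan (e \<nu> ` {1..d' \<nu>})"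
      proof (cases "i = 0")
        case True
        then show ?thesis by (simp add: jordan_zero[OF e eN \<nu>] complex_vector.span_zero)
      next
        case False
        then show ?thesis using i by (intro complex_vector.span_base) auto
      qed
      then show ?thesis using blocks[OF s \<nu>] Y'[OF \<nu>] by blast
    qed
    \<comment> \<open>\<open>E s\<close> maps the block of sign \<open>- s\<close> onto the block of
      sign \<open>s\<close>, so the dimension cannot grow.\<close>
    show "d \<nu> \<le> d' \<nu>"
    proof -
      have sub: "g \<nu> ` {1..d \<nu>} \<subseteq> cspan (blinfun_apply (E s) ` (e \<nu> ` {1..d' \<nu>}))"
        using blocks[OF s \<nu>] complex_vector.span_superset[of "g \<nu> ` {1..d \<nu>}"]
        by (simp only: Y[OF \<nu>] Y'[OF \<nu>] E.span_image)
      have ind: "cindependent (g \<nu> ` {1..d \<nu>})"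
        by (rule complex_vector.independent_mono[OF jordan_independent[OF g gN] Gsub])
      have "inj_on (g \<nu>) {1..d \<nu>}"
      proof (rule inj_onI)
        fix i k assume ik: "i \<in> {1..d \<nu>}" "k \<in> {1..d \<nu>}" "g \<nu> i = g \<nu> k"
        have "(\<nu>, i) = (\<nu>, k)"
          by (rule inj_onD[OF jordan_inj[OF g gN]]) (use ik \<nu> in \<open>auto simp: basis_index_def\<close>)
        then show "i = k" by simp
      qed
      then have "d \<nu> = card (g \<nu> ` {1..d \<nu>})" by (simp add: card_image)
      also have "\<dots> \<le> card (blinfun_apply (E s) ` (e \<nu> ` {1..d' \<nu>}))"
        by (rule conjunct2[OF complex_vector.independent_span_bound[OF _ ind sub]]) simp
      also have "\<dots> \<le> card (e \<nu> ` {1..d' \<nu>})" by (rule card_image_le) simp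
      also have "\<dots> \<le> card {1..d' \<nu>}" by (rule card_image_le) simp
      finally show ?thesis by simp
    qed
    show "k \<le> d' \<nu>" by (rule k)
  qed
  have "v \<in> cspan ((\<lambda>(\<nu>, j). e \<nu> j) ` {p \<in> basis_index M d'. snd p \<le> j})"
    by (rule jordan_kernel[OF e eN v])
  then show ?thesis
  proof (rule clinear_eq_0_on_span[OF clinear_compose[OF clinear_funpow[OF gN] clinear_E_fun[OF s]], rotated])
    fix x assume "x \<in> (\<lambda>(\<nu>, j). e \<nu> j) ` {p \<in> basis_index M d'. snd p \<le> j}"
    then obtain \<nu> k where k: "x = e \<nu> k" "\<nu> \<in> {1..M}" "k \<le> d' \<nu>" "k \<le> j" by (auto simp: basis_index_def)
    have "(blinfun_apply (N s) ^^ ((j - k) + k)) (E s x) = (blinfun_apply (N s) ^^ (j - k)) ((blinfun_apply (N s) ^^ k) (E s x))"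
      by (simp only: funpow_add o_apply)
    also have "\<dots> = 0" unfolding k(1) key[OF k(2,3)] by (rule clinear_zero[OF clinear_funpow[OF gN]])
    finally show "(blinfun_apply (N s) ^^ j) (E s x) = 0" using k(4) by simp
  qed
qed

lemma ups_finite_span:
  assumes "s \<in> {1, -1}"
  obtains B where "finite B" "ups s = cspan B"
proof (rule decomposition_basis[OF assms])
  fix d g assume g: "jordan_basis (N s) (ups s) M d g"
  show thesis
    by (rule that[OF _ jordan_span[OF g clinear_N_fun[OF assms], symmetric]]) (simp add: finite_basis_index)
qed

lemma E_ups_onto:
  assumes s: "s \<in> {1, -1}"
  shows "E s ` ups (- s) = ups s"
proof
  note \<tau> = uminus_sign[OF s]
  show "E s ` ups (- s) \<subseteq> ups s" by (auto simp: ups_def E_E[OF s])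
  obtain d' e where e: "jordan_basis (N (- s)) (ups (- s)) M d' e"
    and Y': "\<And>\<nu>. \<nu> \<in> {1..M} \<Longrightarrow> Y (- s) \<nu> = cspan (e \<nu> ` {1..d' \<nu>})"
    using decomposition_basis[OF \<tau>] by blast
  obtain d g where g: "jordan_basis (N s) (ups s) M d g"
    and Y: "\<And>\<nu>. \<nu> \<in> {1..M} \<Longrightarrow> Y s \<nu> = cspan (g \<nu> ` {1..d \<nu>})"
    using decomposition_basis[OF s] by blast
  note eN = clinear_N_fun[OF \<tau>] and gN = clinear_N_fun[OF s]
  interpret E: module_hom scaleC scaleC "blinfun_apply (E s)" by (rule clinear_E_fun[OF s])
  let ?U = "(\<lambda>(\<nu>, j). e \<nu> j) ` basis_index M d'"
  have img: "E s ` ups (- s) = cspan (blinfun_apply (E s) ` ?U)"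
    using jordan_span[OF e eN] by (simp add: E.span_image)
  have "(\<lambda>(\<nu>, j). g \<nu> j) ` basis_index M d \<subseteq> E s ` ups (- s)"
  proof clarify
    fix \<nu> i assume "(\<nu>, i) \<in> basis_index M d"
    then have \<nu>: "\<nu> \<in> {1..M}" and i: "i \<in> {1..d \<nu>}" by (auto simp: basis_index_def)
    have "g \<nu> i \<in> Y s \<nu>" using i by (simp add: Y[OF \<nu>] complex_vector.span_base)
    then have "g \<nu> i \<in> E s ` Y (- s) \<nu>" using blocks[OF s \<nu>] by simp
    moreover have "Y (- s) \<nu> \<subseteq> ups (- s)"
    proof -
      have "e \<nu> ` {1..d' \<nu>} \<subseteq> ?U" using \<nu> by (force simp: basis_index_def)
      then show ?thesis
        unfolding Y'[OF \<nu>] jordan_span[OF e eN, symmetric] by (rule complex_vector.span_mono)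
    qed
    ultimately show "g \<nu> i \<in> E s ` ups (- s)" by blast
  qed
  then have "cspan ((\<lambda>(\<nu>, j). g \<nu> j) ` basis_index M d) \<subseteq> E s ` ups (- s)"
    unfolding img by (rule complex_vector.span_minimal) (rule complex_vector.subspace_span)
  then show "ups s \<subseteq> E s ` ups (- s)" by (simp only: jordan_span[OF g gN])
qed

text \<open>The composite of the two projections maps the finite-dimensional space
  \<open>ups (- s)\<close> onto itself, hence is injective.\<close>

lemma E_injective_on_ups:
  assumes s: "s \<in> {1, -1}"
  shows "inj_on (E s) (ups (- s))"
proof -
  note \<tau> = uminus_sign[OF s]
  obtain B where B: "finite B" "ups (- s) = cspan B" using ups_finite_span[OF \<tau>] by blast
  have inj: "inj_on (\<lambda>x. E (- s) (E s x)) (cspan B)"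
  proof (rule surjective_selfmap_injective[OF clinear_compose[OF clinear_E_fun[OF \<tau>] clinear_E_fun[OF s]] B(1)])
    have "(\<lambda>x. E (- s) (E s x)) ` ups (- s) = E (- s) ` (E s ` ups (- s))" by (simp add: image_image)
    also have "\<dots> = ups (- s)" using E_ups_onto[OF s] E_ups_onto[OF \<tau>] by simp
    finally show "(\<lambda>x. E (- s) (E s x)) ` cspan B = cspan B" by (simp only: B(2))
  qed
  show ?thesis
    unfolding B(2)
  proof (rule inj_onI)
    fix x y assume "x \<in> cspan B" "y \<in> cspan B" "E s x = E s y"
    then show "x = y" using inj_onD[OF inj, of x y] by simp
  qed
qed

lemma bij_betw_generalized_kernels:
  assumes s: "s \<in> {1, -1}"
  shows "bij_betw (E s) {u \<in> ups (- s). (blinfun_apply (N (- s)) ^^ j) u = 0} {u \<in> ups s. (blinfun_apply (N s) ^^ j) u = 0}"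
proof -
  let ?W = "\<lambda>s. {u \<in> ups s. (blinfun_apply (N s) ^^ j) u = 0}"
  note \<tau> = uminus_sign[OF s]
  obtain B where B: "finite B" "ups s = cspan B" using ups_finite_span[OF s] by blast
  have maps: "E s ` ?W (- s) \<subseteq> ?W s" if "s \<in> {1, -1}" for s
  proof (intro image_subsetI CollectI conjI)
    fix u assume u: "u \<in> ?W (- s)"
    show "E s u \<in> ups s" unfolding ups_def by (simp only: mem_Collect_eq E_E[OF that])
    show "(blinfun_apply (N s) ^^ j) (E s u) = 0"
      using u by (intro E_generalized_kernel[OF that]) simp_all
  qed
  show ?thesis
  proof (rule bij_betw_of_mutual_injections[OF clinear_E_fun[OF s] clinear_E_fun[OF \<tau>]])
    show "csubspace (?W s)"
    proof -
      interpret f: module_hom scaleC scaleC "blinfun_apply (N s) ^^ j" by (rule clinear_funpow[OF clinear_N_fun[OF s]])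
      have "csubspace (ups s \<inter> {u. (blinfun_apply (N s) ^^ j) u = 0})"
        unfolding B(2) by (intro complex_vector.subspace_inter complex_vector.subspace_span f.subspace_kernel)
      then show ?thesis by (simp add: Int_def)
    qed
    show "?W s \<subseteq> cspan B" using B(2) by blast
    show "E (- s) ` ?W s \<subseteq> ?W (- s)" using maps[OF \<tau>] by (simp only: minus_minus)
    show "E s ` ?W (- s) \<subseteq> ?W s" by (rule maps[OF s])
    show "finite B" by (rule B(1))
    show "inj_on (E (- s)) (?W s)"
      using E_injective_on_ups[OF \<tau>] unfolding minus_minus by (rule inj_on_subset) blast
    show "inj_on (E s) (?W (- s))"
      using E_injective_on_ups[OF s] by (rule inj_on_subset) blast
  qed
qed

end

end

section \<open>Independence of the base point\<close>

text \<open>\<open>W = 1 + (s - s0) K0\<close> is injective, commutes with \<open>1 + (r - s) K\<close>, and their product is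
  \<open>1 + (r - s0) K0\<close>.\<close>

lemma kernel_funpow_base_point:
  fixes K K0 :: "'a::real_normed_vector \<Rightarrow>\<^sub>L 'a" and r s s0 :: real
  assumes left: "\<And>u. K u + (s - s0) *\<^sub>R K0 (K u) = K0 u" and right: "\<And>u. K (u + (s - s0) *\<^sub>R K0 u) = K0 u"
    and inj: "\<And>y. y + (s - s0) *\<^sub>R K0 y = 0 \<Longrightarrow> y = 0"
  shows "(blinfun_apply (id_blinfun + (r - s) *\<^sub>R K) ^^ j) u = 0 \<longleftrightarrow>
    (blinfun_apply (id_blinfun + (r - s0) *\<^sub>R K0) ^^ j) u = 0"
proof (induction j arbitrary: u)
  case (Suc j)
  let ?X = "id_blinfun + (r - s) *\<^sub>R K" and ?Y = "id_blinfun + (r - s0) *\<^sub>R K0" and ?W = "id_blinfun + (s - s0) *\<^sub>R K0"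
  have ap: "?X u = u + (r - s) *\<^sub>R K u" "?Y u = u + (r - s0) *\<^sub>R K0 u" "?W u = u + (s - s0) *\<^sub>R K0 u" for u
    by (simp_all add: blinfun.add_left blinfun.scaleR_left)
  have WX: "?W (?X u) = ?Y u" for u
  proof -
    have "?W (?X u) = u + (s - s0) *\<^sub>R K0 u + (r - s) *\<^sub>R (K u + (s - s0) *\<^sub>R K0 (K u))"
      by (simp only: ap blinfun.add_right blinfun.scaleR_right scaleR_add_right add_ac)
    also have "\<dots> = ?Y u" unfolding left ap by (simp add: algebra_simps)
    finally show ?thesis .
  qed
  have W0: "?Y (?W u) = ?W (?Y u)" for u
    by (simp only: ap blinfun.add_right blinfun.scaleR_right) (simp add: algebra_simps)
  have Wj: "(blinfun_apply ?Y ^^ j) (?W v) = ?W ((blinfun_apply ?Y ^^ j) v)" for v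
    by (induction j) (simp_all add: W0)
  have "(blinfun_apply ?X ^^ Suc j) u = 0 \<longleftrightarrow> (blinfun_apply ?Y ^^ j) (?X u) = 0"
    using Suc.IH[of "?X u"] by (simp add: funpow_swap1)
  also have "\<dots> \<longleftrightarrow> ?W ((blinfun_apply ?Y ^^ j) (?X u)) = 0"
    using inj[of "(blinfun_apply ?Y ^^ j) (?X u)"] unfolding ap(3) by auto
  also have "\<dots> \<longleftrightarrow> (blinfun_apply ?Y ^^ Suc j) u = 0"
    unfolding Wj[symmetric] WX by (simp add: funpow_swap1)
  finally show ?case .
qed simp

text \<open>An intertwining operator maps generalized kernel to generalized kernel and generalized
  range to generalized range. With \<open>L = J\<close> this gives \<open>Q J = J P\<close>.\<close>

lemma riesz_projections_intertwine:
  assumes 1: "riesz_splitting X E Z m" and 2: "riesz_splitting X' E' Z' m'"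
    and L: "\<And>x. X' (blinfun_apply L x) = L (X x)"
  shows "E' (L u) = L (E u)"
proof -
  interpret p: riesz_splitting X E Z m by fact
  interpret q: riesz_splitting X' E' Z' m' by fact
  have Ln: "(blinfun_apply X' ^^ n) (L x) = L ((blinfun_apply X ^^ n) x)" for n x
    by (induction n) (simp_all add: L)
  have 1: "E' (L (E u)) = L (E u)"
    by (rule q.E_fixes_generalized_kernel[of m]) (simp add: Ln p.X_funpow_E)
  define y where "y = u - E u"
  have "E y = 0" by (simp add: y_def blinfun.diff_right)
  then have "y = (blinfun_apply X ^^ m') ((blinfun_apply Z ^^ m') y)" by (rule p.X_funpow_Z_funpow[symmetric])
  then have "E' (L y) = E' ((blinfun_apply X' ^^ m') (L ((blinfun_apply Z ^^ m') y)))" by (simp add: Ln)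
  also have "\<dots> = (blinfun_apply X' ^^ m') (E' (L ((blinfun_apply Z ^^ m') y)))"
    by (rule q.intertwine_funpow[symmetric]) (simp add: q.X_E)
  also have "\<dots> = 0" by (rule q.X_funpow_E)
  finally show ?thesis using 1 by (simp add: y_def blinfun.diff_right)
qed

lemma subspace_kernel_funpow:
  fixes X :: "'a::complex_hilbert_space \<Rightarrow>\<^sub>L 'a"
  assumes "clinear_blinfun X"
  shows "csubspace {u. (blinfun_apply X ^^ j) u = 0}"
  using module_hom.subspace_kernel[OF clinear_funpow[OF clinear_blinfun_imp[OF assms]]] .

lemma clinear_iso_betwI:
  assumes "clinear_blinfun S" "csubspace U" "csubspace W" "bij_betw (blinfun_apply S) U W"
  shows "clinear_iso_betw (blinfun_apply S) U W"
  using assms by (simp add: clinear_iso_betw_def blinfun.add_right clinear_blinfunD)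

section \<open>Resonance spaces and residues of the line\<close>

context resonance_line
begin

context
  fixes lam s0 :: real
  assumes s0: "s0 \<in> NR lam"
begin

abbreviation "Aop \<equiv> A_op F J H\<^sub>0 lam"
abbreviation "Bop \<equiv> B_op F J H\<^sub>0 lam"
abbreviation "Ups \<equiv> Upsilon_j F J H\<^sub>0 lam"
abbreviation "Psi \<equiv> Psi_j F J H\<^sub>0 lam"
abbreviation "Pid \<equiv> P_idem F J H\<^sub>0 lam"
abbreviation "Qid \<equiv> Q_idem F J H\<^sub>0 lam"

private lemma move: "a = b + (s0 - s) *\<^sub>R x \<Longrightarrow> a + (s - s0) *\<^sub>R x = b" for a b x :: 'k
  by (simp add: algebra_simps)

text \<open>Together these say that \<open>1 + (s - s0) K s0\<close> is injective and that
  \<open>K s\<close> is its inverse composed with \<open>K s0\<close>, in either order. The first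
  two are the resolvent identity read in both directions; by the second,
  \<open>u + (s - s0) *\<^sub>R K s0 u = 0\<close> forces \<open>K s0 u = 0\<close>.\<close>

lemma A_op_identities:
  assumes s: "s \<in> NR lam" and \<sigma>: "\<sigma> \<in> {1, -1}"
  defines "K \<equiv> Aop \<sigma>"
  shows "K s u + (s - s0) *\<^sub>R K s0 (K s u) = K s0 u" "K s (u + (s - s0) *\<^sub>R K s0 u) = K s0 u"
    "u + (s - s0) *\<^sub>R K s0 u = 0 \<Longrightarrow> u = 0"
proof -
  let ?T = "Tb lam \<sigma> s" and ?S = "Tb lam \<sigma> s0"
  have K: "K s v = ?T (J v)" "K s0 v = ?S (J v)" for v by (simp_all add: K_def A_op_def)
  have 1: "?T v = ?S (v + (s0 - s) *\<^sub>R J (?T v))" for v by (rule boundary_resolvent_identity[OF s s0 \<sigma>])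
  have "?T v = ?S v + (s0 - s) *\<^sub>R ?S (J (?T v))" for v
    by (rule trans[OF 1]) (simp add: blinfun.add_right blinfun.scaleR_right)
  then have "?T v + (s - s0) *\<^sub>R ?S (J (?T v)) = ?S v" for v
    by (rule move)
  then show "K s u + (s - s0) *\<^sub>R K s0 (K s u) = K s0 u" unfolding K by this
  have 2: "?S v = ?T (v + (s - s0) *\<^sub>R J (?S v))" for v by (rule boundary_resolvent_identity[OF s0 s \<sigma>])
  show 3: "K s (u + (s - s0) *\<^sub>R K s0 u) = K s0 u"
    unfolding K using 2[of "J u", symmetric] by (simp add: blinfun.add_right blinfun.scaleR_right)
  show "u = 0" if u: "u + (s - s0) *\<^sub>R K s0 u = 0"
    using 3 u by simp
qed

lemma B_op_identities:
  assumes s: "s \<in> NR lam" and \<sigma>: "\<sigma> \<in> {1, -1}"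
  defines "K \<equiv> Bop \<sigma>"
  shows "K s u + (s - s0) *\<^sub>R K s0 (K s u) = K s0 u" "K s (u + (s - s0) *\<^sub>R K s0 u) = K s0 u"
    "u + (s - s0) *\<^sub>R K s0 u = 0 \<Longrightarrow> u = 0"
proof -
  let ?T = "Tb lam \<sigma> s" and ?S = "Tb lam \<sigma> s0"
  have K: "K s v = J (?T v)" "K s0 v = J (?S v)" for v by (simp_all add: K_def B_op_def)
  have 1: "?T v = ?S (v + (s0 - s) *\<^sub>R J (?T v))" for v by (rule boundary_resolvent_identity[OF s s0 \<sigma>])
  have "J (?T v) = J (?S v) + (s0 - s) *\<^sub>R J (?S (J (?T v)))" for v
    by (rule trans[OF arg_cong[OF 1, of "blinfun_apply J"]]) (simp add: blinfun.add_right blinfun.scaleR_right)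
  then show "K s u + (s - s0) *\<^sub>R K s0 (K s u) = K s0 u" unfolding K by (rule move)
  have 2: "?S v = ?T (v + (s - s0) *\<^sub>R J (?S v))" for v by (rule boundary_resolvent_identity[OF s0 s \<sigma>])
  show 3: "K s (u + (s - s0) *\<^sub>R K s0 u) = K s0 u"
    unfolding K using 2[of u, symmetric] by (rule arg_cong)
  show "u = 0" if u: "u + (s - s0) *\<^sub>R K s0 u = 0"
    using 3 u by simp
qed

lemma Upsilon_j_base_point:
  assumes \<sigma>: "\<sigma> \<in> {1, -1}"
  shows "Ups \<sigma> r j =
    {u. (blinfun_apply (id_blinfun + (r - s0) *\<^sub>R Aop \<sigma> s0) ^^ j) u = 0}"
proof -
  have "(blinfun_apply (id_blinfun + (r - s) *\<^sub>R Aop \<sigma> s) ^^ j) u = 0 \<longleftrightarrow>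
      (blinfun_apply (id_blinfun + (r - s0) *\<^sub>R Aop \<sigma> s0) ^^ j) u = 0"
    if s: "s \<in> NR lam" for s u
    by (rule kernel_funpow_base_point[OF A_op_identities(1)[OF s \<sigma>] A_op_identities(2)[OF s \<sigma>]
          A_op_identities(3)[OF s \<sigma>]])
  then show ?thesis unfolding Upsilon_j_def using s0 by blast
qed

lemma Psi_j_base_point:
  assumes \<sigma>: "\<sigma> \<in> {1, -1}"
  shows "Psi \<sigma> r j =
    {u. (blinfun_apply (id_blinfun + (r - s0) *\<^sub>R Bop \<sigma> s0) ^^ j) u = 0}"
proof -
  have "(blinfun_apply (id_blinfun + (r - s) *\<^sub>R Bop \<sigma> s) ^^ j) u = 0 \<longleftrightarrow>
      (blinfun_apply (id_blinfun + (r - s0) *\<^sub>R Bop \<sigma> s0) ^^ j) u = 0"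
    if s: "s \<in> NR lam" for s u
    by (rule kernel_funpow_base_point[OF B_op_identities(1)[OF s \<sigma>] B_op_identities(2)[OF s \<sigma>]
          B_op_identities(3)[OF s \<sigma>]])
  then show ?thesis unfolding Psi_j_def using s0 by blast
qed

lemma A_op_compact_clinear:
  assumes \<sigma>: "\<sigma> \<in> {1, -1}"
  shows "compact_blinfun (Aop \<sigma> s0)" "clinear_blinfun (Aop \<sigma> s0)"
  unfolding A_op_def
  by (intro compact_blinfun_comp_right clinear_blinfun_intros compact_boundary clinear_boundary clinear_J s0 \<sigma>)+

lemma B_op_compact_clinear:
  assumes \<sigma>: "\<sigma> \<in> {1, -1}"
  shows "compact_blinfun (Bop \<sigma> s0)" "clinear_blinfun (Bop \<sigma> s0)"
  unfolding B_op_def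
  by (intro compact_blinfun_comp_left clinear_blinfun_intros compact_boundary clinear_boundary clinear_J s0 \<sigma>)+

lemma P_idem_A_nil_eq:
  assumes \<sigma>: "\<sigma> \<in> {1, -1}"
    and splitting: "pencil_splitting X E Z m (Aop \<sigma> s0) (of_real (r - s0))"
  shows "Pid \<sigma> r = E"
    "A_nil F J H\<^sub>0 lam \<sigma> r = pencil_splitting.nilp X E m (of_real (r - s0))"
proof -
  obtain \<delta> where \<delta>: "\<delta> > 0" "\<And>s. \<bar>s - s0\<bar> < \<delta> \<Longrightarrow> s \<in> NR lam"
    using nonresonant_nearby[OF s0] by blast
  note res = meromorphic_extension_residues[OF A_op_compact_clinear[OF \<sigma>] \<delta>
      A_op_identities(1)[OF _ \<sigma>] A_op_identities(3)[OF _ \<sigma>] splitting]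
  show "Pid \<sigma> r = E"
    unfolding P_idem_def A_ext_def by (rule res(1))
  show "A_nil F J H\<^sub>0 lam \<sigma> r = pencil_splitting.nilp X E m (of_real (r - s0))"
    unfolding A_nil_def A_ext_def by (rule res(2))
qed

lemma Q_idem_eq:
  assumes \<sigma>: "\<sigma> \<in> {1, -1}"
    and splitting: "pencil_splitting X E Z m (Bop \<sigma> s0) (of_real (r - s0))"
  shows "Qid \<sigma> r = E"
proof -
  obtain \<delta> where \<delta>: "\<delta> > 0" "\<And>s. \<bar>s - s0\<bar> < \<delta> \<Longrightarrow> s \<in> NR lam"
    using nonresonant_nearby[OF s0] by blast
  show ?thesis
    unfolding Q_idem_def B_ext_def
    by (rule meromorphic_extension_residues(1)[OF B_op_compact_clinear[OF \<sigma>] \<delta>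
      B_op_identities(1)[OF _ \<sigma>] B_op_identities(3)[OF _ \<sigma>] splitting])
qed

text \<open>\<open>J\<close> intertwines \<open>1 + c A\<close> with \<open>1 + c B\<close>, and
  \<open>T\<close> intertwines them backwards. \<open>J\<close> is injective since
  \<open>A = T J\<close> is, and onto since \<open>B = J T\<close> is surjective on the generalized
  kernel.\<close>

lemma bij_betw_J:
  assumes \<sigma>: "\<sigma> \<in> {1, -1}"
  shows "bij_betw J (Ups \<sigma> r j) (Psi \<sigma> r j)"
proof -
  let ?T = "Tb lam \<sigma> s0"
  let ?A = "Aop \<sigma> s0" and ?B = "Bop \<sigma> s0"
  let ?c = "complex_of_real (r - s0)"
  define XA where "XA = id_blinfun + cscale ?c ?A"
  define XB where "XB = id_blinfun + cscale ?c ?B"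
  have U: "Ups \<sigma> r j = {u. (blinfun_apply XA ^^ j) u = 0}"
    unfolding Upsilon_j_base_point[OF \<sigma>] XA_def cscale_of_real ..
  have P: "Psi \<sigma> r j = {u. (blinfun_apply XB ^^ j) u = 0}"
    unfolding Psi_j_base_point[OF \<sigma>] XB_def cscale_of_real ..
  obtain EA ZA mA where "pencil_splitting (id_blinfun + cscale ?c ?A) EA ZA mA ?A ?c"
    using pencil_splitting_exists[OF A_op_compact_clinear[OF \<sigma>]] by blast
  then interpret a: pencil_splitting XA EA ZA mA ?A ?c by (simp add: XA_def)
  obtain EB ZB mB where "pencil_splitting (id_blinfun + cscale ?c ?B) EB ZB mB ?B ?c"
    using pencil_splitting_exists[OF B_op_compact_clinear[OF \<sigma>]] by blast
  then interpret b: pencil_splitting XB EB ZB mB ?B ?c by (simp add: XB_def)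
  have A: "?A u = ?T (J u)" and B: "?B u = J (?T u)" for u by (simp_all add: A_op_def B_op_def)
  have JX: "XB (J u) = J (XA u)" for u
    by (simp add: XA_def XB_def blinfun.add_left blinfun.add_right A B clinear_blinfunD[OF clinear_J])
  have TX: "XA (?T u) = ?T (XB u)" for u
    by (simp add: XA_def XB_def blinfun.add_left blinfun.add_right A B clinear_blinfunD[OF clinear_boundary[OF s0 \<sigma>]])
  have JXn: "(blinfun_apply XB ^^ n) (J u) = J ((blinfun_apply XA ^^ n) u)" for n u
    by (induction n) (simp_all add: JX)
  have TXn: "(blinfun_apply XA ^^ n) (?T u) = ?T ((blinfun_apply XB ^^ n) u)" for n u
    by (induction n) (simp_all add: TX)
  show ?thesis
    unfolding U P
  proof (rule bij_betw_imageI)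
    show "inj_on J {u. (blinfun_apply XA ^^ j) u = 0}"
    proof (rule inj_onI)
      fix x y assume x: "x \<in> {u. (blinfun_apply XA ^^ j) u = 0}" and y: "y \<in> {u. (blinfun_apply XA ^^ j) u = 0}" and eq: "J x = J y"
      have "EA x = x" "EA y = y" using x y a.E_fixes_generalized_kernel by auto
      then have "EA (x - y) = x - y" by (simp add: blinfun.diff_right)
      moreover have "?A (x - y) = 0" by (simp add: A blinfun.diff_right eq)
      ultimately have "x - y = 0" by (rule a.A_injective_on_E)
      then show "x = y" by simp
    qed
    show "J ` {u. (blinfun_apply XA ^^ j) u = 0} = {u. (blinfun_apply XB ^^ j) u = 0}"
    proof (intro equalityI subsetI)
      fix x assume "x \<in> J ` {u. (blinfun_apply XA ^^ j) u = 0}"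
      then show "x \<in> {u. (blinfun_apply XB ^^ j) u = 0}" by (auto simp: JXn)
    next
      fix \<psi> assume "\<psi> \<in> {u. (blinfun_apply XB ^^ j) u = 0}"
      then have \<psi>: "(blinfun_apply XB ^^ j) \<psi> = 0" by simp
      have E\<psi>: "EB \<psi> = \<psi>" by (rule b.E_fixes_generalized_kernel[OF \<psi>])
      define v where "v = - (b.nilp \<psi> + ?c *\<^sub>C \<psi>)"
      have v: "\<psi> = J (?T v)" using b.A_surjective_on_E[OF E\<psi>] by (simp only: B v_def)
      have lin: "clinear (blinfun_apply XB ^^ j)" by (rule clinear_funpow[OF clinear_blinfun_imp[OF b.clinear_X]])
      have "(blinfun_apply XB ^^ j) (b.nilp \<psi>) = b.nilp ((blinfun_apply XB ^^ j) \<psi>)"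
        by (rule b.intertwine_funpow) (rule b.X_nilp_commute[symmetric])
      then have "(blinfun_apply XB ^^ j) v = 0"
        by (simp add: v_def module_hom.neg[OF lin] module_hom.diff[OF lin] module_hom.add[OF lin] module_hom.scale[OF lin] \<psi>)
      then have "(blinfun_apply XA ^^ j) (?T v) = 0" by (simp add: TXn)
      then show "\<psi> \<in> J ` {u. (blinfun_apply XA ^^ j) u = 0}" using v by blast
    qed
  qed
qed

lemma resonance_isomorphisms:
  assumes C: "property_C F J H\<^sub>0 lam r" and \<sigma>: "\<sigma> \<in> {1, -1}"
  shows "bij_betw (Pid \<sigma> r) (Ups (- \<sigma>) r j) (Ups \<sigma> r j)"
    "Qid \<sigma> r (J u) = J (Pid \<sigma> r u)"
    "clinear_blinfun (Pid \<sigma> r)" "clinear_blinfun (Qid \<sigma> r)"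
proof -
  define T where "T \<sigma> = Tb lam \<sigma> s0" for \<sigma>
  define c where "c = r - s0"
  have A: "Aop \<sigma> s0 = T \<sigma> o\<^sub>L J" and B: "Bop \<sigma> s0 = J o\<^sub>L T \<sigma>" for \<sigma>
    by (simp_all add: A_op_def B_op_def T_def)
  define S where "S \<sigma> E Z m \<longleftrightarrow> pencil_splitting (id_blinfun + cscale (of_real c) (T \<sigma> o\<^sub>L J)) E Z m (T \<sigma> o\<^sub>L J) (of_real c)"
    for \<sigma> E Z m
  have S: "\<exists>E Z m. S \<tau> E Z m" if "\<tau> \<in> {1, -1}" for \<tau>
    unfolding S_def using pencil_splitting_exists[OF A_op_compact_clinear[OF that], unfolded A] by blast
  obtain E1 Z1 m1 where S1: "S 1 E1 Z1 m1" using S[of 1] by blast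
  obtain E2 Z2 m2 where S2: "S (- 1) E2 Z2 m2" using S[of "- 1"] by blast
  define E where "E \<tau> = (if \<tau> = 1 then E1 else E2)" for \<tau> :: real
  define Z where "Z \<tau> = (if \<tau> = 1 then Z1 else Z2)" for \<tau> :: real
  define m where "m \<tau> = (if \<tau> = 1 then m1 else m2)" for \<tau> :: real
  have split: "S \<tau> (E \<tau>) (Z \<tau>) (m \<tau>)" if "\<tau> \<in> {1, -1}" for \<tau>
    using that S1 S2 by (auto simp: E_def Z_def m_def)
  interpret boundary_pair J T c E Z m
  proof (rule boundary_pair.intro)
    show "cinner (T \<sigma> u) v = cinner u (T (- \<sigma>) v)" if "\<sigma> \<in> {1, -1}" for \<sigma> u v
      unfolding T_def by (rule boundary_adjoint[OF s0 that])
    show "0 \<le> \<sigma> * Im (cinner u (T \<sigma> u))" if "\<sigma> \<in> {1, -1}" for \<sigma> u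
      unfolding T_def by (rule boundary_dissipative[OF s0 that])
    show "pencil_splitting (id_blinfun + cscale (of_real c) (T \<tau> o\<^sub>L J)) (E \<tau>) (Z \<tau>) (m \<tau>) (T \<tau> o\<^sub>L J) (of_real c)"
      if "\<tau> \<in> {1, -1}" for \<tau>
      using split[OF that] by (simp only: S_def)
  qed (rule clinear_J J_symmetric)+
  have split': "pencil_splitting (X \<tau>) (E \<tau>) (Z \<tau>) (m \<tau>) (Aop \<tau> s0) (of_real (r - s0))"
    if "\<tau> \<in> {1, -1}" for \<tau>
    using splitting[OF that] by (simp only: A A_def c_def)
  have P: "Pid \<tau> r = E \<tau>" and nil: "A_nil F J H\<^sub>0 lam \<tau> r = N \<tau>" if "\<tau> \<in> {1, -1}" for \<tau>
    using P_idem_A_nil_eq[OF that split'[OF that], folded c_def] by (simp_all only: N_def)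
  have Uj: "Ups \<tau> r i = {u \<in> ups \<tau>. (blinfun_apply (N \<tau>) ^^ i) u = 0}"
    if \<tau>: "\<tau> \<in> {1, -1}" for \<tau> i
  proof -
    have "id_blinfun + (r - s0) *\<^sub>R Aop \<tau> s0 = X \<tau>"
      unfolding X_def A A_def cscale_of_real by (simp only: c_def)
    then show ?thesis
      unfolding Upsilon_j_base_point[OF \<tau>] by (simp only: kernel_X_funpow[OF \<tau>])
  qed
  have U: "Upsilon F J H\<^sub>0 lam \<tau> r = ups \<tau>" if \<tau>: "\<tau> \<in> {1, -1}" for \<tau>
  proof -
    \<comment> \<open>\<open>N \<tau>\<close> is nilpotent, so the union over all orders exhausts
      \<open>ups \<tau>\<close>.\<close>
    have "\<exists>i. (blinfun_apply (N \<tau>) ^^ i) u = 0" for u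
      using pencil_splitting.nilp_nilpotent[OF splitting[OF \<tau>]] unfolding N_def by blast
    then show ?thesis unfolding Upsilon_def Uj[OF \<tau>] by blast
  qed
  obtain M Y where decomposition: "\<forall>\<sigma>\<in>{1, -1}. jordan_decomposition (A_nil F J H\<^sub>0 lam \<sigma> r) (Upsilon F J H\<^sub>0 lam \<sigma> r) M (Y \<sigma>)"
    and blocks: "\<forall>\<sigma>\<in>{1, -1}. \<forall>\<nu>\<in>{1..M}. Pid \<sigma> r ` Y (- \<sigma>) \<nu> = Y \<sigma> \<nu>"
    using C unfolding property_C_def Let_def by blast
  have "bij_betw (E \<sigma>) {u \<in> ups (- \<sigma>). (blinfun_apply (N (- \<sigma>)) ^^ j) u = 0} {u \<in> ups \<sigma>. (blinfun_apply (N \<sigma>) ^^ j) u = 0}"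
  proof (rule bij_betw_generalized_kernels[OF _ _ \<sigma>])
    show "jordan_decomposition (N \<tau>) (ups \<tau>) M (Y \<tau>)" if "\<tau> \<in> {1, -1}" for \<tau>
      using bspec[OF decomposition that] by (simp only: nil[OF that] U[OF that])
    show "E \<tau> ` Y (- \<tau>) \<nu> = Y \<tau> \<nu>" if "\<tau> \<in> {1, -1}" "\<nu> \<in> {1..M}" for \<tau> \<nu>
      using bspec[OF bspec[OF blocks that(1)] that(2)] by (simp only: P[OF that(1)])
  qed
  then show "bij_betw (Pid \<sigma> r) (Ups (- \<sigma>) r j) (Ups \<sigma> r j)"
    by (simp only: P[OF \<sigma>] Uj[OF \<sigma>] Uj[OF uminus_sign[OF \<sigma>]])
  show "clinear_blinfun (Pid \<sigma> r)"
    unfolding P[OF \<sigma>] by (rule clinear_E[OF \<sigma>])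
  obtain EB ZB mB where EB: "pencil_splitting (id_blinfun + cscale (of_real (r - s0)) (Bop \<sigma> s0)) EB ZB mB (Bop \<sigma> s0) (of_real (r - s0))"
    using pencil_splitting_exists[OF B_op_compact_clinear[OF \<sigma>]] by blast
  have Q: "Qid \<sigma> r = EB" by (rule Q_idem_eq[OF \<sigma> EB])
  show "clinear_blinfun (Qid \<sigma> r)"
    unfolding Q by (rule pencil_splitting.clinear_E[OF EB])
  have "EB (J u) = J (E \<sigma> u)"
  proof (rule riesz_projections_intertwine[OF pencil_splitting.axioms(1)[OF splitting[OF \<sigma>]] pencil_splitting.axioms(1)[OF EB]])
    show "(id_blinfun + cscale (of_real (r - s0)) (Bop \<sigma> s0)) (J x) = J (X \<sigma> x)" for x
      unfolding B X_def A_def c_def[symmetric]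
      by (simp add: blinfun.add_left blinfun.add_right clinear_blinfunD[OF clinear_J])
  qed
  then show "Qid \<sigma> r (J u) = J (Pid \<sigma> r u)"
    by (simp only: Q P[OF \<sigma>])
qed

end

end

theorem theorem1p36:
  fixes F :: "('h::complex_hilbert_space \<times> 'k::complex_hilbert_space) set"
    and J :: "'k \<Rightarrow>\<^sub>L 'k"
    and H\<^sub>0 :: "('h \<times> 'h) set"
    and D :: "'h set"
    and lam r \<sigma> :: real
    and j :: nat
  assumes line: "resonance_line F J H\<^sub>0 D"
    and regular_line: "nonresonant_points F J H\<^sub>0 lam \<noteq> {}"
    and resonance_point: "r \<notin> nonresonant_points F J H\<^sub>0 lam"
    and property_C: "property_C F J H\<^sub>0 lam r"
    and sign: "\<sigma> \<in> {1, -1}"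
    and j: "1 \<le> j"
  shows "clinear_iso_betw (P_idem F J H\<^sub>0 lam \<sigma> r)
            (Upsilon_j F J H\<^sub>0 lam (- \<sigma>) r j) (Upsilon_j F J H\<^sub>0 lam \<sigma> r j) \<and>
         clinear_iso_betw (Q_idem F J H\<^sub>0 lam \<sigma> r)
            (Psi_j F J H\<^sub>0 lam (- \<sigma>) r j) (Psi_j F J H\<^sub>0 lam \<sigma> r j) \<and>
         clinear_iso_betw J
            (Upsilon_j F J H\<^sub>0 lam \<sigma> r j) (Psi_j F J H\<^sub>0 lam \<sigma> r j) \<and>
         (\<forall>u\<in>Upsilon_j F J H\<^sub>0 lam (- \<sigma>) r j.
            Q_idem F J H\<^sub>0 lam \<sigma> r (J u) = J (P_idem F J H\<^sub>0 lam \<sigma> r u))"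
proof -
  interpret resonance_line F J H\<^sub>0 D by (rule line)
  obtain s0 where s0: "s0 \<in> nonresonant_points F J H\<^sub>0 lam" using regular_line by blast
  have \<tau>: "- \<sigma> \<in> {1, -1}" using sign by auto
  note iso = resonance_isomorphisms[OF s0 property_C sign]
  let ?U = "\<lambda>\<sigma>. Upsilon_j F J H\<^sub>0 lam \<sigma> r j" and ?\<Psi> = "\<lambda>\<sigma>. Psi_j F J H\<^sub>0 lam \<sigma> r j"
  let ?P = "P_idem F J H\<^sub>0 lam \<sigma> r" and ?Q = "Q_idem F J H\<^sub>0 lam \<sigma> r"
  have U: "complex_vector.subspace (?U \<tau>)" if "\<tau> \<in> {1, -1}" for \<tau>
    unfolding Upsilon_j_base_point[OF s0 that]
    by (intro subspace_kernel_funpow clinear_blinfun_intros A_op_compact_clinear[OF s0 that])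
  have \<Psi>: "complex_vector.subspace (?\<Psi> \<tau>)" if "\<tau> \<in> {1, -1}" for \<tau>
    unfolding Psi_j_base_point[OF s0 that]
    by (intro subspace_kernel_funpow clinear_blinfun_intros B_op_compact_clinear[OF s0 that])
  have "bij_betw (blinfun_apply J \<circ> blinfun_apply ?P) (?U (- \<sigma>)) (?\<Psi> \<sigma>)"
    by (rule bij_betw_trans[OF iso(1) bij_betw_J[OF s0 sign]])
  \<comment> \<open>Since \<open>Q J = J P\<close>, the bijection \<open>J\<close> can be cancelled
    on the right, which leaves bijectivity of \<open>Q\<close>.\<close>
  then have "bij_betw (blinfun_apply ?Q \<circ> blinfun_apply J) (?U (- \<sigma>)) (?\<Psi> \<sigma>)"
    by (simp add: o_def iso(2))
  then have Q: "bij_betw ?Q (?\<Psi> (- \<sigma>)) (?\<Psi> \<sigma>)"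
    using bij_betw_comp_iff[OF bij_betw_J[OF s0 \<tau>]] by blast
  show ?thesis
    by (intro conjI ballI clinear_iso_betwI iso U \<Psi> \<tau> sign Q clinear_J bij_betw_J[OF s0 sign])
qed

end
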